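(* Let $I$ be a singular support of the diagonal action. The quotient map $q_I:(\mathbb C^J,0)\to(Q_I,o_I)$ induces a morphism $\mathbf q_I:\mathfrak X_I\to(Q_I,o_I)$ from the residual analytic quotient stack $\mathfrak X_I=[(\mathbb C^J,0)/\mathfrak h_I]$ with the following universal property: for every complex analytic germ $(Y,y)$, composition with $\mathbf q_I$ gives a natural bijection $$\operatorname{Hom}_{\mathrm{An}}((Q_I,o_I),(Y,y))\xrightarrow{\ \sim\ }\operatorname{Hom}_{\mathrm{AnSt}}(\mathfrak X_I,(Y,y)).$$
   Context: Let $\mathfrak g=\mathbb C^k$, let $\Lambda_1,\dots,\Lambda_n$ span $\mathfrak g^*$ (weights of the diagonal action $t\cdot z=(e^{\Lambda_j(t)}z_j)_j$ on $\mathbb C^n$). For $I\subset\{1,\dots,n\}$: $J=I^c$, $\mathfrak h_I=\bigcap_{i\in I}\ker\Lambda_i$, $\mu_j=\Lambda_j|_{\mathfrak h_I}$; $I$ is singular if $\dim\operatorname{Span}\{\Lambda_i:i\in I\}<k$. $S_I=\{\alpha\in\mathbb N^J:\sum_{j\in J}\alpha_j\mu_j=0\}$ ($0\in\mathbb N$), $Q_I=\operatorname{Spec}\mathbb C[S_I]$ (analytified), $q_I^*X^\alpha=w^\alpha$, $o_I=q_I(0)$. The vector group $\mathfrak h_I$ acts on $(\mathbb C^J,0)$ by $v\cdot(w_j)=(e^{\mu_j(v)}w_j)$. $\mathrm{An}$ is the category of complex analytic germs, $\mathrm{AnSt}$ denotes analytic stacks, and $\operatorname{Hom}_{\mathrm{AnSt}}$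 denotes morphisms up to 2-isomorphism. The stack $\mathfrak X_I$ is the quotient stack presented by the action groupoid $\mathfrak h_I\times(\mathbb C^J,0)\rightrightarrows(\mathbb C^J,0)$ with $s(v,w)=w$ and $t(v,w)=v\cdot w$; a morphism from $\mathfrak X_I$ to a representable analytic germ $(Y,y)$ is represented by a holomorphic germ $F:(\mathbb C^J,0)\to(Y,y)$ with $F\circ s=F\circ t$ (invariance under the residual $\mathfrak h_I$-action). *)

theory Defs
  imports "HOL-Analysis.Analysis" "HOL-Algebra.Ideal" "HOL-Library.Poly_Mapping"
begin

abbreviation "keys \<equiv> Poly_Mapping.keys"
abbreviation "lookup \<equiv> Poly_Mapping.lookup"

section \<open>Holomorphic function germs\<close>

text \<open>For a finite set \<open>A\<close> of coordinate names, \<open>cspace A\<close> is the affine space with coordinates \<open>A\<close>,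
  realised as the functions vanishing outside \<open>A\<close>.\<close>

definition cspace :: "'a set \<Rightarrow> ('a \<Rightarrow> complex) set" where
  "cspace A = {z. \<forall>a. a \<notin> A \<longrightarrow> z a = 0}"

definition polydisc :: "'a set \<Rightarrow> ('a \<Rightarrow> complex) \<Rightarrow> real \<Rightarrow> ('a \<Rightarrow> complex) set" where
  "polydisc A p r = {z \<in> cspace A. \<forall>a\<in>A. dist (z a) (p a) < r}"

definition germ_nhds :: "'a set \<Rightarrow> ('a \<Rightarrow> complex) \<Rightarrow> ('a \<Rightarrow> complex) filter" where
  "germ_nhds A p = (INF r\<in>{0<..}. principal (polydisc A p r))"

text \<open>Holomorphic at \<open>p\<close>: near \<open>p\<close> the function is the sum of a convergent power series in \<open>z - p\<close>.\<close>

definition holomorphic_at :: "'a set \<Rightarrow> ('a \<Rightarrow> complex) \<Rightarrow> (('a \<Rightarrow> complex) \<Rightarrow> complex) \<Rightarrow> bool" where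
  "holomorphic_at A p f \<longleftrightarrow>
     (\<exists>c :: ('a \<Rightarrow>\<^sub>0 nat) \<Rightarrow> complex. \<forall>\<^sub>F z in germ_nhds A p.
        ((\<lambda>\<alpha>. c \<alpha> * (\<Prod>a\<in>A. (z a - p a) ^ lookup \<alpha> a)) has_sum f z) {\<alpha>. keys \<alpha> \<subseteq> A})"

text \<open>The ring of functions holomorphic at \<open>p\<close>. Its quotient by \<open>null_ideal A p\<close> is the local ring of
  convergent power series at \<open>p\<close>, so ideals of that local ring are the ideals of \<open>hol_ring A p\<close>
  containing \<open>null_ideal A p\<close>.\<close>

definition hol_ring :: "'a set \<Rightarrow> ('a \<Rightarrow> complex) \<Rightarrow> (('a \<Rightarrow> complex) \<Rightarrow> complex) ring" where
  "hol_ring A p = \<lparr>carrier = {f. holomorphic_at A p f},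
     mult = (\<lambda>f g z. f z * g z), one = (\<lambda>z. 1), zero = (\<lambda>z. 0), add = (\<lambda>f g z. f z + g z)\<rparr>"

definition null_ideal :: "'a set \<Rightarrow> ('a \<Rightarrow> complex) \<Rightarrow> (('a \<Rightarrow> complex) \<Rightarrow> complex) set" where
  "null_ideal A p = {f. \<forall>\<^sub>F z in germ_nhds A p. f z = 0}"


section \<open>The category of complex analytic germs\<close>

text \<open>A germ is given as the closed subgerm of \<open>(cspace A, p)\<close> cut out by an ideal of the local ring at
  \<open>p\<close>; it may be non-reduced. The local ring is Noetherian, so every ideal is allowed; the ideal
  vanishes at \<open>p\<close> since \<open>p\<close> is a point of the germ. The structure ring of the germ is \<open>hol_ring A p\<close>
  modulo the ideal.\<close>

record 'a germ =
  coords :: "'a set"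
  base :: "'a \<Rightarrow> complex"
  eqns :: "(('a \<Rightarrow> complex) \<Rightarrow> complex) set"

definition analytic_germ :: "'a germ \<Rightarrow> bool" where
  "analytic_germ X \<longleftrightarrow>
     finite (coords X) \<and> base X \<in> cspace (coords X) \<and>
     ideal (eqns X) (hol_ring (coords X) (base X)) \<and>
     null_ideal (coords X) (base X) \<subseteq> eqns X \<and>
     (\<forall>f\<in>eqns X. f (base X) = 0)"

text \<open>A morphism is represented by a holomorphic map of the ambient spaces that pulls the ideal of the
  target back into the ideal of the source; two representatives give the same morphism iff their
  components agree in the structure ring of the source.\<close>

definition germ_map :: "'a germ \<Rightarrow> 'b germ \<Rightarrow> (('a \<Rightarrow> complex) \<Rightarrow> ('b \<Rightarrow> complex)) \<Rightarrow> bool" where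
  "germ_map X Y \<Phi> \<longleftrightarrow>
     (\<forall>z. \<Phi> z \<in> cspace (coords Y)) \<and>
     (\<forall>b\<in>coords Y. holomorphic_at (coords X) (base X) (\<lambda>z. \<Phi> z b)) \<and>
     \<Phi> (base X) = base Y \<and>
     (\<forall>g\<in>eqns Y. g \<circ> \<Phi> \<in> eqns X)"

definition germ_map_rel ::
  "'a germ \<Rightarrow> 'b germ \<Rightarrow> ((('a \<Rightarrow> complex) \<Rightarrow> ('b \<Rightarrow> complex)) \<times> (('a \<Rightarrow> complex) \<Rightarrow> ('b \<Rightarrow> complex))) set" where
  "germ_map_rel X Y =
     {(\<Phi>, \<Psi>). germ_map X Y \<Phi> \<and> germ_map X Y \<Psi> \<and>
        (\<forall>b\<in>coords Y. (\<lambda>z. \<Phi> z b - \<Psi> z b) \<in> eqns X)}"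

definition Hom_An :: "'a germ \<Rightarrow> 'b germ \<Rightarrow> (('a \<Rightarrow> complex) \<Rightarrow> ('b \<Rightarrow> complex)) set set" where
  "Hom_An X Y = {\<Phi>. germ_map X Y \<Phi>} // germ_map_rel X Y"

definition germ_comp ::
  "'a germ \<Rightarrow> 'c germ \<Rightarrow> (('b \<Rightarrow> complex) \<Rightarrow> ('c \<Rightarrow> complex)) set \<Rightarrow>
   (('a \<Rightarrow> complex) \<Rightarrow> ('b \<Rightarrow> complex)) set \<Rightarrow> (('a \<Rightarrow> complex) \<Rightarrow> ('c \<Rightarrow> complex)) set" where
  "germ_comp X Z g f = (\<Union>\<Psi>\<in>g. \<Union>\<Phi>\<in>f. germ_map_rel X Z `` {\<Psi> \<circ> \<Phi>})"

definition affine_germ :: "'a set \<Rightarrow> 'a germ" where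
  "affine_germ A = \<lparr>coords = A, base = (\<lambda>_. 0), eqns = null_ideal A (\<lambda>_. 0)\<rparr>"


section \<open>Quotient stacks presented by groupoids\<close>

text \<open>A groupoid presentation consists of an object germ, an arrow space and the source and target maps.
  The arrow space \<open>h \<times> (\<complex>\<^sup>J, 0)\<close> is a germ along \<open>h \<times> {0}\<close>, not at a point; it is recorded by the
  filter of neighbourhoods of that locus. It is a manifold, so two morphisms from it into a closed
  subgerm of an affine space are equal iff their underlying maps agree near the locus. The unit and
  the composition of arrows play no role for morphisms into representable germs.\<close>

record ('v, 'a) groupoid_pres =
  objects :: "'a germ"
  arrows :: "('v \<times> ('a \<Rightarrow> complex)) filter"
  src :: "'v \<times> ('a \<Rightarrow> complex) \<Rightarrow> ('a \<Rightarrow> complex)"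
  tgt :: "'v \<times> ('a \<Rightarrow> complex) \<Rightarrow> ('a \<Rightarrow> complex)"

text \<open>Morphisms from the presented stack to a representable germ: morphisms \<open>F\<close> from the object germ with
  \<open>F \<circ> s = F \<circ> t\<close>. As the target is representable, 2-isomorphic morphisms are equal.\<close>

definition Hom_AnSt ::
  "('v, 'a) groupoid_pres \<Rightarrow> 'b germ \<Rightarrow> (('a \<Rightarrow> complex) \<Rightarrow> ('b \<Rightarrow> complex)) set set" where
  "Hom_AnSt \<XX> Y =
     {f \<in> Hom_An (objects \<XX>) Y. \<forall>F\<in>f. \<forall>\<^sub>F x in arrows \<XX>. F (src \<XX> x) = F (tgt \<XX> x)}"

abbreviation stack_comp ::
  "('v, 'a) groupoid_pres \<Rightarrow> 'c germ \<Rightarrow> (('b \<Rightarrow> complex) \<Rightarrow> ('c \<Rightarrow> complex)) set \<Rightarrow>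
   (('a \<Rightarrow> complex) \<Rightarrow> ('b \<Rightarrow> complex)) set \<Rightarrow> (('a \<Rightarrow> complex) \<Rightarrow> ('c \<Rightarrow> complex)) set" where
  "stack_comp \<XX> Z g f \<equiv> germ_comp (objects \<XX>) Z g f"


section \<open>Germs of analytified affine schemes\<close>

text \<open>Polynomials in variables of type \<open>'x\<close> over \<open>\<complex>\<close> are elements of \<open>('x \<Rightarrow>\<^sub>0 nat) \<Rightarrow>\<^sub>0 complex\<close>;
  \<open>poly_subst \<iota> \<theta>\<close> substitutes \<open>\<theta> x\<close> for each variable \<open>x\<close>, where \<open>\<iota>\<close> is the structure map of the
  target algebra.\<close>

definition poly_subst ::
  "(complex \<Rightarrow> 'r) \<Rightarrow> ('x \<Rightarrow> 'r) \<Rightarrow> (('x \<Rightarrow>\<^sub>0 nat) \<Rightarrow>\<^sub>0 complex) \<Rightarrow> 'r::comm_ring_1" where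
  "poly_subst \<iota> \<theta> P = (\<Sum>\<beta>\<in>keys P. \<iota> (lookup P \<beta>) * (\<Prod>x\<in>keys \<beta>. \<theta> x ^ lookup \<beta> x))"

definition polys_in :: "'x set \<Rightarrow> (('x \<Rightarrow>\<^sub>0 nat) \<Rightarrow>\<^sub>0 complex) set" where
  "polys_in G = {P. \<forall>\<beta>\<in>keys P. keys \<beta> \<subseteq> G}"

text \<open>Let \<open>R\<close> be the algebra generated by \<open>G\<close> and \<open>pt\<close> a character of \<open>R\<close>. The presentation of \<open>R\<close> by the
  polynomial ring in the variables \<open>G\<close> embeds \<open>Spec R\<close> into the affine space \<open>cspace G\<close>; its
  analytification is cut out by the ideal generated by the polynomial relations between the
  generators. This is its germ at the point \<open>pt\<close>.\<close>

definition an_spec_germ :: "(complex \<Rightarrow> 'r) \<Rightarrow> 'r set \<Rightarrow> ('r \<Rightarrow> complex) \<Rightarrow> 'r::comm_ring_1 germ" where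
  "an_spec_germ \<iota> G pt =
     (let x0 = (\<lambda>x. if x \<in> G then pt x else 0) in
      \<lparr>coords = G, base = x0,
       eqns = Idl\<^bsub>hol_ring G x0\<^esub>
         (null_ideal G x0 \<union>
          {(\<lambda>z. poly_subst (\<lambda>c. c) z P) | P. P \<in> polys_in G \<and> poly_subst \<iota> (\<lambda>x. x) P = 0})\<rparr>)"


section \<open>The residual data of a diagonal action\<close>

text \<open>\<open>\<gg> = \<complex>\<^sup>k\<close> is \<open>complex ^ 'k\<close>; a weight is given by its coordinates with respect to the dual of the
  standard basis, and \<open>weight\<close> is the bilinear pairing.\<close>

definition weight :: "complex ^ 'k \<Rightarrow> complex ^ 'k \<Rightarrow> complex" where
  "weight L t = (\<Sum>i\<in>UNIV. L $ i * t $ i)"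

definition singular_support :: "('n \<Rightarrow> complex ^ 'k) \<Rightarrow> 'n set \<Rightarrow> bool" where
  "singular_support \<Lambda> I \<longleftrightarrow> vec.dim (vec.span (\<Lambda> ` I)) < CARD('k)"

definition residual_algebra :: "('n \<Rightarrow> complex ^ 'k) \<Rightarrow> 'n set \<Rightarrow> (complex ^ 'k) set" where
  "residual_algebra \<Lambda> I = {v. \<forall>i\<in>I. weight (\<Lambda> i) v = 0}"

definition residual_action ::
  "('n \<Rightarrow> complex ^ 'k) \<Rightarrow> complex ^ 'k \<Rightarrow> ('n \<Rightarrow> complex) \<Rightarrow> ('n \<Rightarrow> complex)" where
  "residual_action \<Lambda> v w = (\<lambda>j. exp (weight (\<Lambda> j) v) * w j)"

definition residual_stack :: "('n \<Rightarrow> complex ^ 'k) \<Rightarrow> 'n set \<Rightarrow> (complex ^ 'k, 'n) groupoid_pres" where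
  "residual_stack \<Lambda> I =
     \<lparr>objects = affine_germ (- I),
      arrows = (SUP v\<in>residual_algebra \<Lambda> I.
        nhdsin (top_of_set (residual_algebra \<Lambda> I)) v \<times>\<^sub>F germ_nhds (- I) (\<lambda>_. 0)),
      src = (\<lambda>(v, w). w),
      tgt = (\<lambda>(v, w). residual_action \<Lambda> v w)\<rparr>"

definition residual_monoid :: "('n::finite \<Rightarrow> complex ^ 'k) \<Rightarrow> 'n set \<Rightarrow> ('n \<Rightarrow>\<^sub>0 nat) set" where
  "residual_monoid \<Lambda> I =
     {\<alpha>. keys \<alpha> \<subseteq> - I \<and>
        (\<forall>v\<in>residual_algebra \<Lambda> I. (\<Sum>j\<in>- I. of_nat (lookup \<alpha> j) * weight (\<Lambda> j) v) = 0)}"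

definition monoid_algebra :: "('n \<Rightarrow>\<^sub>0 nat) set \<Rightarrow> (('n \<Rightarrow>\<^sub>0 nat) \<Rightarrow>\<^sub>0 complex) set" where
  "monoid_algebra S = {p. keys p \<subseteq> S}"

definition character_monomial :: "('n \<Rightarrow>\<^sub>0 nat) \<Rightarrow> (('n \<Rightarrow>\<^sub>0 nat) \<Rightarrow>\<^sub>0 complex)" where
  "character_monomial \<alpha> = Poly_Mapping.single \<alpha> 1"

definition hilbert_basis :: "('n \<Rightarrow>\<^sub>0 nat) set \<Rightarrow> ('n \<Rightarrow>\<^sub>0 nat) set" where
  "hilbert_basis S = {\<alpha>\<in>S. \<alpha> \<noteq> 0 \<and> (\<forall>\<beta>\<in>S. \<forall>\<gamma>\<in>S. \<alpha> = \<beta> + \<gamma> \<longrightarrow> \<beta> = 0 \<or> \<gamma> = 0)}"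

definition residual_gens :: "('n::finite \<Rightarrow> complex ^ 'k) \<Rightarrow> 'n set \<Rightarrow> (('n \<Rightarrow>\<^sub>0 nat) \<Rightarrow>\<^sub>0 complex) set" where
  "residual_gens \<Lambda> I = character_monomial ` hilbert_basis (residual_monoid \<Lambda> I)"

text \<open>\<open>quotient_germ \<Lambda> I\<close> is \<open>(Q\<^sub>I, o\<^sub>I)\<close>: the base point is the character of \<open>\<complex>[S\<^sub>I]\<close> given by evaluation
  at \<open>w = 0\<close>. A point of \<open>Q\<^sub>I\<close> has one coordinate for each generator \<open>X\<^sup>\<alpha>\<close>, and the map \<open>q\<^sub>I\<close>
  evaluates \<open>X\<^sup>\<alpha>\<close> at \<open>w\<close>.\<close>

definition quotient_germ :: "('n::finite \<Rightarrow> complex ^ 'k) \<Rightarrow> 'n set \<Rightarrow> (('n \<Rightarrow>\<^sub>0 nat) \<Rightarrow>\<^sub>0 complex) germ" where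
  "quotient_germ \<Lambda> I =
     an_spec_germ (Poly_Mapping.single 0) (residual_gens \<Lambda> I) (poly_subst (\<lambda>c. c) (\<lambda>_. 0))"

definition residual_quotient_map ::
  "('n::finite \<Rightarrow> complex ^ 'k) \<Rightarrow> 'n set \<Rightarrow> ('n \<Rightarrow> complex) \<Rightarrow> ((('n \<Rightarrow>\<^sub>0 nat) \<Rightarrow>\<^sub>0 complex) \<Rightarrow> complex)" where
  "residual_quotient_map \<Lambda> I w = (\<lambda>x. if x \<in> residual_gens \<Lambda> I then poly_subst (\<lambda>c. c) w x else 0)"

definition quotient_morphism ::
  "('n::finite \<Rightarrow> complex ^ 'k) \<Rightarrow> 'n set \<Rightarrow>
   (('n \<Rightarrow> complex) \<Rightarrow> ((('n \<Rightarrow>\<^sub>0 nat) \<Rightarrow>\<^sub>0 complex) \<Rightarrow> complex)) set" where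
  "quotient_morphism \<Lambda> I =
     germ_map_rel (affine_germ (- I)) (quotient_germ \<Lambda> I) `` {residual_quotient_map \<Lambda> I}"

text \<open>The germ \<open>(Q\<^sub>I, o\<^sub>I)\<close> is built from the generators \<open>residual_gens \<Lambda> I\<close>; these do generate the
  algebra \<open>\<complex>[S\<^sub>I]\<close>.\<close>

lemma poly_subst_superset:
  assumes "finite B" "keys P \<subseteq> B" "\<iota> 0 = 0"
  shows "poly_subst \<iota> \<theta> P = (\<Sum>\<beta>\<in>B. \<iota> (lookup P \<beta>) * (\<Prod>x\<in>keys \<beta>. \<theta> x ^ lookup \<beta> x))"
  unfolding poly_subst_def using assms
  by (intro sum.mono_neutral_left) (auto simp: in_keys_iff)

lemma poly_subst_add:
  fixes \<iota> :: "complex \<Rightarrow> 'r::comm_ring_1"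
  assumes "\<iota> 0 = 0" "\<And>a b. \<iota> (a + b) = \<iota> a + \<iota> b"
  shows "poly_subst \<iota> \<theta> (P + Q) = poly_subst \<iota> \<theta> P + poly_subst \<iota> \<theta> Q"
proof -
  let ?B = "keys P \<union> keys Q"
  have B: "finite ?B" "keys P \<subseteq> ?B" "keys Q \<subseteq> ?B" "keys (P + Q) \<subseteq> ?B"
    using keys_add[of P Q] by auto
  show ?thesis
    unfolding poly_subst_superset[of ?B _ \<iota>, OF B(1) B(2) assms(1)]
      poly_subst_superset[of ?B _ \<iota>, OF B(1) B(3) assms(1)]
      poly_subst_superset[of ?B _ \<iota>, OF B(1) B(4) assms(1)]
    by (simp add: lookup_add assms(2) distrib_right sum.distrib)
qed

lemma poly_subst_zero: "poly_subst \<iota> \<theta> 0 = 0"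
  by (simp add: poly_subst_def)

lemma poly_subst_sum:
  fixes \<iota> :: "complex \<Rightarrow> 'r::comm_ring_1"
  assumes "\<iota> 0 = 0" "\<And>a b. \<iota> (a + b) = \<iota> a + \<iota> b"
  shows "poly_subst \<iota> \<theta> (\<Sum>a\<in>A. P a) = (\<Sum>a\<in>A. poly_subst \<iota> \<theta> (P a))"
  by (induction A rule: infinite_finite_induct)
    (simp_all add: poly_subst_add[of \<iota>, OF assms] poly_subst_zero)

lemma power_prod_add:
  fixes \<theta> :: "'x \<Rightarrow> 'r::comm_ring_1"
  shows "(\<Prod>x\<in>keys (\<beta> + \<gamma>). \<theta> x ^ lookup (\<beta> + \<gamma>) x) =
     (\<Prod>x\<in>keys \<beta>. \<theta> x ^ lookup \<beta> x) * (\<Prod>x\<in>keys \<gamma>. \<theta> x ^ lookup \<gamma> x)"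
proof -
  let ?B = "keys \<beta> \<union> keys \<gamma>"
  have *: "(\<Prod>x\<in>keys \<delta>. \<theta> x ^ lookup \<delta> x) = (\<Prod>x\<in>?B. \<theta> x ^ lookup \<delta> x)"
    if "keys \<delta> \<subseteq> ?B" for \<delta>
    using that by (intro prod.mono_neutral_left) (auto simp: in_keys_iff)
  show ?thesis
    unfolding *[of "\<beta> + \<gamma>", OF keys_add] *[of \<beta>, OF Un_upper1] *[of \<gamma>, OF Un_upper2]
    by (simp add: lookup_add power_add prod.distrib)
qed

lemma residual_monoid_add:
  assumes "\<alpha> \<in> residual_monoid \<Lambda> I" "\<beta> \<in> residual_monoid \<Lambda> I"
  shows "\<alpha> + \<beta> \<in> residual_monoid \<Lambda> I"
  using assms keys_add[of \<alpha> \<beta>]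
  by (fastforce simp: residual_monoid_def lookup_add distrib_right sum.distrib)

lemma monomial_in_residual_algebra:
  assumes "keys \<beta> \<subseteq> residual_gens \<Lambda> I"
  shows "\<exists>\<alpha>\<in>residual_monoid \<Lambda> I. (\<Prod>x\<in>keys \<beta>. x ^ lookup \<beta> x) = character_monomial \<alpha>"
proof -
  let ?M = "residual_monoid \<Lambda> I"
  have 0: "0 \<in> ?M" by (simp add: residual_monoid_def)
  have one: "character_monomial (0 :: 'a \<Rightarrow>\<^sub>0 nat) = 1" by (simp add: character_monomial_def)
  have mult: "character_monomial a * character_monomial b = character_monomial (a + b)"
    for a b :: "'a \<Rightarrow>\<^sub>0 nat"
    by (simp add: character_monomial_def Poly_Mapping.mult_single)
  have pow: "\<exists>\<alpha>\<in>?M. x ^ m = character_monomial \<alpha>" if "x \<in> residual_gens \<Lambda> I" for x m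
  proof (induction m)
    case 0
    then show ?case using \<open>0 \<in> ?M\<close> one by (metis power_0)
  next
    case (Suc m)
    then obtain a where a: "a \<in> ?M" "x ^ m = character_monomial a" by blast
    from that obtain b where b: "b \<in> ?M" "x = character_monomial b"
      by (auto simp: residual_gens_def hilbert_basis_def)
    have "x ^ Suc m = character_monomial (b + a)"
      using a b by (simp add: mult)
    then show ?case using residual_monoid_add[OF b(1) a(1)] by blast
  qed
  have "finite A \<Longrightarrow> A \<subseteq> residual_gens \<Lambda> I \<Longrightarrow>
      \<exists>\<alpha>\<in>?M. (\<Prod>x\<in>A. x ^ lookup \<beta> x) = character_monomial \<alpha>" for A
  proof (induction A rule: finite_induct)
    case empty
    then show ?case using 0 one by (metis prod.empty)
  next
    case (insert x A)
    then obtain a where a: "a \<in> ?M" "(\<Prod>x\<in>A. x ^ lookup \<beta> x) = character_monomial a" by auto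
    from insert.prems pow[of x "lookup \<beta> x"] obtain b
      where b: "b \<in> ?M" "x ^ lookup \<beta> x = character_monomial b" by auto
    have "(\<Prod>x\<in>insert x A. x ^ lookup \<beta> x) = character_monomial (b + a)"
      using insert.hyps a b by (simp add: mult)
    then show ?case using residual_monoid_add[OF b(1) a(1)] by blast
  qed
  then show ?thesis using assms by simp
qed

lemma residual_monomial_generated:
  assumes "\<alpha> \<in> residual_monoid \<Lambda> I"
  shows "\<exists>\<beta>. keys \<beta> \<subseteq> residual_gens \<Lambda> I \<and> (\<Prod>x\<in>keys \<beta>. x ^ lookup \<beta> x) = character_monomial \<alpha>"
  using assms
proof (induction "\<Sum>j\<in>UNIV. lookup \<alpha> j" arbitrary: \<alpha> rule: less_induct)
  case less
  let ?M = "residual_monoid \<Lambda> I"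
  consider "\<alpha> = 0" | "\<alpha> \<in> hilbert_basis ?M"
    | b c where "b \<in> ?M" "c \<in> ?M" "\<alpha> = b + c" "b \<noteq> 0" "c \<noteq> 0"
    using less.prems by (auto simp: hilbert_basis_def)
  then show ?case
  proof cases
    case 1
    then show ?thesis by (intro exI[of _ 0]) (simp add: character_monomial_def)
  next
    case 2
    then show ?thesis
      by (intro exI[of _ "Poly_Mapping.single (character_monomial \<alpha>) 1"])
        (auto simp: residual_gens_def)
  next
    case 3
    have pos: "0 < (\<Sum>j\<in>UNIV. lookup d j)" if "d \<noteq> 0" for d :: "'a \<Rightarrow>\<^sub>0 nat"
    proof -
      from that obtain j where "lookup d j \<noteq> 0" by (metis lookup_zero poly_mapping_eqI)
      then show ?thesis by (intro sum_pos2[of _ j]) auto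
    qed
    have sz: "(\<Sum>j\<in>UNIV. lookup \<alpha> j) = (\<Sum>j\<in>UNIV. lookup b j) + (\<Sum>j\<in>UNIV. lookup c j)"
      by (simp add: 3 lookup_add sum.distrib)
    obtain \<beta> where \<beta>: "keys \<beta> \<subseteq> residual_gens \<Lambda> I"
      "(\<Prod>x\<in>keys \<beta>. x ^ lookup \<beta> x) = character_monomial b"
      using less.hyps[of b] 3 sz pos[of c] by auto
    obtain \<gamma> where \<gamma>: "keys \<gamma> \<subseteq> residual_gens \<Lambda> I"
      "(\<Prod>x\<in>keys \<gamma>. x ^ lookup \<gamma> x) = character_monomial c"
      using less.hyps[of c] 3 sz pos[of b] by auto
    have "(\<Prod>x\<in>keys (\<beta> + \<gamma>). x ^ lookup (\<beta> + \<gamma>) x) = character_monomial \<alpha>"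
      using power_prod_add[of "\<lambda>x. x" \<beta> \<gamma>] \<beta> \<gamma> 3
      by (simp add: character_monomial_def Poly_Mapping.mult_single)
    moreover have "keys (\<beta> + \<gamma>) \<subseteq> residual_gens \<Lambda> I"
      using keys_add[of \<beta> \<gamma>] \<beta> \<gamma> by blast
    ultimately show ?thesis by blast
  qed
qed

lemma residual_gens_generate:
  "poly_subst (Poly_Mapping.single 0) (\<lambda>x. x) ` polys_in (residual_gens \<Lambda> I) =
   monoid_algebra (residual_monoid \<Lambda> I)"
proof (intro equalityI subsetI)
  fix p assume "p \<in> poly_subst (Poly_Mapping.single 0) (\<lambda>x. x) ` polys_in (residual_gens \<Lambda> I)"
  then obtain P where P: "P \<in> polys_in (residual_gens \<Lambda> I)"
    "p = poly_subst (Poly_Mapping.single 0) (\<lambda>x. x) P" by blast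
  have "keys (Poly_Mapping.single 0 (lookup P \<beta>) * (\<Prod>x\<in>keys \<beta>. x ^ lookup \<beta> x))
      \<subseteq> residual_monoid \<Lambda> I" if "\<beta> \<in> keys P" for \<beta>
  proof -
    have "keys \<beta> \<subseteq> residual_gens \<Lambda> I" using P(1) that by (auto simp: polys_in_def)
    then obtain \<alpha> where "\<alpha> \<in> residual_monoid \<Lambda> I"
      "(\<Prod>x\<in>keys \<beta>. x ^ lookup \<beta> x) = character_monomial \<alpha>"
      using monomial_in_residual_algebra by blast
    then show ?thesis by (simp add: character_monomial_def Poly_Mapping.mult_single)
  qed
  then show "p \<in> monoid_algebra (residual_monoid \<Lambda> I)"
    unfolding monoid_algebra_def P(2) poly_subst_def
    using keys_sum[of "\<lambda>\<beta>. Poly_Mapping.single 0 (lookup P \<beta>) * (\<Prod>x\<in>keys \<beta>. x ^ lookup \<beta> x)" "keys P"]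
    by blast
next
  fix p assume p: "p \<in> monoid_algebra (residual_monoid \<Lambda> I)"
  have "\<forall>\<alpha>\<in>keys p. \<exists>\<beta>. keys \<beta> \<subseteq> residual_gens \<Lambda> I \<and>
      (\<Prod>x\<in>keys \<beta>. x ^ lookup \<beta> x) = character_monomial \<alpha>"
    using p by (intro ballI residual_monomial_generated) (auto simp: monoid_algebra_def)
  then obtain e where e: "\<And>\<alpha>. \<alpha> \<in> keys p \<Longrightarrow> keys (e \<alpha>) \<subseteq> residual_gens \<Lambda> I"
    "\<And>\<alpha>. \<alpha> \<in> keys p \<Longrightarrow> (\<Prod>x\<in>keys (e \<alpha>). x ^ lookup (e \<alpha>) x) = character_monomial \<alpha>"
    by metis
  define P where "P = (\<Sum>\<alpha>\<in>keys p. Poly_Mapping.single (e \<alpha>) (lookup p \<alpha>))"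
  have "keys P \<subseteq> (\<Union>\<alpha>\<in>keys p. {e \<alpha>})"
    unfolding P_def using keys_sum[of "\<lambda>\<alpha>. Poly_Mapping.single (e \<alpha>) (lookup p \<alpha>)" "keys p"]
    by (auto split: if_splits)
  then have "P \<in> polys_in (residual_gens \<Lambda> I)" using e(1) by (fastforce simp: polys_in_def)
  moreover have "poly_subst (Poly_Mapping.single 0) (\<lambda>x. x) P = p"
  proof -
    have "poly_subst (Poly_Mapping.single 0) (\<lambda>x. x) P =
        (\<Sum>\<alpha>\<in>keys p. poly_subst (Poly_Mapping.single 0) (\<lambda>x. x) (Poly_Mapping.single (e \<alpha>) (lookup p \<alpha>)))"
      unfolding P_def by (rule poly_subst_sum) (auto simp: single_add)
    also have "\<dots> = (\<Sum>\<alpha>\<in>keys p. Poly_Mapping.single \<alpha> (lookup p \<alpha>))"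
      by (intro sum.cong)
        (auto simp: poly_subst_def e(2) character_monomial_def Poly_Mapping.mult_single in_keys_iff)
    also have "\<dots> = p"
      by (rule poly_mapping_eqI)
        (auto simp: lookup_sum lookup_single when_def in_keys_iff sum.delta)
    finally show ?thesis .
  qed
  ultimately show "p \<in> poly_subst (Poly_Mapping.single 0) (\<lambda>x. x) ` polys_in (residual_gens \<Lambda> I)"
    by blast
qed

end

theory Submission
  imports Defs "HOL-Complex_Analysis.Cauchy_Integral_Formula"
begin

text \<open>
  Comparing Taylor coefficients in \<open>F(w) = F(v \<cdot> w)\<close> shows that an invariant germ \<open>F\<close> only involves
  monomials \<open>w\<^sup>\<alpha>\<close> with \<open>\<alpha> \<in> S\<^sub>I\<close>; choosing for each of them a monomial in the generators of \<open>S\<^sub>I\<close> lifts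
  \<open>F\<close> to a power series on the ambient space of \<open>Q\<^sub>I\<close>, which converges when the coordinate of a
  generator of degree \<open>d\<close> is given the radius \<open>s\<^sup>d\<close>.
  The lift is unique modulo the equations of \<open>Q\<^sub>I\<close> because these are exactly the germs \<open>g\<close> with
  \<open>g \<circ> q\<^sub>I = 0\<close>: if \<open>g = \<Sum> c\<^sub>\<beta> z\<^sup>\<beta>\<close> is such a germ, then the coefficients over each fibre of the exponent
  map \<open>\<mu>\<close> sum to zero, so \<open>g\<close> is a series of binomials \<open>z\<^sup>\<beta> - z\<^bsup>\<gamma>\<^esup>\<close> with \<open>\<mu> \<beta> = \<mu> \<gamma>\<close>. By Dickson's lemma
  the pairs \<open>(\<beta>, \<gamma>)\<close> form a finitely generated monoid, and telescoping divides the whole series by the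
  finitely many generating binomials, with convergent quotients.
\<close>

section \<open>Majorized power series\<close>

text \<open>The ideal of \<open>quotient_germ\<close> is generated by polynomial relations, whereas
  uniqueness of the lift concerns every convergent germ that \<open>q\<close> kills. Dividing such a
  germ degree by degree only yields formal quotients. Hence all divisions carry explicit norms:
  exchanging an exponent for another one in its fibre under \<open>\<mu>\<close> costs nothing,
  since the weighted radii only see the degree of the image, and the one loss, a factor linear in
  the degree, is absorbed by halving the radius. Once the ideal is known to be the full kernel of
  pullback along \<open>q\<close>, the object germ and the quotient germ are tested by the same
  filter, that of \<open>(\<complex>^J, 0)\<close>. Injectivity then compares two identical
  conditions, and surjectivity reduces to lifting one function at a time.\<close>

definition mvpow :: "'a set \<Rightarrow> ('a \<Rightarrow> 'c::comm_semiring_1) \<Rightarrow> ('a \<Rightarrow>\<^sub>0 nat) \<Rightarrow> 'c" where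
  "mvpow A z \<alpha> = (\<Prod>a\<in>A. z a ^ lookup \<alpha> a)"

definition exps :: "'a set \<Rightarrow> ('a \<Rightarrow>\<^sub>0 nat) set" where
  "exps A = {\<alpha>. keys \<alpha> \<subseteq> A}"

text \<open>The radius varies with the coordinate because generators of different degrees receive
  different radii.\<close>

definition closed_polydisc :: "'a set \<Rightarrow> ('a \<Rightarrow> complex) \<Rightarrow> ('a \<Rightarrow> real) \<Rightarrow> ('a \<Rightarrow> complex) set" where
  "closed_polydisc A p \<rho> = {z \<in> cspace A. \<forall>a\<in>A. norm (z a - p a) \<le> \<rho> a}"

text \<open>The weighted \<open>l\<^sup>1\<close>-norm of the Taylor coefficients of \<open>f\<close> is at most \<open>M\<close>. Such bounds are
  countably additive and submultiplicative, so products, compositions and infinite sums of convergent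
  power series need no Cauchy estimates.\<close>

definition majorized ::
  "'a set \<Rightarrow> ('a \<Rightarrow> complex) \<Rightarrow> ('a \<Rightarrow> real) \<Rightarrow> real \<Rightarrow> (('a \<Rightarrow> complex) \<Rightarrow> complex) \<Rightarrow> bool" where
  "majorized A p \<rho> M f \<longleftrightarrow> (\<forall>a\<in>A. 0 < \<rho> a) \<and>
     (\<exists>c. (\<lambda>\<alpha>. norm (c \<alpha>) * mvpow A \<rho> \<alpha>) summable_on exps A \<and>
          (\<Sum>\<^sub>\<infinity>\<alpha>\<in>exps A. norm (c \<alpha>) * mvpow A \<rho> \<alpha>) \<le> M \<and>
          (\<forall>z\<in>closed_polydisc A p \<rho>. ((\<lambda>\<alpha>. c \<alpha> * mvpow A (\<lambda>a. z a - p a) \<alpha>) has_sum f z) (exps A)))"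

lemma mvpow_add: "mvpow A z (\<alpha> + \<beta>) = mvpow A z \<alpha> * mvpow A z \<beta>"
  by (simp add: mvpow_def lookup_add power_add prod.distrib)

lemma mvpow_zero [simp]: "mvpow A z 0 = 1"
  by (simp add: mvpow_def)

lemma exps_iff: "\<alpha> \<in> exps A \<longleftrightarrow> (\<forall>a. a \<notin> A \<longrightarrow> lookup \<alpha> a = 0)"
  by (auto simp: exps_def in_keys_iff)

lemma exps_add: "\<alpha> \<in> exps A \<Longrightarrow> \<beta> \<in> exps A \<Longrightarrow> \<alpha> + \<beta> \<in> exps A"
  using keys_add[of \<alpha> \<beta>] by (auto simp: exps_def)

lemma zero_in_exps [simp]: "0 \<in> exps A"
  by (simp add: exps_def)

lemma norm_mvpow: "norm (mvpow A z \<alpha> :: complex) = mvpow A (\<lambda>a. norm (z a)) \<alpha>"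
  by (simp add: mvpow_def prod_norm [symmetric] norm_power)

lemma mvpow_nonneg: "(\<And>a. a \<in> A \<Longrightarrow> 0 \<le> \<rho> a) \<Longrightarrow> 0 \<le> (mvpow A \<rho> \<alpha> :: real)"
  by (simp add: mvpow_def prod_nonneg)

lemma mvpow_pos: "(\<And>a. a \<in> A \<Longrightarrow> 0 < \<rho> a) \<Longrightarrow> 0 < (mvpow A \<rho> \<alpha> :: real)"
  by (simp add: mvpow_def prod_pos)

lemma mvpow_mono:
  "(\<And>a. a \<in> A \<Longrightarrow> 0 \<le> \<rho> a \<and> \<rho> a \<le> \<sigma> a) \<Longrightarrow> mvpow A \<rho> \<alpha> \<le> (mvpow A \<sigma> \<alpha> :: real)"
  by (auto simp: mvpow_def intro!: prod_mono power_mono)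

lemma mvpow_cong: "(\<And>a. a \<in> A \<Longrightarrow> z a = w a) \<Longrightarrow> mvpow A z \<alpha> = mvpow A w \<alpha>"
  by (simp add: mvpow_def)

lemma mvpow_zero_arg:
  assumes "finite A" "\<alpha> \<in> exps A" "\<alpha> \<noteq> 0"
  shows "mvpow A (\<lambda>_. 0) \<alpha> = (0 :: 'c::{comm_semiring_1, semiring_no_zero_divisors})"
proof -
  obtain a where "a \<in> keys \<alpha>"
    using assms(3) keys_eq_empty[of \<alpha>] by blast
  then show ?thesis
    using assms(1,2) by (auto simp: mvpow_def exps_def in_keys_iff zero_power intro!: prod_zero bexI[of _ a])
qed

lemma norm_mvpow_le:
  assumes "z \<in> closed_polydisc A p \<rho>"
  shows "norm (mvpow A (\<lambda>a. z a - p a) \<alpha>) \<le> mvpow A \<rho> \<alpha>"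
  unfolding norm_mvpow using assms by (intro mvpow_mono) (auto simp: closed_polydisc_def)

section \<open>Polydisc neighbourhoods of a germ\<close>

lemma eventually_germ_nhds:
  "eventually P (germ_nhds A p) \<longleftrightarrow> (\<exists>r>0. \<forall>z\<in>polydisc A p r. P z)"
proof -
  have "eventually P (germ_nhds A p) \<longleftrightarrow> (\<exists>r\<in>{0<..}. eventually P (principal (polydisc A p r)))"
    unfolding germ_nhds_def
  proof (rule eventually_INF_base)
    fix a b :: real assume "a \<in> {0<..}" "b \<in> {0<..}"
    then show "\<exists>x\<in>{0<..}. principal (polydisc A p x)
        \<le> inf (principal (polydisc A p a)) (principal (polydisc A p b))"
      by (intro bexI[of _ "min a b"]) (auto simp: polydisc_def)
  qed auto
  then show ?thesis
    by (auto simp: eventually_principal)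
qed

lemma eventually_germ_nhds_closed_polydisc:
  assumes "finite A" "\<And>a. a \<in> A \<Longrightarrow> 0 < \<rho> a"
  shows "\<forall>\<^sub>F z in germ_nhds A p. z \<in> closed_polydisc A p \<rho>"
proof -
  define r where "r = Min (insert 1 (\<rho> ` A))"
  have "0 < r" using assms by (auto simp: r_def)
  moreover have "r \<le> \<rho> a" if "a \<in> A" for a using assms that by (auto simp: r_def)
  ultimately show ?thesis
    unfolding eventually_germ_nhds
    by (intro exI[of _ r]) (force simp: polydisc_def closed_polydisc_def dist_norm)
qed

lemma eventually_germ_nhds_base:
  assumes "eventually P (germ_nhds A p)" "p \<in> cspace A"
  shows "P p"
  using assms by (auto simp: eventually_germ_nhds polydisc_def)

text \<open>The norms have a finite sum over \<open>I \<times> E\<close>, which licenses both orders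
  of summation. The first two conclusions are for families of coefficients, the third for the values
  of the series at a point.\<close>

lemma abs_summable_double:
  fixes F :: "'i \<Rightarrow> 'e \<Rightarrow> complex"
  assumes F: "\<And>i. i \<in> I \<Longrightarrow> (\<lambda>e. norm (F i e)) summable_on E"
    and le: "\<And>i. i \<in> I \<Longrightarrow> (\<Sum>\<^sub>\<infinity>e\<in>E. norm (F i e)) \<le> M i"
    and M: "M summable_on I"
  shows "(\<lambda>e. norm (\<Sum>\<^sub>\<infinity>i\<in>I. F i e)) summable_on E"
    and "(\<Sum>\<^sub>\<infinity>e\<in>E. norm (\<Sum>\<^sub>\<infinity>i\<in>I. F i e)) \<le> infsum M I"
    and "\<And>f S. (\<And>i. i \<in> I \<Longrightarrow> (F i has_sum f i) E) \<Longrightarrow> (f has_sum S) I \<Longrightarrow>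
           ((\<lambda>e. \<Sum>\<^sub>\<infinity>i\<in>I. F i e) has_sum S) E"
proof -
  let ?N = "\<lambda>i. \<Sum>\<^sub>\<infinity>e\<in>E. norm (F i e)"
  have N: "?N summable_on I"
    using M le by (rule summable_on_comparison_test) (auto intro: infsum_nonneg)
  have sum: "(\<lambda>(i, e). norm (F i e)) summable_on I \<times> E"
    by (rule summable_on_SigmaI[where g = ?N]) (use F N in auto)
  have swap: "(\<lambda>(e, i). norm (F i e)) summable_on E \<times> I"
    using sum by (subst summable_on_swap) (simp add: case_prod_unfold)
  have abs: "(\<lambda>i. norm (F i e)) summable_on I" if "e \<in> E" for e
    using summable_on_SigmaD1[OF swap that] by simp
  then have sI: "(\<lambda>i. F i e) summable_on I" if "e \<in> E" for e
    using that by (simp add: summable_on_iff_abs_summable_on_complex)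
  let ?K = "\<lambda>e. \<Sum>\<^sub>\<infinity>i\<in>I. norm (F i e)"
  have K: "?K summable_on E"
    using summable_on_Sigma_banach[of "\<lambda>e i. norm (F i e)" E "\<lambda>_. I"] swap by simp
  have leK: "norm (\<Sum>\<^sub>\<infinity>i\<in>I. F i e) \<le> ?K e" if "e \<in> E" for e
    by (rule norm_infsum_bound) (use abs that in auto)
  show n: "(\<lambda>e. norm (\<Sum>\<^sub>\<infinity>i\<in>I. F i e)) summable_on E"
    by (rule summable_on_comparison_test[OF K leK]) auto
  have "(\<Sum>\<^sub>\<infinity>e\<in>E. norm (\<Sum>\<^sub>\<infinity>i\<in>I. F i e)) \<le> (\<Sum>\<^sub>\<infinity>e\<in>E. ?K e)"
    by (rule infsum_mono[OF n K leK])
  also have "\<dots> = (\<Sum>\<^sub>\<infinity>i\<in>I. ?N i)"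
    by (rule infsum_swap_banach) (use swap in simp)
  also have "\<dots> \<le> infsum M I"
    by (rule infsum_mono[OF N M le])
  finally show "(\<Sum>\<^sub>\<infinity>e\<in>E. norm (\<Sum>\<^sub>\<infinity>i\<in>I. F i e)) \<le> infsum M I" .
  fix f S assume f: "\<And>i. i \<in> I \<Longrightarrow> (F i has_sum f i) E" and S: "(f has_sum S) I"
  have "(\<lambda>(i, e). F i e) summable_on I \<times> E"
    using sum by (simp add: summable_on_iff_abs_summable_on_complex case_prod_unfold)
  then have "((\<lambda>(i, e). F i e) has_sum S) (I \<times> E)"
    by (intro has_sum_SigmaI[OF _ S]) (use f in auto)
  then have "((\<lambda>(e, i). F i e) has_sum S) (E \<times> I)"
    by (subst has_sum_swap) (simp add: case_prod_unfold)
  then show "((\<lambda>e. \<Sum>\<^sub>\<infinity>i\<in>I. F i e) has_sum S) E"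
    by (rule has_sum_SigmaD) (use sI in auto)
qed

text \<open>Reindexing by the graph of \<open>\<mu>\<close> turns the sum into an iterated one. The
  fibres may be infinite; their sums exist because a summable complex family stays summable on
  subsets.\<close>

lemma has_sum_group:
  fixes f :: "'b \<Rightarrow> complex"
  assumes "(f has_sum S) B" "\<mu> ` B \<subseteq> D"
  shows "((\<lambda>d. \<Sum>\<^sub>\<infinity>b | b \<in> B \<and> \<mu> b = d. f b) has_sum S) D"
proof -
  have bij: "bij_betw snd (SIGMA d:D. {b \<in> B. \<mu> b = d}) B"
    using assms(2) by (intro bij_betwI[of _ _ _ "\<lambda>b. (\<mu> b, b)"]) auto
  have "((\<lambda>x. f (snd x)) has_sum S) (SIGMA d:D. {b \<in> B. \<mu> b = d})"
    using has_sum_reindex_bij_betw[OF bij, of f] assms(1) by simp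
  moreover have "f summable_on {b \<in> B. \<mu> b = d}" for d
    using summable_on_subset[OF has_sum_imp_summable[OF assms(1)], of "{b \<in> B. \<mu> b = d}"] by auto
  ultimately show ?thesis
    by (intro has_sum_SigmaD[where f = "\<lambda>x. f (snd x)" and B = "\<lambda>d. {b \<in> B. \<mu> b = d}"]) auto
qed

section \<open>Algebra of weighted coefficient bounds\<close>

lemma majorized_mono:
  assumes "majorized A p \<sigma> N f" "N \<le> M" "\<And>a. a \<in> A \<Longrightarrow> 0 < \<rho> a \<and> \<rho> a \<le> \<sigma> a"
  shows "majorized A p \<rho> M f"
proof -
  obtain c where c: "(\<lambda>\<alpha>. norm (c \<alpha>) * mvpow A \<sigma> \<alpha>) summable_on exps A"
    "(\<Sum>\<^sub>\<infinity>\<alpha>\<in>exps A. norm (c \<alpha>) * mvpow A \<sigma> \<alpha>) \<le> N"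
    "\<forall>z\<in>closed_polydisc A p \<sigma>. ((\<lambda>\<alpha>. c \<alpha> * mvpow A (\<lambda>a. z a - p a) \<alpha>) has_sum f z) (exps A)"
    using assms(1) by (auto simp: majorized_def)
  have le: "norm (c \<alpha>) * mvpow A \<rho> \<alpha> \<le> norm (c \<alpha>) * mvpow A \<sigma> \<alpha>" for \<alpha>
    using assms(3) by (intro mult_left_mono mvpow_mono) (auto intro: less_imp_le)
  have nn: "0 \<le> norm (c \<alpha>) * mvpow A \<rho> \<alpha>" for \<alpha>
    using assms(3) by (intro mult_nonneg_nonneg mvpow_nonneg) (auto intro: less_imp_le)
  have s: "(\<lambda>\<alpha>. norm (c \<alpha>) * mvpow A \<rho> \<alpha>) summable_on exps A"
    by (rule summable_on_comparison_test[OF c(1) le nn])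
  moreover have "(\<Sum>\<^sub>\<infinity>\<alpha>\<in>exps A. norm (c \<alpha>) * mvpow A \<rho> \<alpha>) \<le> M"
    using infsum_mono[OF s c(1) le] c(2) assms(2) by linarith
  moreover have "closed_polydisc A p \<rho> \<subseteq> closed_polydisc A p \<sigma>"
    using assms(3) by (force simp: closed_polydisc_def)
  ultimately show ?thesis
    using c(3) assms(3) by (auto simp: majorized_def)
qed

lemma majorized_norm_le:
  assumes "majorized A p \<rho> M f" "z \<in> closed_polydisc A p \<rho>"
  shows "norm (f z) \<le> M"
proof -
  obtain c where c: "(\<lambda>\<alpha>. norm (c \<alpha>) * mvpow A \<rho> \<alpha>) summable_on exps A"
    "(\<Sum>\<^sub>\<infinity>\<alpha>\<in>exps A. norm (c \<alpha>) * mvpow A \<rho> \<alpha>) \<le> M"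
    "((\<lambda>\<alpha>. c \<alpha> * mvpow A (\<lambda>a. z a - p a) \<alpha>) has_sum f z) (exps A)"
    using assms by (auto simp: majorized_def)
  have "norm (f z) \<le> (\<Sum>\<^sub>\<infinity>\<alpha>\<in>exps A. norm (c \<alpha>) * mvpow A \<rho> \<alpha>)"
    by (rule norm_infsum_le[OF c(3) has_sum_infsum[OF c(1)]])
      (simp add: norm_mult mult_left_mono norm_mvpow_le[OF assms(2)])
  with c(2) show ?thesis by linarith
qed

text \<open>The coefficients of \<open>g\<close> are the sums of the coefficients of the
  \<open>f i\<close>. The interchange of summation is applied twice: to the weighted coefficients
  for the norm bound, and to the terms at a point \<open>z\<close> for the value.\<close>

lemma majorized_infsum:
  assumes f: "\<And>i. i \<in> I \<Longrightarrow> majorized A p \<rho> (M i) (f i)"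
    and M: "M summable_on I" and \<rho>: "\<And>a. a \<in> A \<Longrightarrow> 0 < \<rho> a"
    and g: "\<And>z. z \<in> closed_polydisc A p \<rho> \<Longrightarrow> ((\<lambda>i. f i z) has_sum g z) I"
  shows "majorized A p \<rho> (infsum M I) g"
proof -
  have "\<forall>i\<in>I. \<exists>c. (\<lambda>\<alpha>. norm (c \<alpha>) * mvpow A \<rho> \<alpha>) summable_on exps A \<and>
      (\<Sum>\<^sub>\<infinity>\<alpha>\<in>exps A. norm (c \<alpha>) * mvpow A \<rho> \<alpha>) \<le> M i \<and>
      (\<forall>z\<in>closed_polydisc A p \<rho>. ((\<lambda>\<alpha>. c \<alpha> * mvpow A (\<lambda>a. z a - p a) \<alpha>) has_sum f i z) (exps A))"
    using f by (simp add: majorized_def)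
  from bchoice[OF this]
  obtain c where c: "\<And>i. i \<in> I \<Longrightarrow> (\<lambda>\<alpha>. norm (c i \<alpha>) * mvpow A \<rho> \<alpha>) summable_on exps A"
    "\<And>i. i \<in> I \<Longrightarrow> (\<Sum>\<^sub>\<infinity>\<alpha>\<in>exps A. norm (c i \<alpha>) * mvpow A \<rho> \<alpha>) \<le> M i"
    "\<And>i z. i \<in> I \<Longrightarrow> z \<in> closed_polydisc A p \<rho> \<Longrightarrow>
       ((\<lambda>\<alpha>. c i \<alpha> * mvpow A (\<lambda>a. z a - p a) \<alpha>) has_sum f i z) (exps A)"
    by auto
  have pos: "0 < mvpow A \<rho> \<alpha>" for \<alpha>
    using \<rho> by (rule mvpow_pos)
  \<comment> \<open>With the weight included, the plain norm of \<open>F i \<alpha>\<close> is the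
    summand of the weighted norm.\<close>
  define F where "F i \<alpha> = c i \<alpha> * of_real (mvpow A \<rho> \<alpha>)" for i \<alpha>
  have nF: "norm (F i \<alpha>) = norm (c i \<alpha>) * mvpow A \<rho> \<alpha>" for i \<alpha>
    using pos[of \<alpha>] by (simp add: F_def norm_mult)
  note D = abs_summable_double[where F = F and I = I and E = "exps A" and M = M,
      unfolded nF, OF c(1) c(2) M]
  define d where "d \<alpha> = (\<Sum>\<^sub>\<infinity>i\<in>I. c i \<alpha>)" for \<alpha>
  have dF: "(\<Sum>\<^sub>\<infinity>i\<in>I. F i \<alpha>) = d \<alpha> * of_real (mvpow A \<rho> \<alpha>)" for \<alpha>
    unfolding F_def d_def by (rule infsum_cmult_left')
  have nd: "norm (\<Sum>\<^sub>\<infinity>i\<in>I. F i \<alpha>) = norm (d \<alpha>) * mvpow A \<rho> \<alpha>" for \<alpha>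
    using pos[of \<alpha>] by (simp add: dF norm_mult)
  have "((\<lambda>\<alpha>. d \<alpha> * mvpow A (\<lambda>a. z a - p a) \<alpha>) has_sum g z) (exps A)"
    if z: "z \<in> closed_polydisc A p \<rho>" for z
  proof -
    define G where "G i \<alpha> = c i \<alpha> * mvpow A (\<lambda>a. z a - p a) \<alpha>" for i \<alpha>
    have le: "norm (G i \<alpha>) \<le> norm (c i \<alpha>) * mvpow A \<rho> \<alpha>" for i \<alpha>
      by (simp add: G_def norm_mult mult_left_mono norm_mvpow_le[OF z])
    have s: "(\<lambda>\<alpha>. norm (G i \<alpha>)) summable_on exps A" if "i \<in> I" for i
      by (rule summable_on_comparison_test[OF c(1)[OF that] le]) auto
    have le': "(\<Sum>\<^sub>\<infinity>\<alpha>\<in>exps A. norm (G i \<alpha>)) \<le> M i" if "i \<in> I" for i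
      using infsum_mono[OF s[OF that] c(1)[OF that] le] c(2)[OF that] by linarith
    have "((\<lambda>\<alpha>. \<Sum>\<^sub>\<infinity>i\<in>I. G i \<alpha>) has_sum g z) (exps A)"
      by (rule abs_summable_double(3)[OF s le' M _ g[OF z]]) (use c(3) z in \<open>auto simp: G_def\<close>)
    then show ?thesis
      by (simp add: G_def d_def infsum_cmult_left')
  qed
  then show ?thesis
    using D(1,2) \<rho> unfolding majorized_def nd by (intro conjI ballI exI[of _ d]) auto
qed

lemma majorized_nonneg:
  assumes "majorized A p \<rho> M f"
  shows "0 \<le> M"
proof -
  obtain c :: "_ \<Rightarrow> complex"
    where "(\<Sum>\<^sub>\<infinity>\<alpha>\<in>exps A. norm (c \<alpha>) * mvpow A \<rho> \<alpha>) \<le> M" "\<forall>a\<in>A. 0 < \<rho> a"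
    using assms by (auto simp: majorized_def)
  moreover have "0 \<le> (\<Sum>\<^sub>\<infinity>\<alpha>\<in>exps A. norm (c \<alpha>) * mvpow A \<rho> \<alpha>)"
    using calculation(2) by (intro infsum_nonneg mult_nonneg_nonneg mvpow_nonneg) (auto intro: less_imp_le)
  ultimately show ?thesis by linarith
qed

text \<open>Multiplication by a monomial translates the coefficients by \<open>\<beta>\<close>, so
  the weighted norm is only scaled. Products and infinite combinations are built from this
  case.\<close>

lemma majorized_mvpow_mult:
  assumes f: "majorized A p \<rho> M f" and \<beta>: "\<beta> \<in> exps A"
  shows "majorized A p \<rho> (norm k * mvpow A \<rho> \<beta> * M) (\<lambda>z. k * mvpow A (\<lambda>a. z a - p a) \<beta> * f z)"
proof -
  obtain c where \<rho>: "\<forall>a\<in>A. 0 < \<rho> a" and c: "(\<lambda>\<alpha>. norm (c \<alpha>) * mvpow A \<rho> \<alpha>) summable_on exps A"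
    "(\<Sum>\<^sub>\<infinity>\<alpha>\<in>exps A. norm (c \<alpha>) * mvpow A \<rho> \<alpha>) \<le> M"
    "\<forall>z\<in>closed_polydisc A p \<rho>. ((\<lambda>\<alpha>. c \<alpha> * mvpow A (\<lambda>a. z a - p a) \<alpha>) has_sum f z) (exps A)"
    using assms by (auto simp: majorized_def)
  define T where "T = (+) \<beta> ` exps A"
  have inj: "inj_on ((+) \<beta>) (exps A)" by (auto simp: inj_on_def)
  have T: "T \<subseteq> exps A" using exps_add[OF \<beta>] by (auto simp: T_def)
  \<comment> \<open>Off the translate \<open>T\<close> the coefficient is 0; there
    \<open>\<alpha> - \<beta>\<close> may be a truncated difference.\<close>
  define d where "d \<alpha> = (if \<alpha> \<in> T then k * c (\<alpha> - \<beta>) else 0)" for \<alpha>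
  have d: "d (\<beta> + \<alpha>) = k * c \<alpha>" if "\<alpha> \<in> exps A" for \<alpha>
    using that by (simp add: d_def T_def)
  have nd: "((\<lambda>\<alpha>. norm (d \<alpha>) * mvpow A \<rho> \<alpha>) has_sum S) (exps A) \<longleftrightarrow>
      ((\<lambda>\<alpha>. norm (d (\<beta> + \<alpha>)) * mvpow A \<rho> (\<beta> + \<alpha>)) has_sum S) (exps A)" for S
  proof -
    have "((\<lambda>\<alpha>. norm (d \<alpha>) * mvpow A \<rho> \<alpha>) has_sum S) (exps A) \<longleftrightarrow>
        ((\<lambda>\<alpha>. norm (d \<alpha>) * mvpow A \<rho> \<alpha>) has_sum S) T"
      using T by (intro has_sum_cong_neutral) (auto simp: d_def)
    then show ?thesis
      unfolding T_def by (simp add: has_sum_reindex[OF inj] o_def)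
  qed
  have "((\<lambda>\<alpha>. norm (d \<alpha>) * mvpow A \<rho> \<alpha>) has_sum
      norm k * mvpow A \<rho> \<beta> * (\<Sum>\<^sub>\<infinity>\<alpha>\<in>exps A. norm (c \<alpha>) * mvpow A \<rho> \<alpha>)) (exps A)"
    unfolding nd
    by (rule has_sum_cong[THEN iffD2, OF _ has_sum_cmult_right[OF has_sum_infsum[OF c(1)]]])
      (simp add: d mvpow_add norm_mult mult_ac)
  then have "(\<lambda>\<alpha>. norm (d \<alpha>) * mvpow A \<rho> \<alpha>) summable_on exps A"
    "(\<Sum>\<^sub>\<infinity>\<alpha>\<in>exps A. norm (d \<alpha>) * mvpow A \<rho> \<alpha>) \<le> norm k * mvpow A \<rho> \<beta> * M"
    using c(2) \<rho> mvpow_nonneg[of A \<rho> \<beta>]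
    by (auto simp: has_sum_iff mult_left_mono less_imp_le)
  moreover have "((\<lambda>\<alpha>. d \<alpha> * mvpow A (\<lambda>a. z a - p a) \<alpha>) has_sum
      (k * mvpow A (\<lambda>a. z a - p a) \<beta> * f z)) (exps A)" if z: "z \<in> closed_polydisc A p \<rho>" for z
  proof -
    let ?m = "mvpow A (\<lambda>a. z a - p a)"
    have "((\<lambda>\<alpha>. d \<alpha> * ?m \<alpha>) has_sum S) (exps A) \<longleftrightarrow> ((\<lambda>\<alpha>. d \<alpha> * ?m \<alpha>) has_sum S) T" for S
      using T by (intro has_sum_cong_neutral) (auto simp: d_def)
    then have "((\<lambda>\<alpha>. d \<alpha> * ?m \<alpha>) has_sum S) (exps A) \<longleftrightarrow>
        ((\<lambda>\<alpha>. d (\<beta> + \<alpha>) * ?m (\<beta> + \<alpha>)) has_sum S) (exps A)" for S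
      unfolding T_def by (simp add: has_sum_reindex[OF inj] o_def)
    moreover have "((\<lambda>\<alpha>. d (\<beta> + \<alpha>) * ?m (\<beta> + \<alpha>)) has_sum (k * ?m \<beta> * f z)) (exps A)"
      by (rule has_sum_cong[THEN iffD2, OF _ has_sum_cmult_right[OF c(3)[rule_format, OF z]]])
        (simp add: d mvpow_add mult_ac)
    ultimately show ?thesis by blast
  qed
  ultimately show ?thesis
    using \<rho> unfolding majorized_def by (intro conjI ballI exI[of _ d]) auto
qed

lemma majorized_const:
  assumes "\<And>a. a \<in> A \<Longrightarrow> 0 < \<rho> a"
  shows "majorized A p \<rho> (norm k) (\<lambda>_. k)"
proof -
  have "((\<lambda>\<alpha>. norm (if \<alpha> = 0 then k else 0) * mvpow A \<rho> \<alpha>) has_sum norm k) (exps A)"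
    by (rule has_sum_finite_neutralI[of "{0}"]) auto
  moreover have "((\<lambda>\<alpha>. (if \<alpha> = 0 then k else 0) * mvpow A (\<lambda>a. z a - p a) \<alpha>) has_sum k) (exps A)" for z
    by (rule has_sum_finite_neutralI[of "{0}"]) auto
  ultimately show ?thesis
    using assms unfolding majorized_def
    by (auto simp: has_sum_iff intro!: exI[of _ "\<lambda>\<alpha>. if \<alpha> = 0 then k else 0"])
qed

lemma majorized_mvpow:
  assumes "\<And>a. a \<in> A \<Longrightarrow> 0 < \<rho> a" "\<beta> \<in> exps A"
  shows "majorized A p \<rho> (mvpow A \<rho> \<beta>) (\<lambda>z. mvpow A (\<lambda>a. z a - p a) \<beta>)"
  using majorized_mvpow_mult[OF majorized_const[of A \<rho> p 1] assms(2), of 1] assms(1) by simp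

lemma majorized_cmult:
  assumes "majorized A p \<rho> M f"
  shows "majorized A p \<rho> (norm k * M) (\<lambda>z. k * f z)"
  using majorized_mvpow_mult[OF assms, of 0 k] by simp

lemma majorized_sum:
  assumes "finite I" "\<And>i. i \<in> I \<Longrightarrow> majorized A p \<rho> (M i) (f i)" "\<And>a. a \<in> A \<Longrightarrow> 0 < \<rho> a"
  shows "majorized A p \<rho> (\<Sum>i\<in>I. M i) (\<lambda>z. \<Sum>i\<in>I. f i z)"
  using majorized_infsum[of I A p \<rho> M f "\<lambda>z. \<Sum>i\<in>I. f i z"] assms by simp

lemma majorized_add:
  assumes "majorized A p \<rho> M f" "majorized A p \<rho> N g"
  shows "majorized A p \<rho> (M + N) (\<lambda>z. f z + g z)"
  using majorized_sum[of "{True, False}" A p \<rho> "\<lambda>b. if b then M else N" "\<lambda>b. if b then f else g"] assms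
  by (auto simp: majorized_def)

text \<open>Only \<open>f\<close> is expanded: each of its terms times \<open>g\<close> is a
  monomial multiple of \<open>g\<close>, and \<open>majorized_infsum\<close> adds these
  multiples.\<close>

lemma majorized_mult:
  assumes f: "majorized A p \<rho> M f" and g: "majorized A p \<rho> N g"
  shows "majorized A p \<rho> (M * N) (\<lambda>z. f z * g z)"
proof -
  obtain c where \<rho>: "\<forall>a\<in>A. 0 < \<rho> a" and c: "(\<lambda>\<alpha>. norm (c \<alpha>) * mvpow A \<rho> \<alpha>) summable_on exps A"
    "(\<Sum>\<^sub>\<infinity>\<alpha>\<in>exps A. norm (c \<alpha>) * mvpow A \<rho> \<alpha>) \<le> M"
    "\<forall>z\<in>closed_polydisc A p \<rho>. ((\<lambda>\<alpha>. c \<alpha> * mvpow A (\<lambda>a. z a - p a) \<alpha>) has_sum f z) (exps A)"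
    using f by (auto simp: majorized_def)
  have "majorized A p \<rho> (\<Sum>\<^sub>\<infinity>\<alpha>\<in>exps A. norm (c \<alpha>) * mvpow A \<rho> \<alpha> * N) (\<lambda>z. f z * g z)"
  proof (rule majorized_infsum)
    show "majorized A p \<rho> (norm (c \<alpha>) * mvpow A \<rho> \<alpha> * N) (\<lambda>z. c \<alpha> * mvpow A (\<lambda>a. z a - p a) \<alpha> * g z)"
      if "\<alpha> \<in> exps A" for \<alpha> using majorized_mvpow_mult[OF g that] .
  qed (use \<rho> c in \<open>auto intro: summable_on_cmult_left has_sum_cmult_left\<close>)
  moreover have "(\<Sum>\<^sub>\<infinity>\<alpha>\<in>exps A. norm (c \<alpha>) * mvpow A \<rho> \<alpha> * N) \<le> M * N"
    using c(2) majorized_nonneg[OF g] by (simp add: infsum_cmult_left' mult_right_mono)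
  ultimately show ?thesis
    by (rule majorized_mono) (use \<rho> in auto)
qed

lemma majorized_power:
  assumes "majorized A p \<rho> M f"
  shows "majorized A p \<rho> (M ^ n) (\<lambda>z. f z ^ n)"
proof (induction n)
  case 0
  then show ?case using majorized_const[of A \<rho> p 1] assms by (simp add: majorized_def)
next
  case (Suc n)
  then show ?case using majorized_mult[OF assms Suc] by simp
qed

lemma majorized_prod:
  assumes "finite B" "\<And>b. b \<in> B \<Longrightarrow> majorized A p \<rho> (M b) (f b)" "\<And>a. a \<in> A \<Longrightarrow> 0 < \<rho> a"
  shows "majorized A p \<rho> (\<Prod>b\<in>B. M b) (\<lambda>z. \<Prod>b\<in>B. f b z)"
  using assms
proof (induction B rule: finite_induct)
  case empty
  then show ?case using majorized_const[of A \<rho> p 1] by simp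
next
  case (insert b B)
  then show ?case using majorized_mult[of A p \<rho> "M b" "f b"] by simp
qed

section \<open>Holomorphic germs and their majorants\<close>

lemma holomorphic_atI:
  assumes "finite A" "majorized A p \<rho> M f"
  shows "holomorphic_at A p f"
proof -
  obtain c where c: "\<forall>a\<in>A. 0 < \<rho> a"
    "\<forall>z\<in>closed_polydisc A p \<rho>. ((\<lambda>\<alpha>. c \<alpha> * mvpow A (\<lambda>a. z a - p a) \<alpha>) has_sum f z) (exps A)"
    using assms by (auto simp: majorized_def)
  have "\<forall>\<^sub>F z in germ_nhds A p. z \<in> closed_polydisc A p \<rho>"
    by (rule eventually_germ_nhds_closed_polydisc) (use assms c in auto)
  then have "\<forall>\<^sub>F z in germ_nhds A p. ((\<lambda>\<alpha>. c \<alpha> * mvpow A (\<lambda>a. z a - p a) \<alpha>) has_sum f z) (exps A)"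
    by eventually_elim (use c in auto)
  then show ?thesis
    unfolding holomorphic_at_def mvpow_def exps_def by blast
qed

text \<open>Unordered summability of complex numbers is absolute, so an expansion that converges
  near \<open>p\<close> has a finite weighted norm at half the radius. The last clause identifies
  the constant term, so that it can be split off.\<close>

lemma holomorphic_at_series:
  assumes "finite A" "p \<in> cspace A" "holomorphic_at A p f"
  obtains c r where "0 < r"
    "(\<lambda>\<alpha>. norm (c \<alpha>) * mvpow A (\<lambda>_. r) \<alpha>) summable_on exps A"
    "\<And>z. z \<in> closed_polydisc A p (\<lambda>_. r) \<Longrightarrow> ((\<lambda>\<alpha>. c \<alpha> * mvpow A (\<lambda>a. z a - p a) \<alpha>) has_sum f z) (exps A)"
    "c 0 = f p"
proof -
  obtain c r where r: "0 < r" and c: "\<And>z. z \<in> polydisc A p r \<Longrightarrow>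
      ((\<lambda>\<alpha>. c \<alpha> * mvpow A (\<lambda>a. z a - p a) \<alpha>) has_sum f z) (exps A)"
    using assms(3) unfolding holomorphic_at_def eventually_germ_nhds mvpow_def exps_def by blast
  have sub: "closed_polydisc A p (\<lambda>_. r/2) \<subseteq> polydisc A p r"
    using r by (force simp: closed_polydisc_def polydisc_def dist_norm)
  \<comment> \<open>At this corner of the polydisc the absolute value of every monomial in
    \<open>z - p\<close> equals its weight for the radius \<open>r/2\<close>, so absolute
    summability at one point gives the weighted norm.\<close>
  define z where "z a = (if a \<in> A then p a + of_real (r/2) else 0)" for a
  have "z \<in> polydisc A p r"
    using r by (auto simp: z_def polydisc_def cspace_def dist_norm)
  from c[OF this] have "(\<lambda>\<alpha>. norm (c \<alpha> * mvpow A (\<lambda>a. z a - p a) \<alpha>)) summable_on exps A"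
    by (simp add: summable_on_iff_abs_summable_on_complex[symmetric] has_sum_iff)
  moreover have "mvpow A (\<lambda>a. norm (z a - p a)) \<alpha> = mvpow A (\<lambda>_. r/2) \<alpha>" for \<alpha>
    using r by (intro mvpow_cong) (auto simp: z_def)
  ultimately have s: "(\<lambda>\<alpha>. norm (c \<alpha>) * mvpow A (\<lambda>_. r/2) \<alpha>) summable_on exps A"
    by (simp add: norm_mult norm_mvpow)
  have "p \<in> polydisc A p r" using assms(2) r by (auto simp: polydisc_def)
  from c[OF this] have "((\<lambda>\<alpha>. c \<alpha> * mvpow A (\<lambda>_. 0) \<alpha>) has_sum f p) (exps A)" by simp
  moreover have "((\<lambda>\<alpha>. c \<alpha> * mvpow A (\<lambda>_. 0) \<alpha>) has_sum c 0) (exps A)"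
    by (rule has_sum_finite_neutralI[of "{0}"]) (use mvpow_zero_arg[OF assms(1)] in auto)
  ultimately have "c 0 = f p" by (rule has_sum_unique[symmetric])
  then show ?thesis
    using that[of "r/2" c] r s c sub by auto
qed

lemma holomorphic_at_majorized:
  assumes "finite A" "p \<in> cspace A" "holomorphic_at A p f"
  shows "\<exists>r>0. \<exists>M. majorized A p (\<lambda>_. r) M f"
proof -
  obtain c r where cr: "0 < r"
    "(\<lambda>\<alpha>. norm (c \<alpha>) * mvpow A (\<lambda>_. r) \<alpha>) summable_on exps A"
    "\<And>z. z \<in> closed_polydisc A p (\<lambda>_. r) \<Longrightarrow> ((\<lambda>\<alpha>. c \<alpha> * mvpow A (\<lambda>a. z a - p a) \<alpha>) has_sum f z) (exps A)"
    "c 0 = f p"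
    by (rule holomorphic_at_series[OF assms]) (rule that; assumption)
  show ?thesis
    by (rule exI[of _ r], rule conjI[OF cr(1)],
        rule exI[of _ "\<Sum>\<^sub>\<infinity>\<alpha>\<in>exps A. norm (c \<alpha>) * mvpow A (\<lambda>_. r) \<alpha>"])
      (use cr in \<open>auto simp: majorized_def\<close>)
qed

text \<open>Shrinking the radius by a factor \<open>t \<le> 1\<close> shrinks every term but the constant one by at least \<open>t\<close>.\<close>

lemma holomorphic_at_majorized_small:
  assumes A: "finite A" "p \<in> cspace A" and f: "holomorphic_at A p f" and e: "0 < \<epsilon>"
  shows "\<exists>r>0. majorized A p (\<lambda>_. r) \<epsilon> (\<lambda>z. f z - f p)"
proof -
  obtain c r where cr: "0 < r"
    "(\<lambda>\<alpha>. norm (c \<alpha>) * mvpow A (\<lambda>_. r) \<alpha>) summable_on exps A"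
    "\<And>z. z \<in> closed_polydisc A p (\<lambda>_. r) \<Longrightarrow> ((\<lambda>\<alpha>. c \<alpha> * mvpow A (\<lambda>a. z a - p a) \<alpha>) has_sum f z) (exps A)"
    "c 0 = f p"
    by (rule holomorphic_at_series[OF A f]) (rule that; assumption)
  define M where "M = (\<Sum>\<^sub>\<infinity>\<alpha>\<in>exps A. norm (c \<alpha>) * mvpow A (\<lambda>_. r) \<alpha>)"
  have M: "0 \<le> M"
    unfolding M_def using cr(1) by (intro infsum_nonneg mult_nonneg_nonneg mvpow_nonneg) auto
  \<comment> \<open>\<open>M + 1\<close> instead of \<open>M\<close> keeps \<open>t\<close> positive
    when \<open>M = 0\<close>.\<close>
  define t where "t = min 1 (\<epsilon> / (M + 1))"
  have t: "0 < t" "t \<le> 1" "t * M \<le> \<epsilon>"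
  proof -
    show "0 < t" "t \<le> 1" using e M by (auto simp: t_def)
    have "t * M \<le> \<epsilon> / (M + 1) * (M + 1)"
      using M e by (intro mult_mono) (auto simp: t_def)
    then show "t * M \<le> \<epsilon>" using M by simp
  qed
  define d where "d \<alpha> = (if \<alpha> = 0 then 0 else c \<alpha>)" for \<alpha>
  have le: "norm (d \<alpha>) * mvpow A (\<lambda>_. t * r) \<alpha> \<le> t * (norm (c \<alpha>) * mvpow A (\<lambda>_. r) \<alpha>)"
    if "\<alpha> \<in> exps A" for \<alpha>
  proof (cases "\<alpha> = 0")
    case True
    then show ?thesis using t cr(1) by (simp add: d_def)
  next
    case False
    then obtain a where a: "a \<in> keys \<alpha>" using keys_eq_empty[of \<alpha>] by blast
    then have a': "a \<in> A" "lookup \<alpha> a \<ge> 1"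
      using that by (auto simp: exps_def in_keys_iff Suc_le_eq)
    have "mvpow A (\<lambda>_. t) \<alpha> = t ^ lookup \<alpha> a * (\<Prod>b\<in>A - {a}. t ^ lookup \<alpha> b)"
      unfolding mvpow_def using a' A(1) by (simp add: prod.remove)
    also have "\<dots> \<le> t * 1"
      using t a' power_decreasing[OF a'(2), of t]
      by (intro mult_mono prod_le_1 conjI power_le_one zero_le_power prod_nonneg) auto
    finally have "mvpow A (\<lambda>_. t) \<alpha> \<le> t" by simp
    moreover have "mvpow A (\<lambda>_. t * r) \<alpha> = mvpow A (\<lambda>_. t) \<alpha> * mvpow A (\<lambda>_. r) \<alpha>"
      by (simp add: mvpow_def power_mult_distrib prod.distrib)
    moreover have "0 \<le> mvpow A (\<lambda>_. r) \<alpha>" using cr(1) by (intro mvpow_nonneg) auto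
    ultimately have "mvpow A (\<lambda>_. t * r) \<alpha> \<le> t * mvpow A (\<lambda>_. r) \<alpha>"
      by (metis mult_right_mono)
    then have "norm (c \<alpha>) * mvpow A (\<lambda>_. t * r) \<alpha> \<le> norm (c \<alpha>) * (t * mvpow A (\<lambda>_. r) \<alpha>)"
      by (rule mult_left_mono) simp
    then show ?thesis
      using False by (simp add: d_def mult.left_commute)
  qed
  have nn: "0 \<le> norm (d \<alpha>) * mvpow A (\<lambda>_. t * r) \<alpha>" for \<alpha>
    using t cr(1) by (intro mult_nonneg_nonneg mvpow_nonneg) auto
  have s: "(\<lambda>\<alpha>. norm (d \<alpha>) * mvpow A (\<lambda>_. t * r) \<alpha>) summable_on exps A"
    by (rule summable_on_comparison_test[OF summable_on_cmult_right[OF cr(2), of t] le nn])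
  have "(\<Sum>\<^sub>\<infinity>\<alpha>\<in>exps A. norm (d \<alpha>) * mvpow A (\<lambda>_. t * r) \<alpha>) \<le> t * M"
    using infsum_mono[OF s summable_on_cmult_right[OF cr(2), of t] le]
    by (simp add: M_def infsum_cmult_right')
  then have "(\<Sum>\<^sub>\<infinity>\<alpha>\<in>exps A. norm (d \<alpha>) * mvpow A (\<lambda>_. t * r) \<alpha>) \<le> \<epsilon>"
    using t(3) by linarith
  moreover have "((\<lambda>\<alpha>. d \<alpha> * mvpow A (\<lambda>a. z a - p a) \<alpha>) has_sum (f z - f p)) (exps A)"
    if "z \<in> closed_polydisc A p (\<lambda>_. t * r)" for z
  proof -
    have "t * r \<le> r" using t cr(1) by simp
    then have "z \<in> closed_polydisc A p (\<lambda>_. r)"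
      using that by (force simp: closed_polydisc_def)
    from cr(3)[OF this]
    have 1: "((\<lambda>\<alpha>. c \<alpha> * mvpow A (\<lambda>a. z a - p a) \<alpha>) has_sum f z) (exps A)" .
    have 2: "((\<lambda>\<alpha>. if \<alpha> = 0 then - c 0 else 0) has_sum (- f p)) (exps A)"
      by (rule has_sum_finite_neutralI[of "{0}"]) (use cr(4) in auto)
    have "((\<lambda>\<alpha>. c \<alpha> * mvpow A (\<lambda>a. z a - p a) \<alpha> + (if \<alpha> = 0 then - c 0 else 0)) has_sum (f z + - f p)) (exps A)"
      by (rule has_sum_add[OF 1 2])
    moreover have "c \<alpha> * mvpow A (\<lambda>a. z a - p a) \<alpha> + (if \<alpha> = 0 then - c 0 else 0) =
        d \<alpha> * mvpow A (\<lambda>a. z a - p a) \<alpha>" for \<alpha>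
      by (simp add: d_def)
    ultimately show ?thesis by simp
  qed
  ultimately have "majorized A p (\<lambda>_. t * r) \<epsilon> (\<lambda>z. f z - f p)"
    using s t cr(1) unfolding majorized_def by (auto intro!: exI[of _ d])
  then show ?thesis using t cr(1) by (intro exI[of _ "t * r"]) auto
qed

lemma eventually_germ_nhds_dist:
  assumes "finite A" "p \<in> cspace A" "holomorphic_at A p f" "0 < \<epsilon>"
  shows "\<forall>\<^sub>F z in germ_nhds A p. norm (f z - f p) \<le> \<epsilon>"
proof -
  obtain r where r: "0 < r" "majorized A p (\<lambda>_. r) \<epsilon> (\<lambda>z. f z - f p)"
    using holomorphic_at_majorized_small[OF assms] by blast
  have "\<forall>\<^sub>F z in germ_nhds A p. z \<in> closed_polydisc A p (\<lambda>_. r)"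
    by (rule eventually_germ_nhds_closed_polydisc) (use assms r in auto)
  then show ?thesis
    by eventually_elim (rule majorized_norm_le[OF r(2)])
qed

lemma filterlim_germ_nhds:
  assumes A: "finite A" "p \<in> cspace A" and B: "finite B"
    and \<Phi>: "\<And>z. \<Phi> z \<in> cspace B" "\<And>b. b \<in> B \<Longrightarrow> holomorphic_at A p (\<lambda>z. \<Phi> z b)"
  shows "filterlim \<Phi> (germ_nhds B (\<Phi> p)) (germ_nhds A p)"
  unfolding filterlim_iff
proof (intro allI impI)
  fix P assume "eventually P (germ_nhds B (\<Phi> p))"
  then obtain r where r: "0 < r" "\<And>z. z \<in> polydisc B (\<Phi> p) r \<Longrightarrow> P z"
    by (auto simp: eventually_germ_nhds)
  have "\<forall>\<^sub>F z in germ_nhds A p. \<forall>b\<in>B. norm (\<Phi> z b - \<Phi> p b) \<le> r / 2"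
    unfolding eventually_ball_finite_distrib[OF B]
    using eventually_germ_nhds_dist[OF A \<Phi>(2), of _ "r/2"] r(1) by auto
  then show "\<forall>\<^sub>F z in germ_nhds A p. P (\<Phi> z)"
  proof eventually_elim
    case (elim z)
    then show ?case using r(1) \<Phi>(1)[of z]
      by (intro r(2)) (force simp: polydisc_def dist_norm)
  qed
qed

text \<open>On a small polydisc the recentred components of \<open>\<Phi>\<close> have norm at most
  the radius \<open>s\<close> of an expansion of \<open>g\<close>. Each term of the composed series
  is then bounded by the corresponding weighted coefficient of \<open>g\<close>, and
  \<open>majorized_infsum\<close> applies.\<close>

lemma holomorphic_at_compose:
  assumes A: "finite A" "p \<in> cspace A" and B: "finite B"
    and \<Phi>: "\<And>z. \<Phi> z \<in> cspace B" "\<And>b. b \<in> B \<Longrightarrow> holomorphic_at A p (\<lambda>z. \<Phi> z b)"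
    and g: "holomorphic_at B (\<Phi> p) g"
  shows "holomorphic_at A p (g \<circ> \<Phi>)"
proof -
  obtain c s where cs: "0 < s"
    "(\<lambda>\<alpha>. norm (c \<alpha>) * mvpow B (\<lambda>_. s) \<alpha>) summable_on exps B"
    "\<And>z. z \<in> closed_polydisc B (\<Phi> p) (\<lambda>_. s) \<Longrightarrow>
      ((\<lambda>\<alpha>. c \<alpha> * mvpow B (\<lambda>b. z b - \<Phi> p b) \<alpha>) has_sum g z) (exps B)"
    "c 0 = g (\<Phi> p)"
    by (rule holomorphic_at_series[OF B \<Phi>(1) g]) (rule that; assumption)
  have "\<exists>r>0. majorized A p (\<lambda>_. r) s (\<lambda>z. \<Phi> z b - \<Phi> p b)" if "b \<in> B" for b
    by (rule holomorphic_at_majorized_small[OF A \<Phi>(2)[OF that] cs(1)])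
  then obtain R where R: "\<And>b. b \<in> B \<Longrightarrow> 0 < R b"
    "\<And>b. b \<in> B \<Longrightarrow> majorized A p (\<lambda>_. R b) s (\<lambda>z. \<Phi> z b - \<Phi> p b)" by metis
  \<comment> \<open>The inserted 1 gives the minimum a value when \<open>B\<close> is empty.\<close>
  define r where "r = Min (insert 1 (R ` B))"
  have r: "0 < r" "\<And>b. b \<in> B \<Longrightarrow> r \<le> R b" using B R(1) by (auto simp: r_def)
  have maj: "majorized A p (\<lambda>_. r) s (\<lambda>z. \<Phi> z b - \<Phi> p b)" if "b \<in> B" for b
    by (rule majorized_mono[OF R(2)[OF that]]) (use r that in auto)
  have "majorized A p (\<lambda>_. r) (\<Sum>\<^sub>\<infinity>\<alpha>\<in>exps B. norm (c \<alpha>) * mvpow B (\<lambda>_. s) \<alpha>) (g \<circ> \<Phi>)"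
  proof (rule majorized_infsum)
    show "majorized A p (\<lambda>_. r) (norm (c \<alpha>) * mvpow B (\<lambda>_. s) \<alpha>)
        (\<lambda>z. c \<alpha> * mvpow B (\<lambda>b. \<Phi> z b - \<Phi> p b) \<alpha>)" for \<alpha>
      unfolding mvpow_def
      by (intro majorized_cmult majorized_prod majorized_power maj B) (use r in auto)
    fix z assume z: "z \<in> closed_polydisc A p (\<lambda>_. r)"
    have "\<Phi> z \<in> closed_polydisc B (\<Phi> p) (\<lambda>_. s)"
      using majorized_norm_le[OF maj z] \<Phi>(1) by (auto simp: closed_polydisc_def)
    from cs(3)[OF this]
    show "((\<lambda>\<alpha>. c \<alpha> * mvpow B (\<lambda>b. \<Phi> z b - \<Phi> p b) \<alpha>) has_sum (g \<circ> \<Phi>) z) (exps B)" by simp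
  qed (use cs r in auto)
  then show ?thesis by (rule holomorphic_atI[OF A(1)])
qed

section \<open>The ring of holomorphic germs\<close>

lemma
  assumes "finite A" "p \<in> cspace A" "holomorphic_at A p f" "holomorphic_at A p g"
  shows holomorphic_at_mult: "holomorphic_at A p (\<lambda>z. f z * g z)"
    and holomorphic_at_add: "holomorphic_at A p (\<lambda>z. f z + g z)"
proof -
  obtain r M where r: "0 < r" "majorized A p (\<lambda>_. r) M f"
    using holomorphic_at_majorized[OF assms(1-3)] by blast
  obtain s N where s: "0 < s" "majorized A p (\<lambda>_. s) N g"
    using holomorphic_at_majorized[OF assms(1,2,4)] by blast
  have f: "majorized A p (\<lambda>_. min r s) M f"
    by (rule majorized_mono[OF r(2)]) (use r s in auto)
  have g: "majorized A p (\<lambda>_. min r s) N g"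
    by (rule majorized_mono[OF s(2)]) (use r s in auto)
  show "holomorphic_at A p (\<lambda>z. f z * g z)" "holomorphic_at A p (\<lambda>z. f z + g z)"
    using holomorphic_atI[OF assms(1) majorized_mult[OF f g]]
      holomorphic_atI[OF assms(1) majorized_add[OF f g]] by auto
qed

lemma holomorphic_at_const: "finite A \<Longrightarrow> holomorphic_at A p (\<lambda>_. k)"
  using holomorphic_atI[OF _ majorized_const[of A "\<lambda>_. 1" p k]] by simp

lemma holomorphic_at_uminus:
  assumes "finite A" "p \<in> cspace A" "holomorphic_at A p f"
  shows "holomorphic_at A p (\<lambda>z. - f z)"
  using holomorphic_at_mult[OF assms(1,2) holomorphic_at_const[OF assms(1), of p "-1"] assms(3)] by simp

lemma holomorphic_at_diff:
  assumes "finite A" "p \<in> cspace A" "holomorphic_at A p f" "holomorphic_at A p g"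
  shows "holomorphic_at A p (\<lambda>z. f z - g z)"
  using holomorphic_at_add[OF assms(1-3) holomorphic_at_uminus[OF assms(1,2,4)]] by simp

lemma holomorphic_at_mvpow:
  assumes "finite A" "\<alpha> \<in> exps A"
  shows "holomorphic_at A (\<lambda>_. 0) (\<lambda>z. mvpow A z \<alpha>)"
  using holomorphic_atI[OF assms(1) majorized_mvpow[of A "\<lambda>_. 1" \<alpha> "\<lambda>_. 0", OF _ assms(2)]] by simp

lemma holomorphic_at_sum:
  assumes "finite A" "p \<in> cspace A" "\<And>i. i \<in> I \<Longrightarrow> holomorphic_at A p (f i)"
  shows "holomorphic_at A p (\<lambda>z. \<Sum>i\<in>I. f i z)"
  using assms(3)
  by (induction I rule: infinite_finite_induct)
    (simp_all add: holomorphic_at_const holomorphic_at_add assms(1,2))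

lemma holomorphic_at_cong:
  assumes "holomorphic_at A p f" "\<forall>\<^sub>F z in germ_nhds A p. f z = g z"
  shows "holomorphic_at A p g"
proof -
  obtain c where "\<forall>\<^sub>F z in germ_nhds A p.
      ((\<lambda>\<alpha>. c \<alpha> * (\<Prod>a\<in>A. (z a - p a) ^ lookup \<alpha> a)) has_sum f z) {\<alpha>. keys \<alpha> \<subseteq> A}"
    using assms(1) by (auto simp: holomorphic_at_def)
  then have "\<forall>\<^sub>F z in germ_nhds A p.
      ((\<lambda>\<alpha>. c \<alpha> * (\<Prod>a\<in>A. (z a - p a) ^ lookup \<alpha> a)) has_sum g z) {\<alpha>. keys \<alpha> \<subseteq> A}"
    using assms(2) by eventually_elim simp
  then show ?thesis by (auto simp: holomorphic_at_def)
qed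

lemma hol_ring_simps [simp]:
  "carrier (hol_ring A p) = {f. holomorphic_at A p f}"
  "f \<otimes>\<^bsub>hol_ring A p\<^esub> g = (\<lambda>z. f z * g z)"
  "f \<oplus>\<^bsub>hol_ring A p\<^esub> g = (\<lambda>z. f z + g z)"
  "\<one>\<^bsub>hol_ring A p\<^esub> = (\<lambda>_. 1)"
  "\<zero>\<^bsub>hol_ring A p\<^esub> = (\<lambda>_. 0)"
  by (simp_all add: hol_ring_def)

lemma ring_hol_ring:
  assumes "finite A" "p \<in> cspace A"
  shows "ring (hol_ring A p)"
proof (rule ringI)
  show "abelian_group (hol_ring A p)"
  proof (rule abelian_groupI)
    fix f assume "f \<in> carrier (hol_ring A p)"
    then show "\<exists>g\<in>carrier (hol_ring A p). g \<oplus>\<^bsub>hol_ring A p\<^esub> f = \<zero>\<^bsub>hol_ring A p\<^esub>"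
      using holomorphic_at_uminus[OF assms, of f] by (intro bexI[of _ "\<lambda>z. - f z"]) auto
  qed (auto simp: holomorphic_at_add assms holomorphic_at_const algebra_simps)
  show "Group.monoid (hol_ring A p)"
    by (rule Group.monoidI) (auto simp: holomorphic_at_mult assms holomorphic_at_const algebra_simps)
qed (auto simp: algebra_simps)

text \<open>Additive inverses come from multiplication by the constant -1, which is
  holomorphic.\<close>

lemma ideal_hol_ringI:
  assumes A: "finite A" "p \<in> cspace A"
    and K: "\<And>f. f \<in> K \<Longrightarrow> holomorphic_at A p f" "(\<lambda>_. 0) \<in> K"
      "\<And>f g. f \<in> K \<Longrightarrow> g \<in> K \<Longrightarrow> (\<lambda>z. f z + g z) \<in> K"
      "\<And>f h. f \<in> K \<Longrightarrow> holomorphic_at A p h \<Longrightarrow> (\<lambda>z. h z * f z) \<in> K"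
  shows "ideal K (hol_ring A p)"
proof (rule idealI)
  interpret ring "hol_ring A p" by (rule ring_hol_ring[OF A])
  show "ring (hol_ring A p)" by (rule ring_hol_ring[OF A])
  show "subgroup K (add_monoid (hol_ring A p))"
  proof (rule group.subgroupI[OF a_group])
    fix f assume f: "f \<in> K"
    have m: "(\<lambda>z. - f z) \<in> K"
      using K(4)[OF f holomorphic_at_const[OF A(1), of p "-1"]] by simp
    have "\<ominus>\<^bsub>hol_ring A p\<^esub> f = (\<lambda>z. - f z)"
      by (rule minus_equality) (use K(1)[OF f] K(1)[OF m] in auto)
    then show "inv\<^bsub>add_monoid (hol_ring A p)\<^esub> f \<in> K"
      using m by (simp add: a_inv_def)
  qed (use K in \<open>auto simp: hol_ring_def\<close>)
qed (use K(4) in \<open>auto simp: mult.commute\<close>)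

lemma ideal_hol_ringD:
  assumes "finite A" "p \<in> cspace A" "ideal K (hol_ring A p)"
  shows "\<And>f. f \<in> K \<Longrightarrow> holomorphic_at A p f" "(\<lambda>_. 0) \<in> K"
    "\<And>f g. f \<in> K \<Longrightarrow> g \<in> K \<Longrightarrow> (\<lambda>z. f z + g z) \<in> K"
    "\<And>f h. f \<in> K \<Longrightarrow> holomorphic_at A p h \<Longrightarrow> (\<lambda>z. h z * f z) \<in> K"
proof -
  interpret ideal K "hol_ring A p" by fact
  show "\<And>f. f \<in> K \<Longrightarrow> holomorphic_at A p f" using a_subset by auto
  show "(\<lambda>_. 0) \<in> K" using additive_subgroup.zero_closed[OF is_additive_subgroup] by simp
  show "(\<lambda>z. f z + g z) \<in> K" if "f \<in> K" "g \<in> K" for f g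
    using additive_subgroup.a_closed[OF is_additive_subgroup that] by simp
  show "(\<lambda>z. h z * f z) \<in> K" if "f \<in> K" "holomorphic_at A p h" for f h
    using I_l_closed[OF that(1), of h] that(2) by simp
qed

lemma ideal_hol_ring_sum:
  assumes "finite A" "p \<in> cspace A" "ideal K (hol_ring A p)" "\<And>i. i \<in> I \<Longrightarrow> f i \<in> K"
  shows "(\<lambda>z. \<Sum>i\<in>I. f i z) \<in> K"
  using assms(4)
  by (induction I rule: infinite_finite_induct) (simp_all add: ideal_hol_ringD[OF assms(1-3)])

section \<open>Uniqueness of coefficients and Dickson's lemma\<close>

text \<open>A nonzero coefficient of positive index would keep a sum that vanishes at 0 away from 0
  on a punctured disc. The coefficient of index 0 is the value at 0.\<close>

lemma power_series_zero:
  fixes a :: "nat \<Rightarrow> complex"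
  assumes r: "0 < r" and sums: "\<And>x. norm x < r \<Longrightarrow> (\<lambda>n. a n * x ^ n) sums 0"
  shows "a m = 0"
proof (cases "m = 0")
  case True
  have "(\<lambda>n. a n * 0 ^ n) sums a 0" using powser_sums_zero[of a] by simp
  with sums[of 0] r show ?thesis using True sums_unique2 by auto
next
  case False
  show ?thesis
  proof (rule ccontr)
    assume "a m \<noteq> 0"
    show False
    proof (rule powser_0_nonzero[OF r, of 0 a "\<lambda>_. 0" m])
      fix s :: real assume s: "0 < s" and n: "\<And>z::complex. z \<in> cball 0 s - {0} \<Longrightarrow> (0::complex) \<noteq> 0"
      show False using n[of "of_real s"] s by simp
    qed (use sums False \<open>a m \<noteq> 0\<close> in auto)
  qed
qed

text \<open>Induction on the set of variables. With the other coordinates fixed, the family is a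
  power series in the new coordinate \<open>t\<close>, whose coefficients vanish by the one-variable
  case. These coefficients are themselves series in the remaining variables, to which the induction
  hypothesis applies.\<close>

lemma coeffs_eq_zero:
  assumes "finite A" "0 < r"
    and "\<And>z. z \<in> polydisc A (\<lambda>_. 0) r \<Longrightarrow> ((\<lambda>\<alpha>. c \<alpha> * mvpow A z \<alpha>) has_sum 0) (exps A)"
    and "\<alpha> \<in> exps A"
  shows "c \<alpha> = 0"
  using assms
proof (induction A arbitrary: c \<alpha> rule: finite_induct)
  case empty
  have e: "exps {} = {0}" by (auto simp: exps_def)
  have o: "(\<lambda>_. 0) \<in> polydisc {} (\<lambda>_. 0) r" by (simp add: polydisc_def cspace_def)
  have "((\<lambda>\<alpha>. c \<alpha> * mvpow {} (\<lambda>_. 0) \<alpha>) has_sum 0) {0}"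
    using empty.prems(2)[OF o] unfolding e .
  then have "0 = (\<Sum>\<alpha>\<in>{0}. c \<alpha> * mvpow {} (\<lambda>_. 0) \<alpha>)"
    by (rule has_sum_unique[OF _ has_sum_finite]) simp
  moreover have "\<alpha> = 0" using empty.prems(3) unfolding e by simp
  ultimately show ?case by simp
next
  case (insert a A)
  let ?s = "\<lambda>n. Poly_Mapping.single a (n::nat)"
  have lk: "lookup \<beta> a = 0" if "\<beta> \<in> exps A" for \<beta>
    using that insert.hyps by (simp add: exps_iff)
  have bij: "bij_betw (\<lambda>(n, \<beta>). ?s n + \<beta>) (UNIV \<times> exps A) (exps (insert a A))"
  proof (rule bij_betwI[of _ _ _ "\<lambda>\<beta>. (lookup \<beta> a, \<beta> - ?s (lookup \<beta> a))"])
    show "(\<lambda>(n, \<beta>). ?s n + \<beta>) \<in> UNIV \<times> exps A \<rightarrow> exps (insert a A)"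
      by (auto simp: exps_iff lookup_add lookup_single when_def)
    show "(\<lambda>\<beta>. (lookup \<beta> a, \<beta> - ?s (lookup \<beta> a))) \<in> exps (insert a A) \<rightarrow> UNIV \<times> exps A"
      using insert.hyps by (auto simp: exps_iff lookup_minus lookup_single when_def)
    show "(\<lambda>\<beta>. (lookup \<beta> a, \<beta> - ?s (lookup \<beta> a))) ((\<lambda>(n, \<beta>). ?s n + \<beta>) x) = x"
      if "x \<in> UNIV \<times> exps A" for x
      using that lk by (auto simp: lookup_add)
    show "(\<lambda>(n, \<beta>). ?s n + \<beta>) ((\<lambda>\<beta>. (lookup \<beta> a, \<beta> - ?s (lookup \<beta> a))) \<beta>) = \<beta>" for \<beta>
      by (rule poly_mapping_eqI) (auto simp: lookup_add lookup_minus lookup_single when_def)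
  qed
  have mv: "mvpow (insert a A) (z(a := t)) (?s n + \<beta>) = t ^ n * mvpow A z \<beta>"
    if "\<beta> \<in> exps A" for z :: "_ \<Rightarrow> complex" and t n \<beta>
  proof -
    have "(\<Prod>b\<in>A. (z(a := t)) b ^ lookup (?s n + \<beta>) b) = mvpow A z \<beta>"
      unfolding mvpow_def using insert.hyps
      by (intro prod.cong) (auto simp: lookup_add lookup_single when_def)
    then show ?thesis
      using insert.hyps lk[OF that] by (simp add: mvpow_def lookup_add)
  qed
  have sum2: "((\<lambda>(n, \<beta>). c (?s n + \<beta>) * (t ^ n * mvpow A z \<beta>)) has_sum 0) (UNIV \<times> exps A)"
    if z: "z \<in> polydisc A (\<lambda>_. 0) r" and t: "norm t < r" for z t
  proof -
    have "z(a := t) \<in> polydisc (insert a A) (\<lambda>_. 0) r"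
      using z t insert.hyps by (auto simp: polydisc_def cspace_def)
    from insert.prems(2)[OF this]
    have "((\<lambda>x. c (case x of (n, \<beta>) \<Rightarrow> ?s n + \<beta>) * mvpow (insert a A) (z(a := t)) (case x of (n, \<beta>) \<Rightarrow> ?s n + \<beta>))
        has_sum 0) (UNIV \<times> exps A)"
      by (subst has_sum_reindex_bij_betw[OF bij])
    then show ?thesis
      by (rule has_sum_cong[THEN iffD1, rotated]) (auto simp: mv)
  qed
  have "((\<lambda>\<beta>. c (?s n + \<beta>) * mvpow A z \<beta>) has_sum 0) (exps A)"
    if z: "z \<in> polydisc A (\<lambda>_. 0) r" for z n
  proof -
    define d where "d n = (\<Sum>\<^sub>\<infinity>\<beta>\<in>exps A. c (?s n + \<beta>) * mvpow A z \<beta>)" for n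
    have summ: "(\<lambda>\<beta>. c (?s n + \<beta>) * mvpow A z \<beta>) summable_on exps A" for n
    proof -
      \<comment> \<open>Summability of a slice is read off at the nonzero value
        \<open>t = r/2\<close>; the factor \<open>t ^ n\<close> is then divided out.\<close>
      have "(\<lambda>\<beta>. c (?s n + \<beta>) * (of_real (r/2) ^ n * mvpow A z \<beta>)) summable_on exps A"
        using summable_on_SigmaD1[OF has_sum_imp_summable[OF sum2[OF z, of "of_real (r/2)"]], of n]
          insert.prems(1) by simp
      from summable_on_cmult_right[OF this, of "1 / of_real (r/2) ^ n"]
      show ?thesis using insert.prems(1) by (simp add: field_simps)
    qed
    have "(\<lambda>n. d n * t ^ n) sums 0" if t: "norm t < r" for t
    proof (rule has_sum_imp_sums)
      have "((\<lambda>\<beta>. c (?s n + \<beta>) * (t ^ n * mvpow A z \<beta>)) has_sum (d n * t ^ n)) (exps A)" for n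
        using has_sum_cmult_left[OF has_sum_infsum[OF summ[of n]], of "t ^ n"]
        by (simp add: d_def mult_ac)
      then show "((\<lambda>n. d n * t ^ n) has_sum 0) UNIV"
        by (intro has_sum_SigmaD[OF sum2[OF z t]]) auto
    qed
    from power_series_zero[OF insert.prems(1) this] have "d n = 0" .
    then show ?thesis using has_sum_infsum[OF summ[of n]] by (simp add: d_def)
  qed
  from insert.IH[OF insert.prems(1) this] have c0: "c (?s n + \<beta>) = 0" if "\<beta> \<in> exps A" for n \<beta>
    using that by blast
  have "\<alpha> \<in> (\<lambda>(n, \<beta>). ?s n + \<beta>) ` (UNIV \<times> exps A)"
    using bij_betw_imp_surj_on[OF bij] insert.prems(3) by simp
  then obtain n \<beta> where "\<alpha> = ?s n + \<beta>" "\<beta> \<in> exps A" by auto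
  with c0 show ?case by simp
qed

lemma coeffs_eq_zero_eventually:
  assumes "finite A"
    and "\<forall>\<^sub>F z in germ_nhds A (\<lambda>_. 0). ((\<lambda>\<alpha>. c \<alpha> * mvpow A z \<alpha>) has_sum 0) (exps A)"
    and "\<alpha> \<in> exps A"
  shows "c \<alpha> = 0"
proof -
  obtain r where r: "0 < r" "\<And>z. z \<in> polydisc A (\<lambda>_. 0) r \<Longrightarrow> ((\<lambda>\<alpha>. c \<alpha> * mvpow A z \<alpha>) has_sum 0) (exps A)"
    using assms(2) by (auto simp: eventually_germ_nhds)
  from coeffs_eq_zero[OF assms(1) r assms(3)] show ?thesis .
qed

section \<open>Dickson's lemma\<close>

lemma nat_mono_subseq:
  fixes g :: "nat \<Rightarrow> nat"
  shows "\<exists>\<psi>. strict_mono \<psi> \<and> incseq (\<lambda>n. g (\<psi> n))"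
proof -
  obtain \<psi> where \<psi>: "strict_mono \<psi>" "monoseq (\<lambda>n. g (\<psi> n))"
    using seq_monosub[of g] by blast
  show ?thesis
  proof (cases "incseq (\<lambda>n. g (\<psi> n))")
    case False
    then have dec: "\<And>m n. m \<le> n \<Longrightarrow> g (\<psi> n) \<le> g (\<psi> m)"
      using \<psi>(2) unfolding monoseq_def incseq_def by blast
    \<comment> \<open>A decreasing sequence of naturals is constant from an index where its minimum
      is attained.\<close>
    obtain m where m: "\<And>n. g (\<psi> m) \<le> g (\<psi> n)"
      using ex_has_least_nat[of "\<lambda>_. True" _ "\<lambda>n. g (\<psi> n)"] by auto
    have "g (\<psi> (m + n)) = g (\<psi> m)" for n
      using dec[of m "m + n"] m[of "m + n"] by simp
    moreover have "strict_mono (\<lambda>n. \<psi> (m + n))"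
      using \<psi>(1) by (auto simp: strict_mono_def)
    ultimately show ?thesis by (intro exI[of _ "\<lambda>n. \<psi> (m + n)"]) (simp add: incseq_def)
  qed (use \<psi> in blast)
qed

text \<open>One thinning per coordinate; monotonicity in the earlier coordinates survives the
  passage to a subsequence.\<close>

lemma dickson_subseq:
  fixes f :: "nat \<Rightarrow> 'a \<Rightarrow> nat"
  assumes "finite A"
  shows "\<exists>\<phi>. strict_mono \<phi> \<and> (\<forall>a\<in>A. incseq (\<lambda>n. f (\<phi> n) a))"
  using assms
proof (induction A rule: finite_induct)
  case empty
  then show ?case by (intro exI[of _ id]) (simp add: strict_mono_def)
next
  case (insert a A)
  then obtain \<phi> where \<phi>: "strict_mono \<phi>" "\<forall>a\<in>A. incseq (\<lambda>n. f (\<phi> n) a)" by blast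
  obtain \<psi> where \<psi>: "strict_mono \<psi>" "incseq (\<lambda>n. f (\<phi> (\<psi> n)) a)"
    using nat_mono_subseq[of "\<lambda>n. f (\<phi> n) a"] by blast
  have "strict_mono (\<phi> \<circ> \<psi>)" by (rule strict_mono_o[OF \<phi>(1) \<psi>(1)])
  moreover have "incseq (\<lambda>n. f (\<phi> (\<psi> n)) b)" if "b \<in> A" for b
    unfolding incseq_def
    using incseqD[OF \<phi>(2)[rule_format, OF that]] strict_mono_leD[OF \<psi>(1)] by blast
  ultimately show ?case
    using \<psi>(2) by (intro exI[of _ "\<phi> \<circ> \<psi>"]) (simp add: o_def)
qed

text \<open>An infinite set would contain two distinct elements that are comparable in every
  coordinate. Coordinates are read through \<open>f\<close> so that exponents and pairs of exponents
  are covered alike.\<close>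

lemma dickson_antichain:
  fixes f :: "'s \<Rightarrow> 'a \<Rightarrow> nat"
  assumes "finite A"
    and "\<And>s t. s \<in> S \<Longrightarrow> t \<in> S \<Longrightarrow> (\<And>a. a \<in> A \<Longrightarrow> f s a \<le> f t a) \<Longrightarrow> s = t"
  shows "finite S"
proof (rule ccontr)
  assume "infinite S"
  then obtain s :: "nat \<Rightarrow> 's" where s: "inj s" "range s \<subseteq> S"
    using infinite_countable_subset by blast
  obtain \<phi> where \<phi>: "strict_mono \<phi>" "\<forall>a\<in>A. incseq (\<lambda>n. f (s (\<phi> n)) a)"
    using dickson_subseq[OF assms(1), of "\<lambda>n. f (s n)"] by blast
  have "s (\<phi> 0) = s (\<phi> 1)"
    using s(2) incseqD[OF \<phi>(2)[rule_format], of _ 0 1] by (intro assms(2)) auto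
  then have "\<phi> 0 = \<phi> 1" using s(1) by (simp add: inj_eq)
  then show False using strict_monoD[OF \<phi>(1), of 0 1] by simp
qed

section \<open>Monomial maps\<close>

text \<open>The exponent map \<open>\<mu>\<close> of the overview: substituting the monomial with
  exponent \<open>m x\<close> for each variable \<open>x\<close> turns the monomial
  \<open>\<beta>\<close> into the one with exponent \<open>expsum m \<beta>\<close>.\<close>

definition expsum :: "('x \<Rightarrow> ('a \<Rightarrow>\<^sub>0 nat)) \<Rightarrow> ('x \<Rightarrow>\<^sub>0 nat) \<Rightarrow> ('a \<Rightarrow>\<^sub>0 nat)" where
  "expsum m \<beta> = (\<Sum>x\<in>keys \<beta>. Poly_Mapping.map ((*) (lookup \<beta> x)) (m x))"

definition total_degree :: "'a set \<Rightarrow> ('a \<Rightarrow>\<^sub>0 nat) \<Rightarrow> nat" where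
  "total_degree A \<alpha> = (\<Sum>a\<in>A. lookup \<alpha> a)"

lemma total_degree_add: "total_degree A (\<alpha> + \<beta>) = total_degree A \<alpha> + total_degree A \<beta>"
  by (simp add: total_degree_def lookup_add sum.distrib)

lemma total_degree_pos:
  assumes "finite A" "\<alpha> \<in> exps A" "\<alpha> \<noteq> 0"
  shows "0 < total_degree A \<alpha>"
proof -
  obtain a where a: "lookup \<alpha> a \<noteq> 0" using assms(3) by (metis lookup_zero poly_mapping_eqI)
  then have "a \<in> A" using assms(2) by (auto simp: exps_iff)
  with a assms(1) show ?thesis unfolding total_degree_def by (intro sum_pos2[of _ a]) auto
qed

lemma mvpow_const: "mvpow A (\<lambda>_. s) \<alpha> = s ^ total_degree A \<alpha>"
  by (simp add: mvpow_def total_degree_def power_sum)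

lemma lookup_expsum:
  assumes "finite G" "keys \<beta> \<subseteq> G"
  shows "lookup (expsum m \<beta>) a = (\<Sum>x\<in>G. lookup \<beta> x * lookup (m x) a)"
proof -
  have "lookup (expsum m \<beta>) a = (\<Sum>x\<in>keys \<beta>. lookup \<beta> x * lookup (m x) a)"
    by (auto simp: expsum_def lookup_sum Poly_Mapping.map.rep_eq when_def intro!: sum.cong)
  also have "\<dots> = (\<Sum>x\<in>G. lookup \<beta> x * lookup (m x) a)"
    using assms by (intro sum.mono_neutral_left) (auto simp: in_keys_iff)
  finally show ?thesis .
qed

lemma expsum_add: "expsum m (\<beta> + \<gamma>) = expsum m \<beta> + expsum m \<gamma>"
proof (rule poly_mapping_eqI)
  fix a
  let ?G = "keys \<beta> \<union> keys \<gamma>"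
  show "lookup (expsum m (\<beta> + \<gamma>)) a = lookup (expsum m \<beta> + expsum m \<gamma>) a"
    using lookup_expsum[of ?G "\<beta> + \<gamma>" m a, OF _ keys_add] lookup_expsum[of ?G \<beta> m a]
      lookup_expsum[of ?G \<gamma> m a]
    by (simp add: lookup_add distrib_right sum.distrib)
qed

lemma expsum_zero [simp]: "expsum m 0 = 0"
  by (simp add: expsum_def)

lemma has_sum_finite_sum:
  fixes f :: "'k \<Rightarrow> 'b \<Rightarrow> 'c::topological_comm_monoid_add"
  assumes "\<And>k. k \<in> K \<Longrightarrow> (f k has_sum S k) B"
  shows "((\<lambda>b. \<Sum>k\<in>K. f k b) has_sum (\<Sum>k\<in>K. S k)) B"
  using assms
  by (induction K rule: infinite_finite_induct) (auto intro: has_sum_add has_sum_0)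

text \<open>The general setting of a toric map. By \<open>m_nonzero\<close> all generators have
  positive degree, so that \<open>q\<close> fixes the origin and exponents are controlled by the
  degree of their image.\<close>

locale monomial_map =
  fixes A :: "'a set" and G :: "'x set" and m :: "'x \<Rightarrow> ('a \<Rightarrow>\<^sub>0 nat)"
  assumes finite_A: "finite A" and finite_G: "finite G"
    and m_exps: "\<And>x. x \<in> G \<Longrightarrow> m x \<in> exps A" and m_nonzero: "\<And>x. x \<in> G \<Longrightarrow> m x \<noteq> 0"
begin

abbreviation "\<mu> \<equiv> expsum m"

definition q :: "('a \<Rightarrow> complex) \<Rightarrow> 'x \<Rightarrow> complex" where
  "q w = (\<lambda>x. if x \<in> G then mvpow A w (m x) else 0)"

definition weight_radius :: "real \<Rightarrow> 'x \<Rightarrow> real" where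
  "weight_radius s x = s ^ total_degree A (m x)"

lemma mu_exps:
  assumes "\<beta> \<in> exps G"
  shows "\<mu> \<beta> \<in> exps A"
  using m_exps lookup_expsum[OF finite_G, of \<beta> m] assms
  by (auto simp: exps_iff[of _ A] exps_def[of G])

lemma mvpow_mu:
  assumes "\<beta> \<in> exps G"
  shows "mvpow G (\<lambda>x. mvpow A w (m x)) \<beta> = mvpow A w (\<mu> \<beta>)"
proof -
  have "keys \<beta> \<subseteq> G" using assms by (simp add: exps_def)
  note l = lookup_expsum[OF finite_G this]
  have "mvpow G (\<lambda>x. mvpow A w (m x)) \<beta> = (\<Prod>x\<in>G. \<Prod>a\<in>A. w a ^ (lookup \<beta> x * lookup (m x) a))"
    by (simp add: mvpow_def prod_power_distrib power_mult [symmetric] mult.commute)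
  also have "\<dots> = (\<Prod>a\<in>A. \<Prod>x\<in>G. w a ^ (lookup \<beta> x * lookup (m x) a))"
    by (rule prod.swap)
  also have "\<dots> = mvpow A w (\<mu> \<beta>)"
    by (simp add: mvpow_def l power_sum)
  finally show ?thesis .
qed

lemma mvpow_q:
  assumes "\<beta> \<in> exps G"
  shows "mvpow G (q w) \<beta> = mvpow A w (\<mu> \<beta>)"
  using mvpow_cong[of G "q w" "\<lambda>x. mvpow A w (m x)" \<beta>] mvpow_mu[OF assms, of w] by (simp add: q_def)

lemma mvpow_weight_radius:
  assumes "\<beta> \<in> exps G"
  shows "mvpow G (weight_radius s) \<beta> = s ^ total_degree A (\<mu> \<beta>)"
proof -
  have "weight_radius s = (\<lambda>x. mvpow A (\<lambda>_. s) (m x))"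
    by (simp add: fun_eq_iff weight_radius_def mvpow_const)
  then show ?thesis using mvpow_mu[OF assms, of "\<lambda>_. s"] by (simp add: mvpow_const)
qed

lemma weight_radius_pos: "0 < s \<Longrightarrow> 0 < weight_radius s x"
  by (simp add: weight_radius_def)

text \<open>Every generator has degree at least 1. In \<open>kernel_generated\<close> this bounds
  the count of \<open>binomial_division\<close> by the degree of the common image.\<close>

lemma total_degree_le:
  assumes "\<beta> \<in> exps G"
  shows "total_degree G \<beta> \<le> total_degree A (\<mu> \<beta>)"
proof -
  have "keys \<beta> \<subseteq> G" using assms by (simp add: exps_def)
  note l = lookup_expsum[OF finite_G this]
  have "total_degree A (\<mu> \<beta>) = (\<Sum>x\<in>G. lookup \<beta> x * total_degree A (m x))"
    by (simp add: total_degree_def l sum_distrib_left sum.swap[of _ A])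
  moreover have "lookup \<beta> x \<le> lookup \<beta> x * total_degree A (m x)" if "x \<in> G" for x
    using total_degree_pos[OF finite_A m_exps[OF that] m_nonzero[OF that]] by simp
  ultimately show ?thesis
    unfolding total_degree_def[of G] by (simp add: sum_mono)
qed

lemma q_closed_polydisc:
  assumes "w \<in> closed_polydisc A (\<lambda>_. 0) (\<lambda>_. s)"
  shows "q w \<in> closed_polydisc G (\<lambda>_. 0) (weight_radius s)"
  using norm_mvpow_le[OF assms]
  by (auto simp: closed_polydisc_def cspace_def q_def weight_radius_def mvpow_const)

section \<open>The monoid of binomial relations\<close>

definition relations :: "(('x \<Rightarrow>\<^sub>0 nat) \<times> ('x \<Rightarrow>\<^sub>0 nat)) set" where
  "relations = {e. fst e \<in> exps G \<and> snd e \<in> exps G \<and> \<mu> (fst e) = \<mu> (snd e)}"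

text \<open>The irreducible elements of the monoid of relations. Apart from the pairs matching a
  generator with itself, whose binomials are 0, they form the Graver basis of the toric
  ideal.\<close>

definition prim_relations :: "(('x \<Rightarrow>\<^sub>0 nat) \<times> ('x \<Rightarrow>\<^sub>0 nat)) set" where
  "prim_relations = {e \<in> relations. e \<noteq> 0 \<and> (\<forall>e1\<in>relations. \<forall>e2\<in>relations. e = e1 + e2 \<longrightarrow> e1 = 0 \<or> e2 = 0)}"

text \<open>Since \<open>\<mu>\<close> is additive and exponents cancel, the difference of two
  comparable relations is again a relation; hence distinct irreducible ones are incomparable. The
  Boolean distinguishes the two components of a pair among the coordinates for Dickson's
  lemma.\<close>

lemma finite_prim_relations: "finite prim_relations"
proof (rule dickson_antichain[where A = "G \<times> UNIV" and
    f = "\<lambda>e (x, t). if t then lookup (fst e) x else lookup (snd e) x"])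
  show "finite (G \<times> (UNIV :: bool set))" using finite_G by simp
  fix e e' assume e: "e \<in> prim_relations" and e': "e' \<in> prim_relations"
    and le: "\<And>a. a \<in> G \<times> UNIV \<Longrightarrow> (case a of (x, t) \<Rightarrow> if t then lookup (fst e) x else lookup (snd e) x)
        \<le> (case a of (x, t) \<Rightarrow> if t then lookup (fst e') x else lookup (snd e') x)"
  have r: "e \<in> relations" "e' \<in> relations" using e e' by (auto simp: prim_relations_def)
  have le1: "lookup (fst e) x \<le> lookup (fst e') x" for x
    using le[of "(x, True)"] r by (cases "x \<in> G") (auto simp: relations_def exps_iff)
  have le2: "lookup (snd e) x \<le> lookup (snd e') x" for x
    using le[of "(x, False)"] r by (cases "x \<in> G") (auto simp: relations_def exps_iff)
  define d where "d = (fst e' - fst e, snd e' - snd e)"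
  have s1: "fst e' = fst e + fst d" and s2: "snd e' = snd e + snd d"
    by (rule poly_mapping_eqI, simp add: d_def lookup_add lookup_minus le1 le2)+
  then have s: "e' = e + d" by (simp add: prod_eq_iff)
  have "\<mu> (fst e) + \<mu> (fst d) = \<mu> (snd e) + \<mu> (snd d)"
    using r(2) unfolding relations_def by (simp add: s1 s2 expsum_add)
  then have "\<mu> (fst d) = \<mu> (snd d)"
    using r(1) by (simp add: relations_def)
  moreover have "fst d \<in> exps G" "snd d \<in> exps G"
    using r by (auto simp: d_def relations_def exps_iff lookup_minus)
  ultimately have "d \<in> relations" by (simp add: relations_def)
  then have "e = 0 \<or> d = 0" using e' r s by (auto simp: prim_relations_def)
  then show "e = e'" using e s by (auto simp: prim_relations_def)
qed

text \<open>If \<open>(b, g)\<close> splits into two relations, then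
  \<open>z\<^bsup>b+b'\<^esup> - z\<^bsup>g+g'\<^esup> = z\<^bsup>b'\<^esup> (z\<^bsup>b\<^esup> - z\<^bsup>g\<^esup>) + z\<^bsup>g\<^esup> (z\<^bsup>b'\<^esup> - z\<^bsup>g'\<^esup>)\<close>. The radius \<open>weight_radius s\<close> gives
  all monomials with the same image under \<open>\<mu>\<close> the same size, so the bound only grows with the number
  of splittings, which is linear in the degree.\<close>

lemma binomial_division:
  assumes s: "0 < s"
  shows "\<exists>C\<ge>0. \<forall>e\<in>relations. \<exists>H.
    (\<forall>k\<in>prim_relations. majorized G (\<lambda>_. 0) (weight_radius s)
       (real (total_degree G (fst e) + total_degree G (snd e)) * s ^ total_degree A (\<mu> (fst e)) * C) (H k)) \<and>
    (\<forall>z. mvpow G z (fst e) - mvpow G z (snd e) =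
       (\<Sum>k\<in>prim_relations. H k z * (mvpow G z (fst k) - mvpow G z (snd k))))"
proof -
  \<comment> \<open>A primitive relation is divided by itself with quotient 1, so its bound has to
    be at least 1. The sum makes one constant serve all primitive relations.\<close>
  define C where "C = (\<Sum>k\<in>prim_relations. 1 / s ^ total_degree A (\<mu> (fst k)))"
  have C0: "0 \<le> C" unfolding C_def using s by (intro sum_nonneg) auto
  have C1: "1 \<le> s ^ total_degree A (\<mu> (fst k)) * C" if "k \<in> prim_relations" for k
  proof -
    have "1 / s ^ total_degree A (\<mu> (fst k)) \<le> C"
      unfolding C_def using s that finite_prim_relations
      by (intro member_le_sum[of k prim_relations "\<lambda>k. 1 / s ^ total_degree A (\<mu> (fst k))"]) auto
    then show ?thesis using s by (simp add: field_simps)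
  qed
  let ?n = "\<lambda>e. total_degree G (fst e) + total_degree G (snd e)"
  let ?M = "\<lambda>e. real (?n e) * s ^ total_degree A (\<mu> (fst e)) * C"
  let ?maj = "majorized G (\<lambda>_. 0) (weight_radius s)"
  have wp: "0 < weight_radius s x" for x by (rule weight_radius_pos[OF s])
  have n_pos: "0 < ?n e" if "e \<in> relations" "e \<noteq> 0" for e
    using that total_degree_pos[OF finite_G, of "fst e"] total_degree_pos[OF finite_G, of "snd e"]
    by (cases "fst e = 0") (auto simp: relations_def prod_eq_iff)
  have "\<exists>H. (\<forall>k\<in>prim_relations. ?maj (?M e) (H k)) \<and>
    (\<forall>z. mvpow G z (fst e) - mvpow G z (snd e) =
       (\<Sum>k\<in>prim_relations. H k z * (mvpow G z (fst k) - mvpow G z (snd k))))"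
    if "e \<in> relations" for e
    using that
  proof (induction "?n e" arbitrary: e rule: less_induct)
    case less
    consider "e = 0" | "e \<in> prim_relations"
      | e1 e2 where "e1 \<in> relations" "e2 \<in> relations" "e = e1 + e2" "e1 \<noteq> 0" "e2 \<noteq> 0"
      using less.prems unfolding prim_relations_def by blast
    then show ?case
    proof cases
      case 1
      then show ?thesis
        using majorized_const[of G "weight_radius s" "\<lambda>_. 0" 0] wp
        by (intro exI[of _ "\<lambda>_ _. 0"]) (simp add: total_degree_def)
    next
      case 2
      have "1 * 1 \<le> real (?n e) * (s ^ total_degree A (\<mu> (fst e)) * C)"
        using C1[OF 2] n_pos[of e] 2 by (intro mult_mono) (auto simp: prim_relations_def)
      then have M: "1 \<le> ?M e" by (simp add: mult.assoc)
      have "?maj (?M e) (\<lambda>z. if k = e then 1 else 0)" for k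
        using majorized_mono[OF majorized_const[of G "weight_radius s" "\<lambda>_. 0" "if k = e then 1 else 0"]] wp M
        by (auto split: if_splits)
      moreover have "mvpow G z (fst e) - mvpow G z (snd e) =
         (\<Sum>k\<in>prim_relations. (if k = e then 1 else 0) * (mvpow G z (fst k) - mvpow G z (snd k)))"
        for z :: "'x \<Rightarrow> complex"
        using 2 finite_prim_relations by (simp add: sum.delta' if_distrib[of "\<lambda>c. c * _"] cong: if_cong)
      ultimately show ?thesis
        by (intro exI[of _ "\<lambda>k z. if k = e then 1 else 0"]) blast
    next
      case 3
      have ne: "?n e = ?n e1 + ?n e2" by (simp add: 3 total_degree_add)
      then have "?n e1 < ?n e" "?n e2 < ?n e" using n_pos[of e1] n_pos[of e2] 3 by auto
      from less.hyps[OF this(1) 3(1)] less.hyps[OF this(2) 3(2)] obtain H1 H2 where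
        H1: "\<forall>k\<in>prim_relations. ?maj (?M e1) (H1 k)"
          "\<And>z. mvpow G z (fst e1) - mvpow G z (snd e1) =
             (\<Sum>k\<in>prim_relations. H1 k z * (mvpow G z (fst k) - mvpow G z (snd k)))" and
        H2: "\<forall>k\<in>prim_relations. ?maj (?M e2) (H2 k)"
          "\<And>z. mvpow G z (fst e2) - mvpow G z (snd e2) =
             (\<Sum>k\<in>prim_relations. H2 k z * (mvpow G z (fst k) - mvpow G z (snd k)))"
        by blast
      define H where "H k z = mvpow G z (fst e2) * H1 k z + mvpow G z (snd e1) * H2 k z" for k and z :: "'x \<Rightarrow> complex"
      have ex: "fst e2 \<in> exps G" "snd e1 \<in> exps G" using 3 by (auto simp: relations_def)
      have mu: "\<mu> (fst e) = \<mu> (fst e1) + \<mu> (fst e2)" "\<mu> (snd e1) = \<mu> (fst e1)"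
        using 3 by (auto simp: expsum_add relations_def)
      have "?maj (?M e) (H k)" if k: "k \<in> prim_relations" for k
      proof -
        have "?maj (mvpow G (weight_radius s) (fst e2) * ?M e1 + mvpow G (weight_radius s) (snd e1) * ?M e2) (H k)"
          unfolding H_def
          using majorized_mvpow_mult[OF H1(1)[rule_format, OF k] ex(1), of 1]
            majorized_mvpow_mult[OF H2(1)[rule_format, OF k] ex(2), of 1]
          by (intro majorized_add) simp_all
        \<comment> \<open>The monomial factors raise both powers of \<open>s\<close> to the degree
          of \<open>\<mu> (fst e)\<close>, so that only the counts \<open>?n e1\<close> and
          \<open>?n e2\<close> add up.\<close>
        moreover have "mvpow G (weight_radius s) (fst e2) * ?M e1 + mvpow G (weight_radius s) (snd e1) * ?M e2 = ?M e"
          by (simp only: mvpow_weight_radius[OF ex(1)] mvpow_weight_radius[OF ex(2)] ne mu total_degree_add power_add)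
            (simp add: algebra_simps)
        ultimately show ?thesis by simp
      qed
      moreover have "mvpow G z (fst e) - mvpow G z (snd e) =
          (\<Sum>k\<in>prim_relations. H k z * (mvpow G z (fst k) - mvpow G z (snd k)))" for z
      proof -
        have "mvpow G z (fst e) - mvpow G z (snd e) =
            mvpow G z (fst e2) * (mvpow G z (fst e1) - mvpow G z (snd e1)) +
            mvpow G z (snd e1) * (mvpow G z (fst e2) - mvpow G z (snd e2))"
          by (simp add: 3 mvpow_add algebra_simps)
        also have "\<dots> = (\<Sum>k\<in>prim_relations. H k z * (mvpow G z (fst k) - mvpow G z (snd k)))"
          by (simp add: H1(2) H2(2) H_def sum_distrib_left distrib_right sum.distrib mult.assoc)
        finally show ?thesis .
      qed
      ultimately show ?thesis by blast
    qed
  qed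
  then show ?thesis using C0 by blast
qed

text \<open>One exponent chosen in each fibre of \<open>\<mu>\<close>. It is the normal form of a
  monomial modulo the relations in \<open>kernel_generated\<close> and the exponent of the lifted
  series in \<open>lift_holomorphic\<close>; off the image of \<open>\<mu>\<close> it is
  arbitrary.\<close>

definition lift :: "('a \<Rightarrow>\<^sub>0 nat) \<Rightarrow> ('x \<Rightarrow>\<^sub>0 nat)" where
  "lift \<alpha> = (SOME \<beta>. \<beta> \<in> exps G \<and> \<mu> \<beta> = \<alpha>)"

lemma lift:
  assumes "\<alpha> \<in> \<mu> ` exps G"
  shows "lift \<alpha> \<in> exps G" "\<mu> (lift \<alpha>) = \<alpha>"
proof -
  have "\<exists>\<beta>. \<beta> \<in> exps G \<and> \<mu> \<beta> = \<alpha>" using assms by blast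
  then have "lift \<alpha> \<in> exps G \<and> \<mu> (lift \<alpha>) = \<alpha>" unfolding lift_def by (rule someI_ex)
  then show "lift \<alpha> \<in> exps G" "\<mu> (lift \<alpha>) = \<alpha>" by auto
qed

text \<open>The series \<open>\<Sum> c \<beta> z^(lift (\<mu> \<beta>))\<close> is 0, because its
  coefficients group into fibre sums. Subtracting it term by term presents \<open>g\<close> as a
  series in the binomials of the relations \<open>(\<beta>, lift (\<mu> \<beta>))\<close>. Each of
  these is divided by \<open>binomial_division\<close>, and the quotients are added under a summable
  majorant.\<close>

lemma kernel_generated:
  assumes g: "holomorphic_at G (\<lambda>_. 0) g"
    and zero: "\<forall>\<^sub>F w in germ_nhds A (\<lambda>_. 0). g (q w) = 0"
  shows "\<exists>h. (\<forall>k\<in>prim_relations. holomorphic_at G (\<lambda>_. 0) (h k)) \<and>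
    (\<forall>\<^sub>F z in germ_nhds G (\<lambda>_. 0).
       g z = (\<Sum>k\<in>prim_relations. h k z * (mvpow G z (fst k) - mvpow G z (snd k))))"
proof -
  have 0: "(\<lambda>_. 0) \<in> cspace G" by (simp add: cspace_def)
  obtain c r where cr: "0 < r"
    "(\<lambda>\<beta>. norm (c \<beta>) * mvpow G (\<lambda>_. r) \<beta>) summable_on exps G"
    "\<And>z. z \<in> closed_polydisc G (\<lambda>_. 0) (\<lambda>_. r) \<Longrightarrow>
      ((\<lambda>\<beta>. c \<beta> * mvpow G (\<lambda>a. z a - 0) \<beta>) has_sum g z) (exps G)"
    "c 0 = g (\<lambda>_. 0)"
    by (rule holomorphic_at_series[OF finite_G 0 g]) (rule that; assumption)
  \<comment> \<open>With \<open>s0 \<le> 1\<close>, the radius \<open>s0 ^ d\<close> of a generator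
    of degree \<open>d \<ge> 1\<close> is at most \<open>s0\<close>, hence at most
    \<open>r\<close>.\<close>
  define s0 where "s0 = min r 1"
  have s0: "0 < s0" "s0 \<le> 1" "s0 \<le> r" using cr(1) by (auto simp: s0_def)
  have wr: "weight_radius s0 x \<le> r" if "x \<in> G" for x
  proof -
    have "weight_radius s0 x \<le> s0 ^ 1"
      unfolding weight_radius_def using s0 total_degree_pos[OF finite_A m_exps[OF that] m_nonzero[OF that]]
      by (intro power_decreasing) auto
    then show ?thesis using s0 by simp
  qed
  let ?D = "\<lambda>\<beta>. total_degree A (\<mu> \<beta>)"
  have sub: "closed_polydisc G (\<lambda>_. 0) (weight_radius s0) \<subseteq> closed_polydisc G (\<lambda>_. 0) (\<lambda>_. r)"
    using wr by (force simp: closed_polydisc_def)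
  have gs: "((\<lambda>\<beta>. c \<beta> * mvpow G z \<beta>) has_sum g z) (exps G)"
    if "z \<in> closed_polydisc G (\<lambda>_. 0) (weight_radius s0)" for z
    using cr(3)[of z] sub that by auto
  have summ: "(\<lambda>\<beta>. norm (c \<beta>) * s0 ^ ?D \<beta>) summable_on exps G"
  proof (rule summable_on_comparison_test[OF cr(2)])
    fix \<beta> assume \<beta>: "\<beta> \<in> exps G"
    have "mvpow G (weight_radius s0) \<beta> \<le> mvpow G (\<lambda>_. r) \<beta>"
      using wr weight_radius_pos[OF s0(1)] by (intro mvpow_mono) (auto intro: less_imp_le)
    then show "norm (c \<beta>) * s0 ^ ?D \<beta> \<le> norm (c \<beta>) * mvpow G (\<lambda>_. r) \<beta>"
      by (simp add: mvpow_weight_radius[OF \<beta>] mult_left_mono)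
  qed (use s0 in simp)
  \<comment> \<open>These are the Taylor coefficients of \<open>g \<circ> q\<close>.\<close>
  define d where "d \<alpha> = (\<Sum>\<^sub>\<infinity>\<beta> | \<beta> \<in> exps G \<and> \<mu> \<beta> = \<alpha>. c \<beta>)" for \<alpha>
  \<comment> \<open>\<open>f\<close> stays arbitrary because the regrouping is used twice: with
    \<open>w^\<alpha>\<close> to show that every \<open>d \<alpha>\<close> vanishes, and with
    \<open>z^(lift \<alpha>)\<close> to sum the normal forms.\<close>
  have group: "((\<lambda>\<alpha>. d \<alpha> * f \<alpha>) has_sum S) (exps A)"
    if "((\<lambda>\<beta>. c \<beta> * f (\<mu> \<beta>)) has_sum S) (exps G)" for f S
  proof -
    have "((\<lambda>\<alpha>. \<Sum>\<^sub>\<infinity>\<beta> | \<beta> \<in> exps G \<and> \<mu> \<beta> = \<alpha>. c \<beta> * f (\<mu> \<beta>)) has_sum S) (exps A)"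
      using has_sum_group[OF that, of \<mu> "exps A"] mu_exps by blast
    moreover have "(\<Sum>\<^sub>\<infinity>\<beta> | \<beta> \<in> exps G \<and> \<mu> \<beta> = \<alpha>. c \<beta> * f (\<mu> \<beta>)) = d \<alpha> * f \<alpha>" for \<alpha>
    proof -
      have "(\<Sum>\<^sub>\<infinity>\<beta> | \<beta> \<in> exps G \<and> \<mu> \<beta> = \<alpha>. c \<beta> * f (\<mu> \<beta>)) =
          (\<Sum>\<^sub>\<infinity>\<beta> | \<beta> \<in> exps G \<and> \<mu> \<beta> = \<alpha>. c \<beta> * f \<alpha>)"
        by (intro infsum_cong) auto
      then show ?thesis by (simp add: d_def infsum_cmult_left')
    qed
    ultimately show ?thesis by simp
  qed
  have "\<forall>\<^sub>F w in germ_nhds A (\<lambda>_. 0). w \<in> closed_polydisc A (\<lambda>_. 0) (\<lambda>_. s0)"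
    using finite_A s0 by (intro eventually_germ_nhds_closed_polydisc) auto
  with zero have "\<forall>\<^sub>F w in germ_nhds A (\<lambda>_. 0). ((\<lambda>\<alpha>. d \<alpha> * mvpow A w \<alpha>) has_sum 0) (exps A)"
  proof eventually_elim
    case (elim w)
    have "((\<lambda>\<beta>. c \<beta> * mvpow G (q w) \<beta>) has_sum g (q w)) (exps G)"
      by (rule gs[OF q_closed_polydisc[OF elim(2)]])
    then have "((\<lambda>\<beta>. c \<beta> * mvpow A w (\<mu> \<beta>)) has_sum g (q w)) (exps G)"
      by (rule has_sum_cong[THEN iffD1, rotated]) (simp add: mvpow_q)
    then show ?case using group[of "mvpow A w"] elim(1) by simp
  qed
  then have d0: "d \<alpha> = 0" if "\<alpha> \<in> exps A" for \<alpha>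
    by (rule coeffs_eq_zero_eventually[OF finite_A _ that])
  have lift': "lift (\<mu> \<beta>) \<in> exps G" "\<mu> (lift (\<mu> \<beta>)) = \<mu> \<beta>" if "\<beta> \<in> exps G" for \<beta>
    using lift[of "\<mu> \<beta>"] that by auto
  have lift_sum: "((\<lambda>\<beta>. c \<beta> * mvpow G z (lift (\<mu> \<beta>))) has_sum 0) (exps G)"
    if z: "z \<in> closed_polydisc G (\<lambda>_. 0) (weight_radius s0)" for z
  proof -
    have "norm (c \<beta> * mvpow G z (lift (\<mu> \<beta>))) \<le> norm (c \<beta>) * s0 ^ ?D \<beta>" if "\<beta> \<in> exps G" for \<beta>
      using norm_mvpow_le[OF z, of "lift (\<mu> \<beta>)"] lift'[OF that]
      by (simp add: norm_mult mult_left_mono mvpow_weight_radius)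
    from Infinite_Sum.abs_summable_on_comparison_test'[OF summ this]
    have "(\<lambda>\<beta>. c \<beta> * mvpow G z (lift (\<mu> \<beta>))) summable_on exps G"
      by (simp add: summable_on_iff_abs_summable_on_complex)
    then obtain S where S: "((\<lambda>\<beta>. c \<beta> * mvpow G z (lift (\<mu> \<beta>))) has_sum S) (exps G)"
      by (auto simp: summable_on_def)
    from group[OF this] have "((\<lambda>\<alpha>. d \<alpha> * mvpow G z (lift \<alpha>)) has_sum S) (exps A)" .
    then have "((\<lambda>\<alpha>. 0) has_sum S) (exps A)"
      by (rule has_sum_cong[THEN iffD1, rotated]) (simp add: d0)
    then have "S = 0" by (rule has_sum_unique) (rule has_sum_0, simp)
    with S show ?thesis by simp
  qed
  \<comment> \<open>Half the radius pays for the linear factor of \<open>binomial_division\<close>: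
    for an image of degree \<open>D\<close> the count is at most
    \<open>2 * D \<le> 2 * 2 ^ D\<close>, and \<open>2 ^ D * s ^ D = s0 ^ D\<close>. The remaining 2
    enters \<open>M\<close>.\<close>
  define s where "s = s0 / 2"
  have s: "0 < s" using s0 by (simp add: s_def)
  have wp: "0 < weight_radius s x" for x by (rule weight_radius_pos[OF s])
  have wle: "weight_radius s x \<le> weight_radius s0 x" for x
    using s0 by (auto simp: weight_radius_def s_def intro: power_mono)
  obtain C where C: "0 \<le> C" "\<And>e. e \<in> relations \<Longrightarrow> \<exists>H.
    (\<forall>k\<in>prim_relations. majorized G (\<lambda>_. 0) (weight_radius s)
       (real (total_degree G (fst e) + total_degree G (snd e)) * s ^ total_degree A (\<mu> (fst e)) * C) (H k)) \<and>
    (\<forall>z. mvpow G z (fst e) - mvpow G z (snd e) =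
       (\<Sum>k\<in>prim_relations. H k z * (mvpow G z (fst k) - mvpow G z (snd k))))"
    using binomial_division[OF s] by blast
  define M where "M \<beta> = 2 * C * (norm (c \<beta>) * s0 ^ ?D \<beta>)" for \<beta>
  have M: "M summable_on exps G"
    unfolding M_def by (rule summable_on_cmult_right[OF summ])
  have "\<forall>\<beta>\<in>exps G. \<exists>H. (\<forall>k\<in>prim_relations. majorized G (\<lambda>_. 0) (weight_radius s) (M \<beta>) (\<lambda>z. c \<beta> * H k z)) \<and>
    (\<forall>z. mvpow G z \<beta> - mvpow G z (lift (\<mu> \<beta>)) =
       (\<Sum>k\<in>prim_relations. H k z * (mvpow G z (fst k) - mvpow G z (snd k))))"
  proof
    fix \<beta> assume \<beta>: "\<beta> \<in> exps G"
    let ?n = "total_degree G \<beta> + total_degree G (lift (\<mu> \<beta>))"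
    have "(\<beta>, lift (\<mu> \<beta>)) \<in> relations" using \<beta> lift'[OF \<beta>] by (simp add: relations_def)
    from C(2)[OF this] obtain H where H:
      "\<And>k. k \<in> prim_relations \<Longrightarrow> majorized G (\<lambda>_. 0) (weight_radius s) (real ?n * s ^ ?D \<beta> * C) (H k)"
      "\<And>z. mvpow G z \<beta> - mvpow G z (lift (\<mu> \<beta>)) =
       (\<Sum>k\<in>prim_relations. H k z * (mvpow G z (fst k) - mvpow G z (snd k)))" by auto
    have "?n \<le> 2 * ?D \<beta>"
      using total_degree_le[OF \<beta>] total_degree_le[OF lift'(1)[OF \<beta>]] lift'(2)[OF \<beta>] by simp
    also have "\<dots> \<le> 2 * 2 ^ ?D \<beta>" using less_exp[of "?D \<beta>"] by simp
    finally have "real ?n \<le> 2 * 2 ^ ?D \<beta>"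
      by (metis of_nat_le_iff of_nat_mult of_nat_numeral of_nat_power)
    then have "real ?n * s ^ ?D \<beta> \<le> (2 * 2 ^ ?D \<beta>) * s ^ ?D \<beta>"
      using s by (intro mult_right_mono) auto
    also have "\<dots> = 2 * s0 ^ ?D \<beta>"
      by (simp add: s_def power_divide)
    finally have "norm (c \<beta>) * (real ?n * s ^ ?D \<beta> * C) \<le> norm (c \<beta>) * (2 * s0 ^ ?D \<beta> * C)"
      using C(1) by (intro mult_left_mono mult_right_mono) auto
    also have "\<dots> = M \<beta>" by (simp add: M_def)
    finally have le: "norm (c \<beta>) * (real ?n * s ^ ?D \<beta> * C) \<le> M \<beta>" .
    have "majorized G (\<lambda>_. 0) (weight_radius s) (M \<beta>) (\<lambda>z. c \<beta> * H k z)" if "k \<in> prim_relations" for k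
      by (rule majorized_mono[OF majorized_cmult[OF H(1)[OF that]] le]) (use wp in auto)
    then show "\<exists>H. (\<forall>k\<in>prim_relations. majorized G (\<lambda>_. 0) (weight_radius s) (M \<beta>) (\<lambda>z. c \<beta> * H k z)) \<and>
      (\<forall>z. mvpow G z \<beta> - mvpow G z (lift (\<mu> \<beta>)) =
         (\<Sum>k\<in>prim_relations. H k z * (mvpow G z (fst k) - mvpow G z (snd k))))"
      using H(2) by (intro exI[of _ H]) simp
  qed
  from bchoice[OF this] obtain H where
    H: "\<And>\<beta> k. \<beta> \<in> exps G \<Longrightarrow> k \<in> prim_relations \<Longrightarrow>
      majorized G (\<lambda>_. 0) (weight_radius s) (M \<beta>) (\<lambda>z. c \<beta> * H \<beta> k z)"
    "\<And>\<beta> z. \<beta> \<in> exps G \<Longrightarrow> mvpow G z \<beta> - mvpow G z (lift (\<mu> \<beta>)) =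
       (\<Sum>k\<in>prim_relations. H \<beta> k z * (mvpow G z (fst k) - mvpow G z (snd k)))" by auto
  define h where "h k z = (\<Sum>\<^sub>\<infinity>\<beta>\<in>exps G. c \<beta> * H \<beta> k z)" for k z
  have hs: "((\<lambda>\<beta>. c \<beta> * H \<beta> k z) has_sum h k z) (exps G)"
    if k: "k \<in> prim_relations" and z: "z \<in> closed_polydisc G (\<lambda>_. 0) (weight_radius s)" for k z
  proof -
    have "(\<lambda>\<beta>. norm (c \<beta> * H \<beta> k z)) summable_on exps G"
      by (rule Infinite_Sum.abs_summable_on_comparison_test'[OF M]) (rule majorized_norm_le[OF H(1)[OF _ k] z])
    then show ?thesis
      by (simp add: h_def summable_on_iff_abs_summable_on_complex)
  qed
  have "holomorphic_at G (\<lambda>_. 0) (h k)" if k: "k \<in> prim_relations" for k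
    using majorized_infsum[OF H(1)[OF _ k] M wp hs[OF k]] by (intro holomorphic_atI[OF finite_G])
  moreover have "\<forall>\<^sub>F z in germ_nhds G (\<lambda>_. 0). z \<in> closed_polydisc G (\<lambda>_. 0) (weight_radius s)"
    using finite_G wp by (intro eventually_germ_nhds_closed_polydisc) auto
  then have "\<forall>\<^sub>F z in germ_nhds G (\<lambda>_. 0).
       g z = (\<Sum>k\<in>prim_relations. h k z * (mvpow G z (fst k) - mvpow G z (snd k)))"
  proof eventually_elim
    case (elim z)
    have z0: "z \<in> closed_polydisc G (\<lambda>_. 0) (weight_radius s0)"
      using elim wle by (auto simp: closed_polydisc_def intro: order_trans)
    let ?R = "\<lambda>k. mvpow G z (fst k) - mvpow G z (snd k)"
    have "((\<lambda>\<beta>. c \<beta> * mvpow G z \<beta> + - 1 * (c \<beta> * mvpow G z (lift (\<mu> \<beta>)))) has_sum (g z + - 1 * 0)) (exps G)"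
      by (rule has_sum_add[OF gs[OF z0] has_sum_cmult_right[OF lift_sum[OF z0]]])
    then have base: "((\<lambda>\<beta>. c \<beta> * mvpow G z \<beta> + - 1 * (c \<beta> * mvpow G z (lift (\<mu> \<beta>)))) has_sum g z) (exps G)"
      by (simp only: mult_zero_right add_0_right)
    have eq: "c \<beta> * mvpow G z \<beta> + - 1 * (c \<beta> * mvpow G z (lift (\<mu> \<beta>))) =
        (\<Sum>k\<in>prim_relations. c \<beta> * H \<beta> k z * ?R k)" if "\<beta> \<in> exps G" for \<beta>
    proof -
      have "c \<beta> * (mvpow G z \<beta> - mvpow G z (lift (\<mu> \<beta>))) = (\<Sum>k\<in>prim_relations. c \<beta> * H \<beta> k z * ?R k)"
        by (simp only: H(2)[OF that]) (simp add: sum_distrib_left mult.assoc)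
      then show ?thesis by (simp add: right_diff_distrib)
    qed
    have 1: "((\<lambda>\<beta>. \<Sum>k\<in>prim_relations. c \<beta> * H \<beta> k z * ?R k) has_sum g z) (exps G)"
      by (rule has_sum_cong[THEN iffD1, OF _ base]) (rule eq)
    have 2: "((\<lambda>\<beta>. \<Sum>k\<in>prim_relations. c \<beta> * H \<beta> k z * ?R k) has_sum (\<Sum>k\<in>prim_relations. h k z * ?R k)) (exps G)"
      by (intro has_sum_finite_sum has_sum_cmult_left hs elim)
    show ?case by (rule has_sum_unique[OF 1 2])
  qed
  ultimately show ?thesis by blast
qed

text \<open>Replacing \<open>w^\<alpha>\<close> by \<open>z^(lift \<alpha>)\<close> preserves the
  weighted norm: for the radii \<open>weight_radius r\<close> the new monomial has the same size as
  the old one for the radius \<open>r\<close>. The support condition ranges over all expansions of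
  \<open>f\<close> because the one in use is only obtained inside the proof.\<close>

lemma lift_holomorphic:
  assumes f: "holomorphic_at A (\<lambda>_. 0) f"
    and supp: "\<And>c. \<forall>\<^sub>F w in germ_nhds A (\<lambda>_. 0). ((\<lambda>\<alpha>. c \<alpha> * mvpow A w \<alpha>) has_sum f w) (exps A) \<Longrightarrow>
      (\<And>\<alpha>. \<alpha> \<in> exps A \<Longrightarrow> c \<alpha> \<noteq> 0 \<Longrightarrow> \<alpha> \<in> \<mu> ` exps G)"
  shows "\<exists>g. holomorphic_at G (\<lambda>_. 0) g \<and> (\<forall>\<^sub>F w in germ_nhds A (\<lambda>_. 0). g (q w) = f w)"
proof -
  have 0: "(\<lambda>_. 0) \<in> cspace A" by (simp add: cspace_def)
  obtain c r where cr: "0 < r"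
    "(\<lambda>\<alpha>. norm (c \<alpha>) * mvpow A (\<lambda>_. r) \<alpha>) summable_on exps A"
    "\<And>w. w \<in> closed_polydisc A (\<lambda>_. 0) (\<lambda>_. r) \<Longrightarrow>
      ((\<lambda>\<alpha>. c \<alpha> * mvpow A (\<lambda>a. w a - 0) \<alpha>) has_sum f w) (exps A)"
    "c 0 = f (\<lambda>_. 0)"
    by (rule holomorphic_at_series[OF finite_A 0 f]) (rule that; assumption)
  let ?T = "\<mu> ` exps G"
  have T: "?T \<subseteq> exps A" using mu_exps by blast
  have ev: "\<forall>\<^sub>F w in germ_nhds A (\<lambda>_. 0). w \<in> closed_polydisc A (\<lambda>_. 0) (\<lambda>_. r)"
    using finite_A cr(1) by (intro eventually_germ_nhds_closed_polydisc) auto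
  then have "\<forall>\<^sub>F w in germ_nhds A (\<lambda>_. 0). ((\<lambda>\<alpha>. c \<alpha> * mvpow A w \<alpha>) has_sum f w) (exps A)"
    by eventually_elim (use cr(3) in simp)
  from supp[OF this] have c0: "c \<alpha> = 0" if "\<alpha> \<in> exps A - ?T" for \<alpha>
    using that by blast
  define M where "M \<alpha> = norm (c \<alpha>) * mvpow A (\<lambda>_. r) \<alpha>" for \<alpha>
  have M: "M summable_on ?T"
    unfolding M_def by (rule summable_on_subset[OF cr(2) T])
  have wp: "0 < weight_radius r x" for x by (rule weight_radius_pos[OF cr(1)])
  have maj: "majorized G (\<lambda>_. 0) (weight_radius r) (M \<alpha>) (\<lambda>z. c \<alpha> * mvpow G z (lift \<alpha>))"
    if "\<alpha> \<in> ?T" for \<alpha>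
    using majorized_cmult[OF majorized_mvpow[of G "weight_radius r" "lift \<alpha>" "\<lambda>_. 0"], of "c \<alpha>"]
      wp lift[OF that] by (simp add: M_def mvpow_const mvpow_weight_radius)
  define g where "g z = (\<Sum>\<^sub>\<infinity>\<alpha>\<in>?T. c \<alpha> * mvpow G z (lift \<alpha>))" for z
  have gs: "((\<lambda>\<alpha>. c \<alpha> * mvpow G z (lift \<alpha>)) has_sum g z) ?T"
    if z: "z \<in> closed_polydisc G (\<lambda>_. 0) (weight_radius r)" for z
  proof -
    have "(\<lambda>\<alpha>. norm (c \<alpha> * mvpow G z (lift \<alpha>))) summable_on ?T"
      by (rule Infinite_Sum.abs_summable_on_comparison_test'[OF M]) (rule majorized_norm_le[OF maj z])
    then show ?thesis
      by (simp add: g_def summable_on_iff_abs_summable_on_complex)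
  qed
  have "holomorphic_at G (\<lambda>_. 0) g"
    using majorized_infsum[OF maj M wp gs] by (intro holomorphic_atI[OF finite_G])
  moreover from ev have "\<forall>\<^sub>F w in germ_nhds A (\<lambda>_. 0). g (q w) = f w"
  proof eventually_elim
    case (elim w)
    have "((\<lambda>\<alpha>. c \<alpha> * mvpow A w \<alpha>) has_sum f w) (exps A)" using cr(3)[OF elim] by simp
    also have "?this \<longleftrightarrow> ((\<lambda>\<alpha>. c \<alpha> * mvpow A w \<alpha>) has_sum f w) ?T"
      using T c0 by (intro has_sum_cong_neutral) auto
    also have "\<dots> \<longleftrightarrow> ((\<lambda>\<alpha>. c \<alpha> * mvpow G (q w) (lift \<alpha>)) has_sum f w) ?T"
      by (intro has_sum_cong) (simp only: mvpow_q lift)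
    finally show ?case unfolding g_def by (rule infsumI)
  qed
  ultimately show ?thesis by blast
qed

end

section \<open>Morphisms of germs\<close>

text \<open>A map out of a germ whose equations are the functions vanishing along \<open>\<pi>\<close> is determined by its
  values along \<open>\<pi>\<close>. Affine germs have this form, and so does the quotient germ, along the quotient map.\<close>

definition detected_germ :: "'a germ \<Rightarrow> 't filter \<Rightarrow> ('t \<Rightarrow> 'a \<Rightarrow> complex) \<Rightarrow> bool" where
  "detected_germ X T \<pi> \<longleftrightarrow> finite (coords X) \<and> base X \<in> cspace (coords X) \<and>
     (\<forall>g. g \<in> eqns X \<longleftrightarrow> holomorphic_at (coords X) (base X) g \<and> (\<forall>\<^sub>F t in T. g (\<pi> t) = 0))"

lemma germ_map_compose:
  assumes X: "finite (coords X)" "base X \<in> cspace (coords X)" and Y: "finite (coords Y)"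
    and \<Phi>: "germ_map X Y \<Phi>" and \<Psi>: "germ_map Y Z \<Psi>"
  shows "germ_map X Z (\<Psi> \<circ> \<Phi>)"
proof -
  have "holomorphic_at (coords X) (base X) ((\<lambda>y. \<Psi> y c) \<circ> \<Phi>)" if "c \<in> coords Z" for c
    by (rule holomorphic_at_compose[OF X Y]) (use \<Phi> \<Psi> that in \<open>auto simp: germ_map_def\<close>)
  then show ?thesis
    using \<Phi> \<Psi> unfolding germ_map_def by (auto simp: o_def)
qed

lemma cspace_eqI:
  assumes "z \<in> cspace A" "w \<in> cspace A" "\<And>a. a \<in> A \<Longrightarrow> z a = w a"
  shows "z = w"
proof (rule ext)
  fix a show "z a = w a"
    using assms by (cases "a \<in> A") (auto simp: cspace_def)
qed

text \<open>The target has finitely many coordinates, so the eventual equalities of the components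
  merge into one.\<close>

lemma germ_map_rel_detected:
  assumes X: "detected_germ X T \<pi>" and Y: "finite (coords Y)"
  shows "(\<Phi>, \<Psi>) \<in> germ_map_rel X Y \<longleftrightarrow>
    germ_map X Y \<Phi> \<and> germ_map X Y \<Psi> \<and> (\<forall>\<^sub>F t in T. \<Phi> (\<pi> t) = \<Psi> (\<pi> t))"
proof (cases "germ_map X Y \<Phi> \<and> germ_map X Y \<Psi>")
  case True
  have hol: "holomorphic_at (coords X) (base X) (\<lambda>z. \<Phi> z b - \<Psi> z b)" if "b \<in> coords Y" for b
    using X True that by (intro holomorphic_at_diff) (auto simp: detected_germ_def germ_map_def)
  have "(\<forall>b\<in>coords Y. (\<lambda>z. \<Phi> z b - \<Psi> z b) \<in> eqns X) \<longleftrightarrow>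
      (\<forall>\<^sub>F t in T. \<forall>b\<in>coords Y. \<Phi> (\<pi> t) b - \<Psi> (\<pi> t) b = 0)"
    using X hol by (auto simp: detected_germ_def eventually_ball_finite_distrib[OF Y])
  also have "\<dots> \<longleftrightarrow> (\<forall>\<^sub>F t in T. \<Phi> (\<pi> t) = \<Psi> (\<pi> t))"
  proof (intro eventually_cong[OF always_eventually] allI)
    fix t
    have "\<Phi> (\<pi> t) \<in> cspace (coords Y)" "\<Psi> (\<pi> t) \<in> cspace (coords Y)"
      using True by (auto simp: germ_map_def)
    then show "(\<forall>b\<in>coords Y. \<Phi> (\<pi> t) b - \<Psi> (\<pi> t) b = 0) \<longleftrightarrow> \<Phi> (\<pi> t) = \<Psi> (\<pi> t)"
      using cspace_eqI[of "\<Phi> (\<pi> t)" "coords Y" "\<Psi> (\<pi> t)"] by auto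
  qed simp
  finally show ?thesis using True by (simp add: germ_map_rel_def)
qed (auto simp: germ_map_rel_def)

lemma germ_class_eq_iff:
  assumes X: "detected_germ X T \<pi>" and Y: "finite (coords Y)"
    and "germ_map X Y \<Phi>" "germ_map X Y \<Psi>"
  shows "germ_map_rel X Y `` {\<Phi>} = germ_map_rel X Y `` {\<Psi>} \<longleftrightarrow> (\<forall>\<^sub>F t in T. \<Phi> (\<pi> t) = \<Psi> (\<pi> t))"
proof
  assume "germ_map_rel X Y `` {\<Phi>} = germ_map_rel X Y `` {\<Psi>}"
  moreover have "\<Psi> \<in> germ_map_rel X Y `` {\<Psi>}"
    using assms by (simp add: germ_map_rel_detected[OF X Y])
  ultimately have "(\<Phi>, \<Psi>) \<in> germ_map_rel X Y" by blast
  then show "\<forall>\<^sub>F t in T. \<Phi> (\<pi> t) = \<Psi> (\<pi> t)" by (simp add: germ_map_rel_detected[OF X Y])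
next
  assume ev: "\<forall>\<^sub>F t in T. \<Phi> (\<pi> t) = \<Psi> (\<pi> t)"
  have "(\<forall>\<^sub>F t in T. \<Phi> (\<pi> t) = \<Theta> (\<pi> t)) \<longleftrightarrow> (\<forall>\<^sub>F t in T. \<Psi> (\<pi> t) = \<Theta> (\<pi> t))" for \<Theta>
    by (rule eventually_cong[OF ev]) simp
  then show "germ_map_rel X Y `` {\<Phi>} = germ_map_rel X Y `` {\<Psi>}"
    using assms(3,4) by (simp add: set_eq_iff germ_map_rel_detected[OF X Y])
qed

lemma germ_class_self:
  assumes "ideal (eqns X) (hol_ring (coords X) (base X))" "finite (coords X)" "base X \<in> cspace (coords X)"
    and "germ_map X Y \<Phi>"
  shows "\<Phi> \<in> germ_map_rel X Y `` {\<Phi>}"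
  using ideal_hol_ringD(2)[OF assms(2,3,1)] assms(4) by (simp add: germ_map_rel_def)

lemma Hom_An_iff: "f \<in> Hom_An X Y \<longleftrightarrow> (\<exists>\<Phi>. germ_map X Y \<Phi> \<and> f = germ_map_rel X Y `` {\<Phi>})"
  by (auto simp: Hom_An_def quotient_def)

text \<open>Composition is defined as a union over all representatives, and this union is a single
  class. A change of \<open>\<Psi>\<close> alters its components by equations of \<open>Y\<close>,
  which \<open>\<Phi>\<close> pulls back into the ideal of \<open>X\<close>. A change of
  \<open>\<Phi>\<close> eventually keeps its values along \<open>\<pi>\<close>, as \<open>X\<close>
  is detected, and so keeps those of the composite.\<close>

lemma germ_comp_class:
  assumes X: "detected_germ X T \<pi>" and Y: "analytic_germ Y" and Z: "finite (coords Z)"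
    and \<Phi>: "germ_map X Y \<Phi>" and \<Psi>: "germ_map Y Z \<Psi>"
  shows "germ_comp X Z (germ_map_rel Y Z `` {\<Psi>}) (germ_map_rel X Y `` {\<Phi>}) = germ_map_rel X Z `` {\<Psi> \<circ> \<Phi>}"
proof -
  have X': "finite (coords X)" "base X \<in> cspace (coords X)" using X by (auto simp: detected_germ_def)
  have Y': "finite (coords Y)" using Y by (simp add: analytic_germ_def)
  have "germ_map_rel X Z `` {\<Psi>' \<circ> \<Phi>'} = germ_map_rel X Z `` {\<Psi> \<circ> \<Phi>}"
    if "\<Psi>' \<in> germ_map_rel Y Z `` {\<Psi>}" "\<Phi>' \<in> germ_map_rel X Y `` {\<Phi>}" for \<Psi>' \<Phi>'
  proof -
    have \<Phi>': "germ_map X Y \<Phi>'" and ev: "\<forall>\<^sub>F t in T. \<Phi> (\<pi> t) = \<Phi>' (\<pi> t)"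
      using that(2) by (auto simp: germ_map_rel_detected[OF X Y'])
    have \<Psi>': "germ_map Y Z \<Psi>'" and eq: "\<And>c. c \<in> coords Z \<Longrightarrow> (\<lambda>y. \<Psi> y c - \<Psi>' y c) \<in> eqns Y"
      using that(1) by (auto simp: germ_map_rel_def)
    have "(\<lambda>y. \<Psi> y c - \<Psi>' y c) \<circ> \<Phi> \<in> eqns X" if "c \<in> coords Z" for c
      using \<Phi> eq[OF that] by (auto simp: germ_map_def)
    then have "(\<Psi> \<circ> \<Phi>, \<Psi>' \<circ> \<Phi>) \<in> germ_map_rel X Z"
      using germ_map_compose[OF X' Y' \<Phi> \<Psi>] germ_map_compose[OF X' Y' \<Phi> \<Psi>']
      by (simp add: germ_map_rel_def o_def)
    then have "\<forall>\<^sub>F t in T. \<Psi> (\<Phi> (\<pi> t)) = \<Psi>' (\<Phi> (\<pi> t))"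
      by (simp add: germ_map_rel_detected[OF X Z])
    with ev have "\<forall>\<^sub>F t in T. \<Psi>' (\<Phi>' (\<pi> t)) = \<Psi> (\<Phi> (\<pi> t))"
      by eventually_elim simp
    then show ?thesis
      using germ_class_eq_iff[OF X Z germ_map_compose[OF X' Y' \<Phi>' \<Psi>'] germ_map_compose[OF X' Y' \<Phi> \<Psi>]]
      by simp
  qed
  moreover have "\<Psi> \<in> germ_map_rel Y Z `` {\<Psi>}"
    using Y \<Psi> by (intro germ_class_self) (auto simp: analytic_germ_def)
  moreover have "\<Phi> \<in> germ_map_rel X Y `` {\<Phi>}"
    using \<Phi> by (simp add: germ_map_rel_detected[OF X Y'])
  ultimately show ?thesis unfolding germ_comp_def by blast
qed

lemma detected_affine_germ:
  assumes "finite A"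
  shows "detected_germ (affine_germ A) (germ_nhds A (\<lambda>_. 0)) (\<lambda>w. w)"
proof -
  have "holomorphic_at A (\<lambda>_. 0) g" if "\<forall>\<^sub>F z in germ_nhds A (\<lambda>_. 0). g z = 0" for g
    using that by (intro holomorphic_at_cong[OF holomorphic_at_const[OF assms, of _ 0]]) (auto elim: eventually_mono)
  then show ?thesis
    using assms by (auto simp: detected_germ_def affine_germ_def cspace_def null_ideal_def)
qed

section \<open>The quotient germ\<close>

lemma poly_subst_single:
  "poly_subst \<iota> \<theta> (Poly_Mapping.single \<beta> c) = (if c = 0 then 0 else \<iota> c * (\<Prod>x\<in>keys \<beta>. \<theta> x ^ lookup \<beta> x))"
  by (simp add: poly_subst_def)

lemma mvpow_keys:
  assumes "finite A" "\<alpha> \<in> exps A"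
  shows "(\<Prod>x\<in>keys \<alpha>. z x ^ lookup \<alpha> x) = mvpow A z \<alpha>"
  unfolding mvpow_def using assms
  by (intro prod.mono_neutral_left) (auto simp: exps_def in_keys_iff)

text \<open>The coordinates of the quotient germ are elements \<open>X^\<alpha>\<close> of the
  monoid algebra; the exponent is recovered from their only key.\<close>

definition gen_exponent :: "(('n \<Rightarrow>\<^sub>0 nat) \<Rightarrow>\<^sub>0 complex) \<Rightarrow> ('n \<Rightarrow>\<^sub>0 nat)" where
  "gen_exponent x = the_elem (keys x)"

lemma gen_exponent [simp]: "gen_exponent (character_monomial \<alpha>) = \<alpha>"
  by (simp add: gen_exponent_def character_monomial_def)

text \<open>The monoid consists of the natural points of a linear subspace, so a difference that
  stays natural stays in it. In \<open>finite_hilbert_basis\<close> this splits the larger of two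
  comparable elements.\<close>

lemma residual_monoid_minus:
  assumes "\<alpha> \<in> residual_monoid \<Lambda> I" "\<alpha> + \<beta> \<in> residual_monoid \<Lambda> I"
  shows "\<beta> \<in> residual_monoid \<Lambda> I"
proof -
  have "keys \<beta> \<subseteq> - I"
    using assms(2) by (auto simp: residual_monoid_def in_keys_iff lookup_add subset_iff)
  then show ?thesis
    using assms by (auto simp: residual_monoid_def lookup_add distrib_right sum.distrib)
qed

lemma finite_hilbert_basis: "finite (hilbert_basis (residual_monoid (\<Lambda> :: 'n::finite \<Rightarrow> complex ^ 'k) I))"
proof (rule dickson_antichain[where A = UNIV and f = lookup])
  fix s t assume s: "s \<in> hilbert_basis (residual_monoid \<Lambda> I)" and t: "t \<in> hilbert_basis (residual_monoid \<Lambda> I)"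
    and le: "\<And>a. a \<in> UNIV \<Longrightarrow> lookup s a \<le> lookup t a"
  have eq: "t = s + (t - s)"
    by (rule poly_mapping_eqI) (simp add: lookup_add lookup_minus le)
  have S: "s \<in> residual_monoid \<Lambda> I" "t \<in> residual_monoid \<Lambda> I" using s t by (auto simp: hilbert_basis_def)
  have "t - s \<in> residual_monoid \<Lambda> I"
    by (rule residual_monoid_minus[OF S(1)]) (use S(2) eq in simp)
  with s t eq S have "s = 0 \<or> t - s = 0" unfolding hilbert_basis_def by blast
  then show "s = t" using s eq by (auto simp: hilbert_basis_def)
qed simp

lemma finite_residual_gens: "finite (residual_gens \<Lambda> I)"
  by (simp add: residual_gens_def finite_hilbert_basis)

lemma residual_gens_exponent:
  assumes "x \<in> residual_gens \<Lambda> I"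
  shows "x = character_monomial (gen_exponent x)" "gen_exponent x \<in> residual_monoid \<Lambda> I" "gen_exponent x \<noteq> 0"
  using assms by (auto simp: residual_gens_def hilbert_basis_def)

lemma residual_monoid_exps: "\<alpha> \<in> residual_monoid \<Lambda> I \<Longrightarrow> \<alpha> \<in> exps (- I)"
  by (simp add: residual_monoid_def exps_def)

lemma monomial_map_residual:
  "monomial_map (- I) (residual_gens (\<Lambda> :: 'n::finite \<Rightarrow> complex ^ 'k) I) gen_exponent"
  by unfold_locales (auto simp: finite_residual_gens residual_gens_exponent(3)
      intro: residual_monoid_exps residual_gens_exponent(2))

lemma character_monomial_power:
  "character_monomial \<alpha> ^ n = character_monomial (Poly_Mapping.map ((*) n) \<alpha>)"
proof (induction n)
  case 0
  have z: "Poly_Mapping.map ((*) 0) \<alpha> = 0"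
    by (rule poly_mapping_eqI) (simp add: Poly_Mapping.map.rep_eq)
  show ?case unfolding z by (simp add: character_monomial_def)
next
  case (Suc n)
  have z: "Poly_Mapping.map ((*) (Suc n)) \<alpha> = \<alpha> + Poly_Mapping.map ((*) n) \<alpha>"
    by (rule poly_mapping_eqI) (simp add: Poly_Mapping.map.rep_eq lookup_add when_def)
  show ?case unfolding z using Suc by (simp add: character_monomial_def Poly_Mapping.mult_single)
qed

text \<open>This ties the monoid algebra to \<open>\<mu>\<close>: two monomials in the generators
  have the same image exactly if \<open>\<mu>\<close> agrees on them, so \<open>relations\<close>
  describes the binomial relations of the algebra.\<close>

lemma prod_residual_gens:
  assumes "keys \<beta> \<subseteq> residual_gens \<Lambda> I"
  shows "(\<Prod>x\<in>keys \<beta>. x ^ lookup \<beta> x) = character_monomial (expsum gen_exponent \<beta>)"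
proof -
  have "(\<Prod>x\<in>F. x ^ lookup \<beta> x) =
      character_monomial (\<Sum>x\<in>F. Poly_Mapping.map ((*) (lookup \<beta> x)) (gen_exponent x))"
    if "finite F" "F \<subseteq> residual_gens \<Lambda> I" for F
    using that
  proof (induction F rule: finite_induct)
    case empty
    then show ?case by (simp add: character_monomial_def)
  next
    case (insert x F)
    have "x ^ lookup \<beta> x = character_monomial (Poly_Mapping.map ((*) (lookup \<beta> x)) (gen_exponent x))"
      using residual_gens_exponent(1)[of x \<Lambda> I] insert.prems
      by (metis character_monomial_power insert_subset)
    then show ?case
      using insert by (simp add: character_monomial_def Poly_Mapping.mult_single)
  qed
  from this[OF _ assms] show ?thesis by (simp add: expsum_def)
qed

lemma residual_quotient_map_eq:
  "residual_quotient_map \<Lambda> I w = monomial_map.q (- I) (residual_gens \<Lambda> I) gen_exponent w"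
proof -
  interpret monomial_map "- I" "residual_gens \<Lambda> I" gen_exponent by (rule monomial_map_residual)
  have "poly_subst (\<lambda>c. c) w x = mvpow (- I) w (gen_exponent x)" if "x \<in> residual_gens \<Lambda> I" for x
  proof -
    have "poly_subst (\<lambda>c. c) w (character_monomial (gen_exponent x)) = mvpow (- I) w (gen_exponent x)"
      using m_exps[OF that] by (simp add: character_monomial_def poly_subst_single mvpow_keys)
    then show ?thesis using residual_gens_exponent(1)[OF that] by simp
  qed
  then show ?thesis by (auto simp: residual_quotient_map_def q_def)
qed

lemma base_quotient_germ: "base (quotient_germ \<Lambda> I) = (\<lambda>_. 0)"
  and coords_quotient_germ: "coords (quotient_germ \<Lambda> I) = residual_gens \<Lambda> I"
  and eqns_quotient_germ: "eqns (quotient_germ \<Lambda> I) =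
    Idl\<^bsub>hol_ring (residual_gens \<Lambda> I) (\<lambda>_. 0)\<^esub> (null_ideal (residual_gens \<Lambda> I) (\<lambda>_. 0) \<union>
      {(\<lambda>z. poly_subst (\<lambda>c. c) z P) | P.
        P \<in> polys_in (residual_gens \<Lambda> I) \<and> poly_subst (Poly_Mapping.single 0) (\<lambda>x. x) P = 0})"
proof -
  interpret monomial_map "- I" "residual_gens \<Lambda> I" gen_exponent by (rule monomial_map_residual)
  have "poly_subst (\<lambda>c. c) (\<lambda>_. 0) x = 0" if "x \<in> residual_gens \<Lambda> I" for x
  proof -
    have "poly_subst (\<lambda>c. c) (\<lambda>_. 0) (character_monomial (gen_exponent x)) = 0"
      using mvpow_zero_arg[OF _ m_exps[OF that] m_nonzero[OF that]] m_exps[OF that]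
      by (simp add: character_monomial_def poly_subst_single mvpow_keys[where A = "- I"])
    then show ?thesis using residual_gens_exponent(1)[OF that] by simp
  qed
  then have "(\<lambda>x. if x \<in> residual_gens \<Lambda> I then poly_subst (\<lambda>c. c) (\<lambda>_. 0) x else 0) = (\<lambda>_. 0)"
    by auto
  then show "base (quotient_germ \<Lambda> I) = (\<lambda>_. 0)" "coords (quotient_germ \<Lambda> I) = residual_gens \<Lambda> I"
    "eqns (quotient_germ \<Lambda> I) =
    Idl\<^bsub>hol_ring (residual_gens \<Lambda> I) (\<lambda>_. 0)\<^esub> (null_ideal (residual_gens \<Lambda> I) (\<lambda>_. 0) \<union>
      {(\<lambda>z. poly_subst (\<lambda>c. c) z P) | P.
        P \<in> polys_in (residual_gens \<Lambda> I) \<and> poly_subst (Poly_Mapping.single 0) (\<lambda>x. x) P = 0})"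
    by (simp_all add: quotient_germ_def an_spec_germ_def Let_def)
qed

text \<open>Evaluation at \<open>w\<close> is multiplicative on the monoid algebra and sends each
  generator to its coordinate of the quotient map. Hence relations between the generators vanish
  along that map.\<close>

lemma poly_subst_quotient_map:
  assumes "P \<in> polys_in (residual_gens \<Lambda> I)"
  shows "poly_subst (\<lambda>c. c) (residual_quotient_map \<Lambda> I w) P =
    poly_subst (\<lambda>c. c) w (poly_subst (Poly_Mapping.single 0) (\<lambda>x. x) P)"
proof -
  interpret monomial_map "- I" "residual_gens \<Lambda> I" gen_exponent by (rule monomial_map_residual)
  have "poly_subst (\<lambda>c. c) w (poly_subst (Poly_Mapping.single 0) (\<lambda>x. x) P) =
      (\<Sum>\<beta>\<in>keys P. poly_subst (\<lambda>c. c) w (Poly_Mapping.single 0 (lookup P \<beta>) * (\<Prod>x\<in>keys \<beta>. x ^ lookup \<beta> x)))"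
    unfolding poly_subst_def[of "Poly_Mapping.single 0"] by (rule poly_subst_sum) auto
  also have "\<dots> = (\<Sum>\<beta>\<in>keys P. lookup P \<beta> * (\<Prod>x\<in>keys \<beta>. residual_quotient_map \<Lambda> I w x ^ lookup \<beta> x))"
  proof (rule sum.cong[OF refl])
    fix \<beta> assume "\<beta> \<in> keys P"
    then have \<beta>: "keys \<beta> \<subseteq> residual_gens \<Lambda> I" "\<beta> \<in> exps (residual_gens \<Lambda> I)" "lookup P \<beta> \<noteq> 0"
      using assms by (auto simp: polys_in_def exps_def in_keys_iff)
    have "poly_subst (\<lambda>c. c) w (Poly_Mapping.single 0 (lookup P \<beta>) * (\<Prod>x\<in>keys \<beta>. x ^ lookup \<beta> x)) =
        lookup P \<beta> * mvpow (- I) w (\<mu> \<beta>)"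
      using \<beta> mu_exps[OF \<beta>(2)]
      by (simp add: prod_residual_gens[OF \<beta>(1)] character_monomial_def Poly_Mapping.mult_single
          poly_subst_single mvpow_keys[where A = "- I"])
    also have "mvpow (- I) w (\<mu> \<beta>) = (\<Prod>x\<in>keys \<beta>. residual_quotient_map \<Lambda> I w x ^ lookup \<beta> x)"
      by (simp add: residual_quotient_map_eq mvpow_q[OF \<beta>(2), symmetric] mvpow_keys[OF finite_residual_gens \<beta>(2)])
    finally show "poly_subst (\<lambda>c. c) w (Poly_Mapping.single 0 (lookup P \<beta>) * (\<Prod>x\<in>keys \<beta>. x ^ lookup \<beta> x)) =
        lookup P \<beta> * (\<Prod>x\<in>keys \<beta>. residual_quotient_map \<Lambda> I w x ^ lookup \<beta> x)" .
  qed
  finally show ?thesis by (simp add: poly_subst_def[of "\<lambda>c. c" "residual_quotient_map \<Lambda> I w"])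
qed

section \<open>The quotient map as a map of germs, and the ideal of its image\<close>

lemma residual_quotient_map_cspace: "residual_quotient_map \<Lambda> I w \<in> cspace (residual_gens \<Lambda> I)"
  by (simp add: residual_quotient_map_def cspace_def)

lemma holomorphic_residual_quotient_map:
  assumes "x \<in> residual_gens \<Lambda> I"
  shows "holomorphic_at (- I) (\<lambda>_. 0) (\<lambda>w. residual_quotient_map \<Lambda> I w x)"
proof -
  interpret monomial_map "- I" "residual_gens \<Lambda> I" gen_exponent by (rule monomial_map_residual)
  show ?thesis
    using holomorphic_at_mvpow[OF finite_A m_exps[OF assms]] assms
    by (simp add: residual_quotient_map_eq q_def)
qed

lemma residual_quotient_map_zero: "residual_quotient_map \<Lambda> I (\<lambda>_. 0) = (\<lambda>_. 0)"
proof -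
  interpret monomial_map "- I" "residual_gens \<Lambda> I" gen_exponent by (rule monomial_map_residual)
  show ?thesis
    using mvpow_zero_arg[OF finite_A m_exps m_nonzero]
    by (auto simp: residual_quotient_map_eq q_def fun_eq_iff)
qed

lemma filterlim_residual_quotient_map:
  "filterlim (residual_quotient_map \<Lambda> I) (germ_nhds (residual_gens \<Lambda> I) (\<lambda>_. 0)) (germ_nhds (- I) (\<lambda>_. 0))"
  using filterlim_germ_nhds[of "- I" "\<lambda>_. 0" "residual_gens \<Lambda> I" "residual_quotient_map \<Lambda> I"]
  by (simp add: residual_quotient_map_zero finite_residual_gens residual_quotient_map_cspace
      holomorphic_residual_quotient_map cspace_def[of "- I"])

lemma holomorphic_at_poly_subst:
  assumes "finite G" "P \<in> polys_in G"
  shows "holomorphic_at G (\<lambda>_. 0) (\<lambda>z. poly_subst (\<lambda>c. c) z P)"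
proof -
  have "holomorphic_at G (\<lambda>_. 0) (\<lambda>z. lookup P \<beta> * (\<Prod>x\<in>keys \<beta>. z x ^ lookup \<beta> x))" if "\<beta> \<in> keys P" for \<beta>
  proof -
    have \<beta>: "\<beta> \<in> exps G" using that assms(2) by (auto simp: polys_in_def exps_def)
    show ?thesis
      unfolding mvpow_keys[OF assms(1) \<beta>]
      by (intro holomorphic_at_mult holomorphic_at_const holomorphic_at_mvpow assms \<beta>) (simp add: cspace_def)
  qed
  then show ?thesis
    unfolding poly_subst_def by (intro holomorphic_at_sum assms) (auto simp: cspace_def)
qed

lemma null_ideal_holomorphic:
  assumes "finite A" "g \<in> null_ideal A p"
  shows "holomorphic_at A p g"
  using assms(2)
  by (intro holomorphic_at_cong[OF holomorphic_at_const[OF assms(1), of _ 0]])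
    (auto simp: null_ideal_def elim: eventually_mono)

text \<open>The kernel of pullback along the quotient map is an ideal containing the generators of
  \<open>eqns\<close>, hence all of \<open>eqns\<close>. Conversely, \<open>kernel_generated\<close>
  writes a germ of the kernel through binomials, and these are polynomial relations in the monoid
  algebra.\<close>

lemma eqns_quotient_germ_iff:
  "g \<in> eqns (quotient_germ \<Lambda> I) \<longleftrightarrow> holomorphic_at (residual_gens \<Lambda> I) (\<lambda>_. 0) g \<and>
     (\<forall>\<^sub>F w in germ_nhds (- I) (\<lambda>_. 0). g (residual_quotient_map \<Lambda> I w) = 0)"
  and ideal_eqns_quotient_germ:
  "ideal (eqns (quotient_germ \<Lambda> I)) (hol_ring (residual_gens \<Lambda> I) (\<lambda>_. 0))"
  and null_ideal_quotient_germ: "null_ideal (residual_gens \<Lambda> I) (\<lambda>_. 0) \<subseteq> eqns (quotient_germ \<Lambda> I)"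
proof -
  interpret monomial_map "- I" "residual_gens \<Lambda> I" gen_exponent by (rule monomial_map_residual)
  let ?G = "residual_gens \<Lambda> I" and ?q = "residual_quotient_map \<Lambda> I"
  let ?N = "germ_nhds (- I) (\<lambda>_. 0 :: complex)"
  have 0: "(\<lambda>_. 0) \<in> cspace ?G" by (simp add: cspace_def)
  note G = finite_G 0
  interpret R: ring "hol_ring ?G (\<lambda>_. 0)" by (rule ring_hol_ring[OF G])
  define K where "K = {g. holomorphic_at ?G (\<lambda>_. 0) g \<and> (\<forall>\<^sub>F w in ?N. g (?q w) = 0)}"
  define B where "B = null_ideal ?G (\<lambda>_. 0) \<union> {(\<lambda>z. poly_subst (\<lambda>c. c) z P) | P.
        P \<in> polys_in ?G \<and> poly_subst (Poly_Mapping.single 0) (\<lambda>x. x) P = 0}"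
  have E: "eqns (quotient_germ \<Lambda> I) = Idl\<^bsub>hol_ring ?G (\<lambda>_. 0)\<^esub> B"
    by (simp add: eqns_quotient_germ B_def)
  have K: "ideal K (hol_ring ?G (\<lambda>_. 0))"
  proof (rule ideal_hol_ringI[OF G])
    fix f g assume "f \<in> K" "g \<in> K"
    then have "\<forall>\<^sub>F w in ?N. f (?q w) = 0" "\<forall>\<^sub>F w in ?N. g (?q w) = 0" by (auto simp: K_def)
    then have "\<forall>\<^sub>F w in ?N. f (?q w) + g (?q w) = 0" by eventually_elim simp
    with \<open>f \<in> K\<close> \<open>g \<in> K\<close> show "(\<lambda>z. f z + g z) \<in> K"
      by (simp add: K_def holomorphic_at_add[OF G])
  next
    fix f h assume "f \<in> K" "holomorphic_at ?G (\<lambda>_. 0) h"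
    moreover from this have "\<forall>\<^sub>F w in ?N. h (?q w) * f (?q w) = 0"
      by (auto simp: K_def elim: eventually_mono)
    ultimately show "(\<lambda>z. h z * f z) \<in> K"
      by (auto simp: K_def holomorphic_at_mult[OF G])
  qed (auto simp: K_def holomorphic_at_const finite_G)
  have "B \<subseteq> K"
  proof
    fix g assume "g \<in> B"
    then consider "g \<in> null_ideal ?G (\<lambda>_. 0)" | P where "g = (\<lambda>z. poly_subst (\<lambda>c. c) z P)"
      "P \<in> polys_in ?G" "poly_subst (Poly_Mapping.single 0) (\<lambda>x. x) P = 0"
      by (auto simp: B_def)
    then show "g \<in> K"
    proof cases
      case 1
      then have "\<forall>\<^sub>F w in ?N. g (?q w) = 0"
        using filterlim_iff[THEN iffD1, OF filterlim_residual_quotient_map, rule_format, of "\<lambda>z. g z = 0" \<Lambda> I]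
        by (simp add: null_ideal_def)
      then show ?thesis using null_ideal_holomorphic[OF finite_G 1] by (simp add: K_def)
    next
      case 2
      then show ?thesis
        by (simp add: K_def holomorphic_at_poly_subst[OF finite_G] poly_subst_quotient_map poly_subst_zero)
    qed
  qed
  then have B: "B \<subseteq> carrier (hol_ring ?G (\<lambda>_. 0))" by (auto simp: K_def)
  have sub: "eqns (quotient_germ \<Lambda> I) \<subseteq> K"
    unfolding E by (rule R.genideal_minimal[OF K \<open>B \<subseteq> K\<close>])
  show ideal: "ideal (eqns (quotient_germ \<Lambda> I)) (hol_ring ?G (\<lambda>_. 0))"
    unfolding E by (rule R.genideal_ideal[OF B])
  have BE: "B \<subseteq> eqns (quotient_germ \<Lambda> I)"
    unfolding E by (rule R.genideal_self[OF B])
  then show null: "null_ideal ?G (\<lambda>_. 0) \<subseteq> eqns (quotient_germ \<Lambda> I)"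
    by (auto simp: B_def)
  note D = ideal_hol_ringD[OF G ideal]
  have rel: "(\<lambda>z. mvpow ?G z (fst k) - mvpow ?G z (snd k)) \<in> eqns (quotient_germ \<Lambda> I)"
    if "k \<in> prim_relations" for k
  proof -
    have k: "fst k \<in> exps ?G" "snd k \<in> exps ?G" "\<mu> (fst k) = \<mu> (snd k)"
      using that by (auto simp: prim_relations_def relations_def)
    then have k': "keys (fst k) \<subseteq> ?G" "keys (snd k) \<subseteq> ?G" by (auto simp: exps_def)
    \<comment> \<open>The binomial as a polynomial: both of its monomials become the character of
      \<open>\<mu> (fst k)\<close> in the monoid algebra and cancel.\<close>
    define P :: "(_ \<Rightarrow>\<^sub>0 nat) \<Rightarrow>\<^sub>0 complex"
      where "P = Poly_Mapping.single (fst k) 1 + Poly_Mapping.single (snd k) (- 1)"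
    have "keys P \<subseteq> {fst k, snd k}"
      unfolding P_def using keys_add[of "Poly_Mapping.single (fst k) (1::complex)" "Poly_Mapping.single (snd k) (- 1)"]
      by (simp add: insert_commute)
    then have "P \<in> polys_in ?G" using k' by (auto simp: polys_in_def)
    moreover have "poly_subst (Poly_Mapping.single 0) (\<lambda>x. x) P = 0"
      using k(3) unfolding P_def
      by (simp add: poly_subst_add single_add poly_subst_single prod_residual_gens[OF k'(1)] prod_residual_gens[OF k'(2)]
          character_monomial_def Poly_Mapping.mult_single flip: single_add)
    moreover have "poly_subst (\<lambda>c. c) z P = mvpow ?G z (fst k) - mvpow ?G z (snd k)" for z
      by (simp add: P_def poly_subst_add poly_subst_single mvpow_keys[OF finite_G k(1)] mvpow_keys[OF finite_G k(2)])
    ultimately have "(\<lambda>z. mvpow ?G z (fst k) - mvpow ?G z (snd k)) \<in> B"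
      unfolding B_def by (intro UnI2 CollectI exI[of _ P]) auto
    then show ?thesis using BE by blast
  qed
  have "K \<subseteq> eqns (quotient_germ \<Lambda> I)"
  proof
    fix g assume "g \<in> K"
    then have g: "holomorphic_at ?G (\<lambda>_. 0) g" "\<forall>\<^sub>F w in ?N. g (q w) = 0"
      by (auto simp: K_def residual_quotient_map_eq)
    from kernel_generated[OF this] obtain h where
      h: "\<And>k. k \<in> prim_relations \<Longrightarrow> holomorphic_at ?G (\<lambda>_. 0) (h k)"
      "\<forall>\<^sub>F z in germ_nhds ?G (\<lambda>_. 0). g z = (\<Sum>k\<in>prim_relations. h k z * (mvpow ?G z (fst k) - mvpow ?G z (snd k)))"
      by blast
    let ?S = "\<lambda>z. \<Sum>k\<in>prim_relations. h k z * (mvpow ?G z (fst k) - mvpow ?G z (snd k))"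
    have "?S \<in> eqns (quotient_germ \<Lambda> I)"
      by (intro ideal_hol_ring_sum[OF G ideal] D(4) rel h(1))
    \<comment> \<open>The division holds only near 0; the discrepancy lies in the null ideal, which
      is among the generators.\<close>
    moreover have "(\<lambda>z. g z - ?S z) \<in> null_ideal ?G (\<lambda>_. 0)"
      using h(2) by (simp add: null_ideal_def)
    ultimately have "(\<lambda>z. (g z - ?S z) + ?S z) \<in> eqns (quotient_germ \<Lambda> I)"
      using null by (intro D(3)) auto
    then show "g \<in> eqns (quotient_germ \<Lambda> I)" by simp
  qed
  with sub show "g \<in> eqns (quotient_germ \<Lambda> I) \<longleftrightarrow> holomorphic_at ?G (\<lambda>_. 0) g \<and>
     (\<forall>\<^sub>F w in ?N. g (?q w) = 0)" for g
    by (auto simp: K_def)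
qed

lemma detected_quotient_germ:
  "detected_germ (quotient_germ \<Lambda> I) (germ_nhds (- I) (\<lambda>_. 0)) (residual_quotient_map \<Lambda> I)"
  by (simp add: detected_germ_def coords_quotient_germ base_quotient_germ finite_residual_gens
      eqns_quotient_germ_iff cspace_def)

lemma analytic_quotient_germ: "analytic_germ (quotient_germ \<Lambda> I)"
proof -
  have "g (\<lambda>_. 0) = 0" if "g \<in> eqns (quotient_germ \<Lambda> I)" for g
  proof -
    have "\<forall>\<^sub>F w in germ_nhds (- I) (\<lambda>_. 0). g (residual_quotient_map \<Lambda> I w) = 0"
      using that by (simp add: eqns_quotient_germ_iff)
    from eventually_germ_nhds_base[OF this] show ?thesis
      by (simp add: residual_quotient_map_zero cspace_def)
  qed
  then show ?thesis
    by (simp add: analytic_germ_def coords_quotient_germ base_quotient_germ finite_residual_gens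
        ideal_eqns_quotient_germ null_ideal_quotient_germ cspace_def)
qed

lemma germ_map_residual_quotient_map:
  "germ_map (affine_germ (- I)) (quotient_germ \<Lambda> I) (residual_quotient_map \<Lambda> I)"
  by (auto simp: germ_map_def affine_germ_def coords_quotient_germ base_quotient_germ
      residual_quotient_map_cspace holomorphic_residual_quotient_map residual_quotient_map_zero
      eqns_quotient_germ_iff null_ideal_def)

section \<open>Invariant maps\<close>

lemma weight_scale: "weight L (c *s v) = c * weight L v"
  by (simp add: weight_def sum_distrib_left mult.left_commute)

lemma residual_algebra_scale: "v \<in> residual_algebra \<Lambda> I \<Longrightarrow> c *s v \<in> residual_algebra \<Lambda> I"
  by (simp add: residual_algebra_def weight_scale)

lemma continuous_weight: "continuous_on UNIV (weight L)"
  unfolding weight_def by (intro continuous_intros)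

lemma eventually_nhdsin_top_of_set:
  assumes "v \<in> h" "eventually P (nhds v)"
  shows "eventually (\<lambda>x. x \<in> h \<and> P x) (nhdsin (top_of_set h) v)"
proof -
  obtain S where "open S" "v \<in> S" "\<forall>x\<in>S. P x" using assms(2) by (auto simp: eventually_nhds)
  with assms(1) show ?thesis
    unfolding eventually_nhdsin by (intro disjI2 exI[of _ "h \<inter> S"]) (auto simp: openin_open)
qed

section \<open>Arrows near the locus of the zero point\<close>

lemma eventually_arrows:
  "eventually P (arrows (residual_stack \<Lambda> I)) \<longleftrightarrow> (\<forall>v\<in>residual_algebra \<Lambda> I.
     eventually P (nhdsin (top_of_set (residual_algebra \<Lambda> I)) v \<times>\<^sub>F germ_nhds (- I) (\<lambda>_. 0)))"
  by (simp add: residual_stack_def eventually_Sup)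

text \<open>Every neighbourhood of \<open>v\<close> contains \<open>v\<close>, so a property of the
  arrows near \<open>(v, 0)\<close> can be specialised to \<open>v\<close> itself. Coefficients are
  compared for one \<open>v\<close> at a time.\<close>

lemma eventually_arrowsD:
  assumes "eventually P (arrows (residual_stack \<Lambda> I))" "v \<in> residual_algebra \<Lambda> I"
  shows "\<forall>\<^sub>F w in germ_nhds (- I) (\<lambda>_. 0). P (v, w)"
proof -
  obtain Pf Pg where "eventually Pf (nhdsin (top_of_set (residual_algebra \<Lambda> I)) v)"
    and g: "eventually Pg (germ_nhds (- I) (\<lambda>_. 0))" and P: "\<And>x y. Pf x \<Longrightarrow> Pg y \<Longrightarrow> P (x, y)"
    using assms unfolding eventually_arrows eventually_prod_filter by blast
  then have "Pf v" using assms(2) by (auto simp: eventually_nhdsin)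
  with g P show ?thesis by (auto elim: eventually_mono)
qed

lemma filterlim_src: "filterlim (src (residual_stack \<Lambda> I)) (germ_nhds (- I) (\<lambda>_. 0)) (arrows (residual_stack \<Lambda> I))"
proof -
  have "eventually (\<lambda>x. P (src (residual_stack \<Lambda> I) x)) (arrows (residual_stack \<Lambda> I))"
    if "eventually P (germ_nhds (- I) (\<lambda>_. 0))" for P
    unfolding eventually_arrows
  proof
    fix v assume "v \<in> residual_algebra \<Lambda> I"
    show "eventually (\<lambda>x. P (src (residual_stack \<Lambda> I) x))
        (nhdsin (top_of_set (residual_algebra \<Lambda> I)) v \<times>\<^sub>F germ_nhds (- I) (\<lambda>_. 0))"
      using eventually_prodI[OF eventually_True that] by (simp add: residual_stack_def case_prod_unfold)
  qed
  then show ?thesis by (simp add: filterlim_iff)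
qed

text \<open>Near a fixed \<open>v\<close> the exponentials stay below a common bound
  \<open>K\<close>, so radius \<open>r / K\<close> is carried into radius \<open>r\<close>. The
  bound depends on \<open>v\<close>, which is harmless since neighbourhoods of the locus may shrink
  along it.\<close>

lemma filterlim_tgt:
  fixes \<Lambda> :: "'n::finite \<Rightarrow> complex ^ 'k"
  shows "filterlim (tgt (residual_stack \<Lambda> I)) (germ_nhds (- I) (\<lambda>_. 0)) (arrows (residual_stack \<Lambda> I))"
proof -
  have "eventually (\<lambda>x. P (tgt (residual_stack \<Lambda> I) x)) (arrows (residual_stack \<Lambda> I))"
    if P: "eventually P (germ_nhds (- I) (\<lambda>_. 0))" for P
    unfolding eventually_arrows
  proof
    fix v assume v: "v \<in> residual_algebra \<Lambda> I"
    obtain r where r: "0 < r" "\<And>w. w \<in> polydisc (- I) (\<lambda>_. 0) r \<Longrightarrow> P w"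
      using P by (auto simp: eventually_germ_nhds)
    \<comment> \<open>The summand 1 makes the bound strict at \<open>v\<close>, hence stable under
      small changes of \<open>v\<close>.\<close>
    define K where "K = 1 + (\<Sum>j\<in>UNIV. norm (exp (weight (\<Lambda> j) v)))"
    have K: "0 < K" unfolding K_def by (intro add_pos_nonneg sum_nonneg) auto
    have "\<forall>\<^sub>F v' in nhds v. norm (exp (weight (\<Lambda> j) v')) < K" for j
    proof -
      have "norm (exp (weight (\<Lambda> j) v)) \<le> (\<Sum>j\<in>UNIV. norm (exp (weight (\<Lambda> j) v)))"
        by (rule member_le_sum) auto
      then have "norm (exp (weight (\<Lambda> j) v)) < K" by (simp add: K_def)
      moreover have "continuous_on UNIV (\<lambda>v. norm (exp (weight (\<Lambda> j) v)))"
        by (intro continuous_intros continuous_weight)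
      then have "isCont (\<lambda>v. norm (exp (weight (\<Lambda> j) v))) v"
        by (rule continuous_on_interior) simp
      then have "((\<lambda>v. norm (exp (weight (\<Lambda> j) v))) \<longlongrightarrow> norm (exp (weight (\<Lambda> j) v))) (nhds v)"
        unfolding isCont_def
        by (rule tendsto_at_iff_tendsto_nhds[where g = "\<lambda>v. norm (exp (weight (\<Lambda> j) v))", THEN iffD1])
      ultimately show ?thesis by (intro order_tendstoD(2))
    qed
    then have "\<forall>\<^sub>F v' in nhds v. \<forall>j. norm (exp (weight (\<Lambda> j) v')) < K"
      by (rule eventually_all_finite)
    from eventually_nhdsin_top_of_set[OF v this]
    have 1: "\<forall>\<^sub>F v' in nhdsin (top_of_set (residual_algebra \<Lambda> I)) v. \<forall>j. norm (exp (weight (\<Lambda> j) v')) < K"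
      by (rule eventually_mono) auto
    have 2: "\<forall>\<^sub>F w in germ_nhds (- I) (\<lambda>_. 0). w \<in> polydisc (- I) (\<lambda>_. 0) (r / K)"
      unfolding eventually_germ_nhds using r K by (intro exI[of _ "r / K"]) auto
    from eventually_prodI[OF 1 2]
    show "eventually (\<lambda>x. P (tgt (residual_stack \<Lambda> I) x))
        (nhdsin (top_of_set (residual_algebra \<Lambda> I)) v \<times>\<^sub>F germ_nhds (- I) (\<lambda>_. 0))"
    proof eventually_elim
      case (elim x)
      have "norm (exp (weight (\<Lambda> j) (fst x)) * snd x j) < r" if "j \<in> - I" for j
      proof -
        have "norm (snd x j) < r / K" using elim that by (auto simp: polydisc_def)
        then have lt: "K * norm (snd x j) < r" using K by (simp add: field_simps)
        have "norm (exp (weight (\<Lambda> j) (fst x))) * norm (snd x j) \<le> K * norm (snd x j)"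
          using elim by (intro mult_right_mono) (auto intro: less_imp_le)
        with lt have "norm (exp (weight (\<Lambda> j) (fst x))) * norm (snd x j) < r" by linarith
        then show ?thesis by (simp add: norm_mult)
      qed
      then have "residual_action \<Lambda> (fst x) (snd x) \<in> polydisc (- I) (\<lambda>_. 0) r"
        using elim by (auto simp: polydisc_def cspace_def residual_action_def)
      then show ?case using r(2) by (simp add: residual_stack_def case_prod_unfold)
    qed
  qed
  then show ?thesis by (simp add: filterlim_iff)
qed

abbreviation invariant_map where
  "invariant_map \<Lambda> I F \<equiv> (\<forall>\<^sub>F x in arrows (residual_stack \<Lambda> I).
     F (src (residual_stack \<Lambda> I) x) = F (tgt (residual_stack \<Lambda> I) x))"

lemma objects_residual_stack [simp]: "objects (residual_stack \<Lambda> I) = affine_germ (- I)"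
  by (simp add: residual_stack_def)

text \<open>Representatives of one class agree near 0, and both ends of an arrow tend to 0 along the
  arrow filter. Invariance therefore passes from one representative to all others.\<close>

lemma class_in_Hom_AnSt_iff:
  fixes \<Lambda> :: "'n::finite \<Rightarrow> complex ^ 'k"
  assumes Y: "finite (coords Y)" and F: "germ_map (affine_germ (- I)) Y F"
  shows "germ_map_rel (affine_germ (- I)) Y `` {F} \<in> Hom_AnSt (residual_stack \<Lambda> I) Y \<longleftrightarrow> invariant_map \<Lambda> I F"
proof -
  note D = germ_map_rel_detected[OF detected_affine_germ Y, of "- I", OF finite]
  show ?thesis
  proof
    assume "germ_map_rel (affine_germ (- I)) Y `` {F} \<in> Hom_AnSt (residual_stack \<Lambda> I) Y"
    moreover have "F \<in> germ_map_rel (affine_germ (- I)) Y `` {F}" using F by (simp add: D)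
    ultimately show "invariant_map \<Lambda> I F" unfolding Hom_AnSt_def by blast
  next
    assume inv: "invariant_map \<Lambda> I F"
    have "invariant_map \<Lambda> I F'" if "F' \<in> germ_map_rel (affine_germ (- I)) Y `` {F}" for F'
    proof -
      have ev: "\<forall>\<^sub>F w in germ_nhds (- I) (\<lambda>_. 0). F w = F' w" using that by (simp add: D)
      from inv filterlim_iff[THEN iffD1, OF filterlim_src, rule_format, OF ev, of \<Lambda>]
        filterlim_iff[THEN iffD1, OF filterlim_tgt, rule_format, OF ev, of \<Lambda>]
      show ?thesis by eventually_elim simp
    qed
    then show "germ_map_rel (affine_germ (- I)) Y `` {F} \<in> Hom_AnSt (residual_stack \<Lambda> I) Y"
      using F by (auto simp: Hom_AnSt_def Hom_An_iff)
  qed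
qed

section \<open>Invariant power series and their factorization\<close>

lemma mvpow_residual_action:
  "mvpow A (residual_action \<Lambda> v w) \<alpha> =
     exp (\<Sum>j\<in>A. of_nat (lookup \<alpha> j) * weight (\<Lambda> j) v) * mvpow A w \<alpha>"
proof (cases "finite A")
  case True
  then show ?thesis
    by (simp add: mvpow_def residual_action_def power_mult_distrib prod.distrib exp_sum exp_of_nat_mult)
qed (simp add: mvpow_def)

lemma residual_quotient_map_action:
  assumes "v \<in> residual_algebra \<Lambda> I"
  shows "residual_quotient_map \<Lambda> I (residual_action \<Lambda> v w) = residual_quotient_map \<Lambda> I w"
proof -
  interpret monomial_map "- I" "residual_gens \<Lambda> I" gen_exponent by (rule monomial_map_residual)
  have "mvpow (- I) (residual_action \<Lambda> v w) (gen_exponent x) = mvpow (- I) w (gen_exponent x)"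
    if "x \<in> residual_gens \<Lambda> I" for x
    using residual_gens_exponent(2)[OF that] assms
    by (simp add: mvpow_residual_action residual_monoid_def)
  then show ?thesis by (auto simp: residual_quotient_map_eq q_def)
qed

lemma invariant_residual_quotient_map: "invariant_map \<Lambda> I (residual_quotient_map \<Lambda> I)"
  unfolding eventually_arrows
proof
  fix v assume v: "v \<in> residual_algebra \<Lambda> I"
  have "\<forall>\<^sub>F v' in nhdsin (top_of_set (residual_algebra \<Lambda> I)) v. v' \<in> residual_algebra \<Lambda> I"
    using eventually_nhdsin_top_of_set[OF v eventually_True] by (rule eventually_mono) simp
  from eventually_prodI[OF this eventually_True]
  show "\<forall>\<^sub>F x in nhdsin (top_of_set (residual_algebra \<Lambda> I)) v \<times>\<^sub>F germ_nhds (- I) (\<lambda>_. 0).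
      residual_quotient_map \<Lambda> I (src (residual_stack \<Lambda> I) x) =
      residual_quotient_map \<Lambda> I (tgt (residual_stack \<Lambda> I) x)"
    by eventually_elim (simp add: residual_stack_def case_prod_unfold residual_quotient_map_action)
qed

text \<open>Equating coefficients in \<open>f w = f (v \<cdot> w)\<close> gives
  \<open>exp (?X \<alpha> v) = 1\<close>, which only places \<open>?X \<alpha> v\<close> in
  \<open>2\<pi>i\<int>\<close>. As this holds on a whole complex vector space, on which
  \<open>?X \<alpha>\<close> is linear, the value is 0.\<close>

lemma invariant_series_support:
  fixes \<Lambda> :: "'n::finite \<Rightarrow> complex ^ 'k"
  assumes inv: "invariant_map \<Lambda> I f"
    and c: "\<forall>\<^sub>F w in germ_nhds (- I) (\<lambda>_. 0). ((\<lambda>\<alpha>. c \<alpha> * mvpow (- I) w \<alpha>) has_sum f w) (exps (- I))"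
    and \<alpha>: "\<alpha> \<in> exps (- I)" "c \<alpha> \<noteq> 0"
  shows "\<alpha> \<in> residual_monoid \<Lambda> I"
proof -
  let ?X = "\<lambda>\<alpha> v. \<Sum>j\<in>- I. of_nat (lookup \<alpha> j) * weight (\<Lambda> j) v"
  have e1: "exp (?X \<alpha> v) = 1" if v: "v \<in> residual_algebra \<Lambda> I" for v
  proof -
    have t: "\<forall>\<^sub>F w in germ_nhds (- I) (\<lambda>_. 0).
        ((\<lambda>\<alpha>. c \<alpha> * mvpow (- I) (residual_action \<Lambda> v w) \<alpha>) has_sum f (residual_action \<Lambda> v w)) (exps (- I))"
      using eventually_arrowsD[OF filterlim_iff[THEN iffD1, OF filterlim_tgt, rule_format, OF c] v]
      by (simp add: residual_stack_def)
    have i: "\<forall>\<^sub>F w in germ_nhds (- I) (\<lambda>_. 0). f w = f (residual_action \<Lambda> v w)"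
      using eventually_arrowsD[OF inv v] by (simp add: residual_stack_def)
    from t i c have "\<forall>\<^sub>F w in germ_nhds (- I) (\<lambda>_. 0).
        ((\<lambda>\<alpha>. c \<alpha> * (exp (?X \<alpha> v) - 1) * mvpow (- I) w \<alpha>) has_sum 0) (exps (- I))"
    proof eventually_elim
      case (elim w)
      have "((\<lambda>\<alpha>. c \<alpha> * mvpow (- I) (residual_action \<Lambda> v w) \<alpha> + - 1 * (c \<alpha> * mvpow (- I) w \<alpha>)) has_sum
          (f w + - 1 * f w)) (exps (- I))"
        using elim by (intro has_sum_add has_sum_cmult_right) simp_all
      then show ?case by (simp add: mvpow_residual_action algebra_simps)
    qed
    from coeffs_eq_zero_eventually[OF finite this \<alpha>(1)] \<alpha>(2) show ?thesis by simp
  qed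
  have "?X \<alpha> v = 0" if v: "v \<in> residual_algebra \<Lambda> I" for v
  proof (rule ccontr)
    assume "?X \<alpha> v \<noteq> 0"
    moreover have "?X \<alpha> (c *s v) = c * ?X \<alpha> v" for c
      by (simp add: weight_scale sum_distrib_left mult.left_commute)
    \<comment> \<open>Rescaling \<open>v\<close> by the inverse of its supposed nonzero value yields
      a vector of value 1, where \<open>exp\<close> is not 1.\<close>
    ultimately have "?X \<alpha> ((1 / ?X \<alpha> v) *s v) = 1" by simp
    with e1[OF residual_algebra_scale[OF v, of "1 / ?X \<alpha> v"]] have "exp (1 :: complex) = 1" by simp
    then have "norm (exp (1 :: complex)) = 1" by simp
    then show False by simp
  qed
  then show ?thesis using \<alpha>(1) by (simp add: residual_monoid_def exps_def)
qed

text \<open>The coordinates of \<open>F\<close> are lifted independently of each other. That the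
  resulting map still respects the ideal of \<open>Y\<close> comes from
  \<open>f \<circ> \<Phi> \<circ> q = f \<circ> F = 0\<close> near 0 for every equation
  \<open>f\<close>: by \<open>eqns_quotient_germ_iff\<close> this already puts
  \<open>f \<circ> \<Phi>\<close> into the ideal of the quotient germ.\<close>

lemma invariant_map_factors:
  fixes \<Lambda> :: "'n::finite \<Rightarrow> complex ^ 'k"
  assumes Y: "analytic_germ Y" and F: "germ_map (affine_germ (- I)) Y F" and inv: "invariant_map \<Lambda> I F"
  shows "\<exists>\<Phi>. germ_map (quotient_germ \<Lambda> I) Y \<Phi> \<and>
    (\<forall>\<^sub>F w in germ_nhds (- I) (\<lambda>_. 0). \<Phi> (residual_quotient_map \<Lambda> I w) = F w)"
proof -
  interpret monomial_map "- I" "residual_gens \<Lambda> I" gen_exponent by (rule monomial_map_residual)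
  let ?G = "residual_gens \<Lambda> I" and ?q = "residual_quotient_map \<Lambda> I"
  let ?N = "germ_nhds (- I) (\<lambda>_. 0 :: complex)"
  have finY: "finite (coords Y)" using Y by (simp add: analytic_germ_def)
  have "\<exists>g. holomorphic_at ?G (\<lambda>_. 0) g \<and> (\<forall>\<^sub>F w in ?N. g (q w) = F w b)" if b: "b \<in> coords Y" for b
  proof (rule lift_holomorphic)
    show "holomorphic_at (- I) (\<lambda>_. 0) (\<lambda>w. F w b)"
      using F b by (simp add: germ_map_def affine_germ_def)
    fix c \<alpha> assume c: "\<forall>\<^sub>F w in ?N. ((\<lambda>\<alpha>. c \<alpha> * mvpow (- I) w \<alpha>) has_sum F w b) (exps (- I))"
      "\<alpha> \<in> exps (- I)" "c \<alpha> \<noteq> 0"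
    have "invariant_map \<Lambda> I (\<lambda>w. F w b)" using inv by (rule eventually_mono) simp
    from invariant_series_support[OF this c] have "\<alpha> \<in> residual_monoid \<Lambda> I" .
    then obtain \<beta> where \<beta>: "keys \<beta> \<subseteq> ?G" "(\<Prod>x\<in>keys \<beta>. x ^ lookup \<beta> x) = character_monomial \<alpha>"
      using residual_monomial_generated by blast
    then have "character_monomial (\<mu> \<beta>) = character_monomial \<alpha>"
      by (simp add: prod_residual_gens)
    then have "\<mu> \<beta> = \<alpha>" by (metis gen_exponent)
    then show "\<alpha> \<in> \<mu> ` exps ?G" using \<beta>(1) by (auto simp: exps_def)
  qed
  then have "\<forall>b\<in>coords Y. \<exists>g. holomorphic_at ?G (\<lambda>_. 0) g \<and> (\<forall>\<^sub>F w in ?N. g (q w) = F w b)"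
    by blast
  from bchoice[OF this] obtain g where g: "\<And>b. b \<in> coords Y \<Longrightarrow> holomorphic_at ?G (\<lambda>_. 0) (g b)"
    "\<And>b. b \<in> coords Y \<Longrightarrow> \<forall>\<^sub>F w in ?N. g b (q w) = F w b" by blast
  define \<Phi> where "\<Phi> z b = (if b \<in> coords Y then g b z else 0)" for z b
  have cs: "\<Phi> z \<in> cspace (coords Y)" for z by (simp add: \<Phi>_def cspace_def)
  have "\<forall>\<^sub>F w in ?N. \<forall>b\<in>coords Y. g b (q w) = F w b"
    using g(2) by (simp add: eventually_ball_finite_distrib[OF finY])
  then have ev: "\<forall>\<^sub>F w in ?N. \<Phi> (?q w) = F w"
  proof eventually_elim
    case (elim w)
    have "F w \<in> cspace (coords Y)" using F by (simp add: germ_map_def)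
    then show ?case
      by (rule cspace_eqI[OF cs]) (use elim in \<open>simp add: \<Phi>_def residual_quotient_map_eq\<close>)
  qed
  \<comment> \<open>An eventual equality holds at the base point itself, and the quotient map sends
    0 to 0.\<close>
  have base: "\<Phi> (\<lambda>_. 0) = base Y"
    using eventually_germ_nhds_base[OF ev] F
    by (simp add: residual_quotient_map_zero cspace_def[of "- I"] germ_map_def affine_germ_def)
  have hol: "holomorphic_at ?G (\<lambda>_. 0) (\<lambda>z. \<Phi> z b)" if "b \<in> coords Y" for b
    using g(1)[OF that] that by (simp add: \<Phi>_def)
  have "f \<circ> \<Phi> \<in> eqns (quotient_germ \<Lambda> I)" if f: "f \<in> eqns Y" for f
  proof -
    have "holomorphic_at (coords Y) (base Y) f"
      using Y f ideal_hol_ringD(1) unfolding analytic_germ_def by blast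
    then have "holomorphic_at ?G (\<lambda>_. 0) (f \<circ> \<Phi>)"
      using holomorphic_at_compose[OF finite_G _ finY cs hol, of f] base by (simp add: cspace_def)
    moreover have "\<forall>\<^sub>F w in ?N. f (F w) = 0"
      using F f by (simp add: germ_map_def affine_germ_def null_ideal_def)
    with ev have "\<forall>\<^sub>F w in ?N. (f \<circ> \<Phi>) (?q w) = 0" by eventually_elim simp
    ultimately show ?thesis by (simp add: eqns_quotient_germ_iff)
  qed
  then have "germ_map (quotient_germ \<Lambda> I) Y \<Phi>"
    by (simp add: germ_map_def cs hol base coords_quotient_germ base_quotient_germ)
  with ev show ?thesis by blast
qed

section \<open>The universal property\<close>

lemma stack_comp_class:
  fixes \<Lambda> :: "'n::finite \<Rightarrow> complex ^ 'k"
  assumes "finite (coords Y)" and "germ_map (quotient_germ \<Lambda> I) Y \<Phi>"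
  shows "germ_comp (affine_germ (- I)) Y (germ_map_rel (quotient_germ \<Lambda> I) Y `` {\<Phi>}) (quotient_morphism \<Lambda> I) =
    germ_map_rel (affine_germ (- I)) Y `` {\<Phi> \<circ> residual_quotient_map \<Lambda> I}"
  unfolding quotient_morphism_def
  by (rule germ_comp_class[OF detected_affine_germ[OF finite] analytic_quotient_germ assms(1)
        germ_map_residual_quotient_map assms(2)])

theorem proposition7p5:
  fixes \<Lambda> :: "'n::finite \<Rightarrow> complex ^ 'k" and I :: "'n set"
  assumes "vec.span (range \<Lambda>) = UNIV"
    and "singular_support \<Lambda> I"
  shows "analytic_germ (quotient_germ \<Lambda> I) \<and>
    residual_quotient_map \<Lambda> I \<in> quotient_morphism \<Lambda> I \<and>
    quotient_morphism \<Lambda> I \<in> Hom_AnSt (residual_stack \<Lambda> I) (quotient_germ \<Lambda> I) \<and>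
    (\<forall>Y :: 'b germ. analytic_germ Y \<longrightarrow>
      bij_betw (\<lambda>f. stack_comp (residual_stack \<Lambda> I) Y f (quotient_morphism \<Lambda> I))
        (Hom_An (quotient_germ \<Lambda> I) Y) (Hom_AnSt (residual_stack \<Lambda> I) Y)) \<and>
    (\<forall>(Y :: 'b germ) (Y' :: 'c germ). analytic_germ Y \<longrightarrow> analytic_germ Y' \<longrightarrow>
      (\<forall>\<phi>\<in>Hom_An Y Y'.
        (\<forall>F\<in>Hom_AnSt (residual_stack \<Lambda> I) Y.
          stack_comp (residual_stack \<Lambda> I) Y' \<phi> F \<in> Hom_AnSt (residual_stack \<Lambda> I) Y') \<and>
        (\<forall>f\<in>Hom_An (quotient_germ \<Lambda> I) Y.
          stack_comp (residual_stack \<Lambda> I) Y' (germ_comp (quotient_germ \<Lambda> I) Y' \<phi> f) (quotient_morphism \<Lambda> I) =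
          stack_comp (residual_stack \<Lambda> I) Y' \<phi> (stack_comp (residual_stack \<Lambda> I) Y f (quotient_morphism \<Lambda> I)))))"
proof -
  let ?X = "affine_germ (- I)" and ?Q = "quotient_germ \<Lambda> I" and ?q = "residual_quotient_map \<Lambda> I"
  let ?S = "residual_stack \<Lambda> I"
  note dX = detected_affine_germ[of "- I", OF finite]
  note dQ = detected_quotient_germ[of \<Lambda> I]
  have fX: "finite (coords ?X)" "base ?X \<in> cspace (coords ?X)" using dX by (auto simp: detected_germ_def)
  have fQ: "finite (coords ?Q)" "base ?Q \<in> cspace (coords ?Q)" using dQ by (auto simp: detected_germ_def)
  note q = germ_map_residual_quotient_map[of I \<Lambda>]
  have inv_comp: "invariant_map \<Lambda> I (\<Phi> \<circ> F)" if "invariant_map \<Lambda> I F"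
    for \<Phi> :: "('d \<Rightarrow> complex) \<Rightarrow> 'e" and F
    using that by (rule eventually_mono) simp
  have "?q \<in> quotient_morphism \<Lambda> I"
    unfolding quotient_morphism_def using q by (simp add: germ_map_rel_detected[OF dX fQ(1)])
  moreover have "quotient_morphism \<Lambda> I \<in> Hom_AnSt ?S ?Q"
    unfolding quotient_morphism_def class_in_Hom_AnSt_iff[OF fQ(1) q] by (rule invariant_residual_quotient_map)
  moreover have "bij_betw (\<lambda>f. stack_comp ?S Y f (quotient_morphism \<Lambda> I)) (Hom_An ?Q Y) (Hom_AnSt ?S Y)"
    if Y: "analytic_germ Y" for Y :: "'b germ"
  proof -
    have finY: "finite (coords Y)" using Y by (simp add: analytic_germ_def)
    have comp: "germ_map ?X Y (\<Phi> \<circ> ?q)" if "germ_map ?Q Y \<Phi>" for \<Phi>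
      by (rule germ_map_compose[OF fX fQ(1) q that])
    show ?thesis
    proof (rule bij_betw_imageI[OF inj_onI subset_antisym[OF subsetI subsetI]])
      fix f f' assume f: "f \<in> Hom_An ?Q Y" "f' \<in> Hom_An ?Q Y"
        and eq: "stack_comp ?S Y f (quotient_morphism \<Lambda> I) = stack_comp ?S Y f' (quotient_morphism \<Lambda> I)"
      obtain \<Phi> \<Phi>' where \<Phi>: "germ_map ?Q Y \<Phi>" "f = germ_map_rel ?Q Y `` {\<Phi>}"
        and \<Phi>': "germ_map ?Q Y \<Phi>'" "f' = germ_map_rel ?Q Y `` {\<Phi>'}"
        using f by (auto simp: Hom_An_iff)
      from eq have "germ_map_rel ?X Y `` {\<Phi> \<circ> ?q} = germ_map_rel ?X Y `` {\<Phi>' \<circ> ?q}"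
        by (simp add: \<Phi> \<Phi>' stack_comp_class[OF finY])
      \<comment> \<open>The affine germ is tested through the identity and the quotient germ through
        \<open>?q\<close>, along the same filter, so the criteria for equal classes
        coincide.\<close>
      then have "\<forall>\<^sub>F w in germ_nhds (- I) (\<lambda>_. 0). \<Phi> (?q w) = \<Phi>' (?q w)"
        by (simp add: germ_class_eq_iff[OF dX finY comp[OF \<Phi>(1)] comp[OF \<Phi>'(1)]])
      then show "f = f'"
        using germ_class_eq_iff[OF dQ finY \<Phi>(1) \<Phi>'(1)] by (simp add: \<Phi> \<Phi>')
    next
      fix F assume "F \<in> (\<lambda>f. stack_comp ?S Y f (quotient_morphism \<Lambda> I)) ` Hom_An ?Q Y"
      then obtain \<Phi> where \<Phi>: "germ_map ?Q Y \<Phi>" "F = germ_map_rel ?X Y `` {\<Phi> \<circ> ?q}"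
        by (auto simp: Hom_An_iff stack_comp_class[OF finY])
      then show "F \<in> Hom_AnSt ?S Y"
        using class_in_Hom_AnSt_iff[OF finY comp[OF \<Phi>(1)], of \<Lambda>]
          inv_comp[OF invariant_residual_quotient_map] by simp
    next
      fix f assume f: "f \<in> Hom_AnSt ?S Y"
      then obtain F where F: "germ_map ?X Y F" "f = germ_map_rel ?X Y `` {F}"
        by (auto simp: Hom_AnSt_def Hom_An_iff)
      with f have "invariant_map \<Lambda> I F" using class_in_Hom_AnSt_iff[OF finY F(1), of \<Lambda>] by simp
      from invariant_map_factors[OF Y F(1) this] obtain \<Phi> where \<Phi>: "germ_map ?Q Y \<Phi>"
        "\<forall>\<^sub>F w in germ_nhds (- I) (\<lambda>_. 0). \<Phi> (?q w) = F w" by blast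
      have "f = stack_comp ?S Y (germ_map_rel ?Q Y `` {\<Phi>}) (quotient_morphism \<Lambda> I)"
        using \<Phi>(2) germ_class_eq_iff[OF dX finY comp[OF \<Phi>(1)] F(1)]
        by (simp add: F(2) stack_comp_class[OF finY \<Phi>(1)])
      moreover have "germ_map_rel ?Q Y `` {\<Phi>} \<in> Hom_An ?Q Y"
        using \<Phi>(1) by (auto simp: Hom_An_iff)
      ultimately show "f \<in> (\<lambda>f. stack_comp ?S Y f (quotient_morphism \<Lambda> I)) ` Hom_An ?Q Y"
        by (rule image_eqI)
    qed
  qed
  moreover have "(\<forall>F\<in>Hom_AnSt ?S Y. stack_comp ?S Y' \<phi> F \<in> Hom_AnSt ?S Y') \<and>
      (\<forall>f\<in>Hom_An ?Q Y. stack_comp ?S Y' (germ_comp ?Q Y' \<phi> f) (quotient_morphism \<Lambda> I) =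
        stack_comp ?S Y' \<phi> (stack_comp ?S Y f (quotient_morphism \<Lambda> I)))"
    if Y: "analytic_germ Y" and Y': "analytic_germ Y'" and \<phi>: "\<phi> \<in> Hom_An Y Y'"
    for Y :: "'b germ" and Y' :: "'c germ" and \<phi>
  proof -
    have fin: "finite (coords Y)" "finite (coords Y')" using Y Y' by (auto simp: analytic_germ_def)
    obtain \<Psi> where \<Psi>: "germ_map Y Y' \<Psi>" "\<phi> = germ_map_rel Y Y' `` {\<Psi>}"
      using \<phi> by (auto simp: Hom_An_iff)
    have "stack_comp ?S Y' \<phi> f \<in> Hom_AnSt ?S Y'" if f: "f \<in> Hom_AnSt ?S Y" for f
    proof -
      obtain F where F: "germ_map ?X Y F" "f = germ_map_rel ?X Y `` {F}"
        using f by (auto simp: Hom_AnSt_def Hom_An_iff)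
      with f have "invariant_map \<Lambda> I F" using class_in_Hom_AnSt_iff[OF fin(1) F(1), of \<Lambda>] by simp
      then show ?thesis
        using class_in_Hom_AnSt_iff[OF fin(2) germ_map_compose[OF fX fin(1) F(1) \<Psi>(1)], of \<Lambda>]
          inv_comp[of F \<Psi>] by (simp add: F(2) \<Psi>(2) germ_comp_class[OF dX Y fin(2) F(1) \<Psi>(1)])
    qed
    moreover have "stack_comp ?S Y' (germ_comp ?Q Y' \<phi> f) (quotient_morphism \<Lambda> I) =
        stack_comp ?S Y' \<phi> (stack_comp ?S Y f (quotient_morphism \<Lambda> I))" if f: "f \<in> Hom_An ?Q Y" for f
    proof -
      obtain \<Phi> where \<Phi>: "germ_map ?Q Y \<Phi>" "f = germ_map_rel ?Q Y `` {\<Phi>}"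
        using f by (auto simp: Hom_An_iff)
      \<comment> \<open>Passing from classes to representatives reduces naturality to associativity
        of composition.\<close>
      have "stack_comp ?S Y' (germ_comp ?Q Y' \<phi> f) (quotient_morphism \<Lambda> I) =
          germ_map_rel ?X Y' `` {(\<Psi> \<circ> \<Phi>) \<circ> ?q}"
        by (simp add: \<Phi>(2) \<Psi>(2) germ_comp_class[OF dQ Y fin(2) \<Phi>(1) \<Psi>(1)]
            stack_comp_class[OF fin(2) germ_map_compose[OF fQ fin(1) \<Phi>(1) \<Psi>(1)]])
      also have "\<dots> = stack_comp ?S Y' \<phi> (stack_comp ?S Y f (quotient_morphism \<Lambda> I))"
        by (simp add: \<Phi>(2) \<Psi>(2) stack_comp_class[OF fin(1) \<Phi>(1)] o_assoc
            germ_comp_class[OF dX Y fin(2) germ_map_compose[OF fX fQ(1) q \<Phi>(1)] \<Psi>(1)])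
      finally show ?thesis .
    qed
    ultimately show ?thesis by blast
  qed
  ultimately show ?thesis using analytic_quotient_germ[of \<Lambda> I] by blast
qed

end
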